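(* For $\omega\in2^{\mathbb N\times\mathbb N}$ the following are equivalent: (1) $\omega$ is not Doob random; (2) $(M_{m,n}(\omega))$ diverges as $(m,n)\to\infty$ for some computable nonnegative $\mathbb N\times\mathbb N$-indexed martingale $(M_{m,n})$; (3) $(M_{m,n}(\omega))$ diverges as $(m,n)\to\infty$ for some computable rational-valued nonnegative $\mathbb N\times\mathbb N$-indexed martingale $(M_{m,n})$; (4) $\liminf_{m,n}M_{m,n}(\omega)=\infty$ for some computable rational-valued nonnegative $\mathbb N\times\mathbb N$-indexed martingale $(M_{m,n})$ and some computable function $k:\mathbb N\to\mathbb N$ such that $M_{m,n}=M_{m+1,0}$ for all $m$ and all $n\ge k(m)$.
   Context: $2^{\mathbb N\times\mathbb N}$ carries the uniform (fair-coin product) measure $\mathbb P$. $<$ is the lexicographic order on $\mathbb N\times\mathbb N$: $(k,\ell)<(m,n)$ iff $k<m$ or ($k=m$ and $\ell<n$). $\omega_{<(m,n)}=(\omega_{k,\ell})_{(k,\ell)<(m,n)}$. For integrable $f$, $\mathbb E_{m,n}(f)(\omega)$ is the expectation of $f(\omega')$ where $\omega'$ agrees with $\omega$ at all indices $<(m,n)$ and has independent fair random bits at all indices $\ge(m,n)$. An $\mathbb N\times\mathbb N$-indexed martingale is a family $(M_{m,n})$ of integrable functions such that a.s. $M_{m,n}(\omega)$ depends only on $(m,n)$ and $\omega_{<(m,n)}$, and $\mathbb E_{k,\ell}(M_{m,n})=M_{k,\ell}$ for $(k,\ell)\le(m,n)$; it is computable if $M_{m,n}(\omega)$ is uniformly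 computable from $(m,n)$ and $\omega$. A function $f$ into $\mathbb Q$ is computable rational-valued if $f(\omega)=q_{g(\omega)}$ for a fixed enumeration $(q_i)$ of $\mathbb Q$ and a computable $g$ into $\mathbb N$ (uniformly in the indices for a family). $M_{m,n}(\omega)\to a$ as $(m,n)\to\infty$ if for all $\varepsilon>0$ there is $(k,\ell)$ with $|M_{m,n}(\omega)-a|<\varepsilon$ for all $(m,n)>(k,\ell)$; $\limsup,\liminf$ are analogous; "diverges" means no real limit. Doob randomness: identify $2^{\mathbb N\times\mathbb N}$ with $(2^{\mathbb N})^{\mathbb N}$ via rows $\omega_m=(\omega_{m,0},\omega_{m,1},\dots)$; with $\omega_{<m}=(\omega_0,\dots,\omega_{m-1})$ and $\mathbb E_m=\mathbb E_{m,0}$, an $\mathbb N$-indexed martingale is $(M_m)$ with $M_m(\omega)$ a.s. depending only on $m,\omega_{<m}$ and $\mathbb E_jM_m=M_j$ for $j\le m$, computable if $M_m(\omega)$ is uniformly computable from $m,\omega_{<m}$; $\omega$ is Doob random if $(M_m(\omega))$ converges to a real for all nonnegative computable $\mathbb N$-indexed martingales. *)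

theory Defs
  imports "HOL-Probability.Probability"
begin

type_synonym bits = "nat \<times> nat \<Rightarrow> bool"

definition coin :: "bits measure" where
  "coin = (\<Pi>\<^sub>M i\<in>UNIV. measure_pmf (bernoulli_pmf (1/2)))"

definition lex_less :: "nat \<times> nat \<Rightarrow> nat \<times> nat \<Rightarrow> bool"  (infix "\<prec>" 50) where
  "p \<prec> q \<longleftrightarrow> fst p < fst q \<or> fst p = fst q \<and> snd p < snd q"

definition lex_le :: "nat \<times> nat \<Rightarrow> nat \<times> nat \<Rightarrow> bool"  (infix "\<preceq>" 50) where
  "p \<preceq> q \<longleftrightarrow> p \<prec> q \<or> p = q"

definition lex_at_top :: "(nat \<times> nat) filter" where
  "lex_at_top = (INF p. principal {q. p \<prec> q})"

text \<open>Limits along \<open>lex_at_top\<close> are thus the limits for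
  \<open>(m, n) \<rightarrow> \<infinity>\<close>: "for some \<open>p\<close>, for all \<open>q\<close> beyond \<open>p\<close>".\<close>

lemma eventually_lex_at_top:
  "eventually P lex_at_top \<longleftrightarrow> (\<exists>p. \<forall>q. p \<prec> q \<longrightarrow> P q)"
proof -
  have "eventually P lex_at_top \<longleftrightarrow> (\<exists>p\<in>UNIV. eventually P (principal {q. p \<prec> q}))"
    unfolding lex_at_top_def
  proof (rule eventually_INF_base)
    fix p r :: "nat \<times> nat"
    have "{q. p \<prec> q} \<subseteq> {q. r \<prec> q} \<or> {q. r \<prec> q} \<subseteq> {q. p \<prec> q}"
      by (cases p; cases r) (auto simp: lex_less_def)
    then show "\<exists>x\<in>UNIV. principal {q. x \<prec> q}
        \<le> inf (principal {q. p \<prec> q}) (principal {q. r \<prec> q})"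
      by (simp only: inf_principal principal_le_iff) blast
  qed auto
  then show ?thesis
    by (simp add: eventually_principal)
qed

lemma tendsto_lex_at_top_iff:
  fixes f :: "nat \<times> nat \<Rightarrow> real"
  shows "(f \<longlongrightarrow> a) lex_at_top \<longleftrightarrow>
    (\<forall>\<epsilon>>0. \<exists>p. \<forall>q. p \<prec> q \<longrightarrow> \<bar>f q - a\<bar> < \<epsilon>)"
  by (simp add: tendsto_iff eventually_lex_at_top dist_real_def)

definition resample :: "nat \<times> nat \<Rightarrow> bits \<Rightarrow> bits \<Rightarrow> bits" where
  "resample p \<omega> \<omega>' = (\<lambda>q. if q \<prec> p then \<omega> q else \<omega>' q)"

definition expect_from :: "nat \<times> nat \<Rightarrow> (bits \<Rightarrow> real) \<Rightarrow> bits \<Rightarrow> real" where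
  "expect_from p f \<omega> = (\<integral>\<omega>'. f (resample p \<omega> \<omega>') \<partial>coin)"

definition depends_only_below :: "nat \<times> nat \<Rightarrow> (bits \<Rightarrow> real) \<Rightarrow> bool" where
  "depends_only_below p f \<longleftrightarrow>
    (\<exists>g. AE \<omega> in coin. f \<omega> = g (restrict \<omega> {q. q \<prec> p}))"

definition lex_martingale :: "(nat \<times> nat \<Rightarrow> bits \<Rightarrow> real) \<Rightarrow> bool" where
  "lex_martingale M \<longleftrightarrow>
    (\<forall>p. integrable coin (M p)) \<and>
    (\<forall>p. depends_only_below p (M p)) \<and>
    (\<forall>p q. p \<preceq> q \<longrightarrow> (AE \<omega> in coin. expect_from p (M q) \<omega> = M p \<omega>))"

text \<open>The indices below \<open>(m, 0)\<close> are exactly those of the rows \<open>0, \<dots>, m - 1\<close>.\<close>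

definition row_martingale :: "(nat \<Rightarrow> bits \<Rightarrow> real) \<Rightarrow> bool" where
  "row_martingale M \<longleftrightarrow>
    (\<forall>m. integrable coin (M m)) \<and>
    (\<forall>m. depends_only_below (m, 0) (M m)) \<and>
    (\<forall>j m. j \<le> m \<longrightarrow> (AE \<omega> in coin. expect_from (j, 0) (M m) \<omega> = M j \<omega>))"

text \<open>Kleene's partial recursive functions relative to an oracle.\<close>

datatype recf =
    Zero | Succ | Proj nat | Query
  | Comp recf "recf list" | PrimRec recf recf | Mu recf

fun eval :: "bits \<Rightarrow> recf \<Rightarrow> nat list \<Rightarrow> nat option" where
  "eval \<omega> Zero xs = Some 0"
| "eval \<omega> Succ xs = (case xs of x # _ \<Rightarrow> Some (Suc x) | _ \<Rightarrow> None)"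
| "eval \<omega> (Proj i) xs = (if i < length xs then Some (xs ! i) else None)"
| "eval \<omega> Query xs = (case xs of i # j # _ \<Rightarrow> Some (of_bool (\<omega> (i, j))) | _ \<Rightarrow> None)"
| "eval \<omega> (Comp f gs) xs =
    Option.bind (those (map (\<lambda>g. eval \<omega> g xs) gs)) (eval \<omega> f)"
| "eval \<omega> (PrimRec f g) xs = (case xs of [] \<Rightarrow> None
    | n # ys \<Rightarrow> rec_nat (eval \<omega> f ys)
        (\<lambda>k r. Option.bind r (\<lambda>y. eval \<omega> g (k # y # ys))) n)"
| "eval \<omega> (Mu f) xs =
    (if \<exists>n. eval \<omega> f (n # xs) = Some 0 \<and> (\<forall>k<n. eval \<omega> f (k # xs) \<noteq> None)
     then Some (LEAST n. eval \<omega> f (n # xs) = Some 0) else None)"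

text \<open>The fixed enumeration of the rationals is the library's surjection
  \<^const>\<open>nat_to_rat_surj\<close>, built from the computable bijections
  \<^const>\<open>prod_decode\<close> and \<^const>\<open>int_decode\<close>.\<close>

definition enum_rat :: "nat \<Rightarrow> real" where
  "enum_rat i = of_rat (nat_to_rat_surj i)"

text \<open>The program \<open>e\<close> with oracle \<open>\<omega>\<close> and input \<open>xs\<close> computes the real number \<open>r\<close>:
  given an additional input \<open>i\<close>, it outputs the index of a rational within
  \<open>1 / 2 ^ i\<close> of \<open>r\<close>.\<close>

definition computes_real :: "recf \<Rightarrow> bits \<Rightarrow> nat list \<Rightarrow> real \<Rightarrow> bool" where
  "computes_real e \<omega> xs r \<longleftrightarrow>
    (\<forall>i. \<exists>c. eval \<omega> e (xs @ [i]) = Some c \<and> \<bar>enum_rat c - r\<bar> \<le> 1 / 2 ^ i)"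

definition computable_lex :: "(nat \<times> nat \<Rightarrow> bits \<Rightarrow> real) \<Rightarrow> bool" where
  "computable_lex M \<longleftrightarrow>
    (\<exists>e. \<forall>m n \<omega>. computes_real e \<omega> [m, n] (M (m, n) \<omega>))"

definition computable_rational_lex :: "(nat \<times> nat \<Rightarrow> bits \<Rightarrow> real) \<Rightarrow> bool" where
  "computable_rational_lex M \<longleftrightarrow>
    (\<exists>e. \<forall>m n \<omega>. \<exists>c. eval \<omega> e [m, n] = Some c \<and> M (m, n) \<omega> = enum_rat c)"

text \<open>Access to the first \<open>m\<close> rows only is expressed by blanking out all later rows
  of the oracle; no information is confused, since \<open>m\<close> is an input as well.\<close>

definition first_rows :: "nat \<Rightarrow> bits \<Rightarrow> bits" where
  "first_rows m \<omega> = (\<lambda>(i, j). i < m \<and> \<omega> (i, j))"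

definition computable_rows :: "(nat \<Rightarrow> bits \<Rightarrow> real) \<Rightarrow> bool" where
  "computable_rows M \<longleftrightarrow>
    (\<exists>e. \<forall>m \<omega>. computes_real e (first_rows m \<omega>) [m] (M m \<omega>))"

text \<open>Plain computability is computability relative to the empty oracle.\<close>

definition computable_nat :: "(nat \<Rightarrow> nat) \<Rightarrow> bool" where
  "computable_nat k \<longleftrightarrow> (\<exists>e. \<forall>x. eval (\<lambda>_. False) e [x] = Some (k x))"

definition Doob_random :: "bits \<Rightarrow> bool" where
  "Doob_random \<omega> \<longleftrightarrow>
    (\<forall>M. row_martingale M \<and> computable_rows M \<and> (\<forall>m \<omega>'. 0 \<le> M m \<omega>')
      \<longrightarrow> convergent (\<lambda>m. M m \<omega>))"

definition lex_diverges :: "(nat \<times> nat \<Rightarrow> real) \<Rightarrow> bool" where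
  "lex_diverges x \<longleftrightarrow> \<not> (\<exists>a. (x \<longlongrightarrow> a) lex_at_top)"

end

theory Submission
  imports Defs
begin

text \<open>Clearly (4) implies (3) and (3) implies (2), and from (4) the row martingale \<open>M (m, 0)\<close> tends
  to infinity at \<open>\<omega>\<close>, so \<open>\<omega>\<close> is not Doob random. That (1) and (2) imply (4) reduces to one
  construction, for a nonnegative computable row martingale \<open>N\<close> such that the conditional
  expectations \<open>E\<^sub>m\<^sub>,\<^sub>n N\<^sub>m\<^sub>+\<^sub>1\<close> diverge at \<open>\<omega>\<close>: for (1) let \<open>N\<close> be a row martingale
  that diverges at \<open>\<omega>\<close>, for (2) let \<open>N\<^sub>m = M\<^sub>m\<^sub>,\<^sub>0\<close>.

  By compactness of the space of bits, \<open>N\<^sub>m\<^sub>+\<^sub>1\<close> is within \<open>1 / 2\<^sup>m\<close> of a dyadic rational that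
  depends only on the bits with both indices below some computable \<open>k m\<close>. Averaging this
  approximation over the bits \<open>n, \<dots>, k m - 1\<close> of row \<open>m\<close> and taking differences in \<open>n\<close> gives
  rational martingale increments, whose sum \<open>X\<close> differs from \<open>E\<^sub>m\<^sub>,\<^sub>n N\<^sub>m\<^sub>+\<^sub>1\<close> by a convergent
  sequence. In row \<open>m\<close> only the finitely many times \<open>n < k m\<close> matter, so \<open>X\<close> is an ordinary
  sequence, and it diverges. Either \<open>X\<close> tends to infinity, or \<open>X\<close> crosses some rational interval
  infinitely often and the strategy that buys low and sells high makes the capital tend to
  infinity.\<close>

section \<open>Programs with an oracle\<close>

text \<open>The theorem concerns one fixed \<open>\<omega>\<close>, about which almost sure
  identities say nothing. But a computable function is uniformly continuous and every cylinder has
  positive measure, so the almost sure clauses of both martingale notions hold everywhere.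

  The approximations used in different rows do not fit together into a martingale. So only
  increments inside a row are bet on, and the jump from one row's approximation to the next is
  dropped. The precision doubles from row to row, so the resulting error is summable, with total at
  most 4; starting that much higher keeps the wealth nonnegative. Nonnegativity is demanded on every
  path, which is why the errors are bounded uniformly in \<open>\<omega>\<close>.

  An infinite row has no last bit, so a bettor needs to know when enough of it has been read.
  Compactness alone yields such a bound without computing it. Hence programs are accompanied by
  programs that bound how much of the oracle they consult.\<close>

definition agree :: "nat \<Rightarrow> bits \<Rightarrow> bits \<Rightarrow> bool" where
  "agree u \<omega> \<omega>' \<longleftrightarrow> (\<forall>i<u. \<forall>j<u. \<omega> (i, j) = \<omega>' (i, j))"

lemma agree_refl [simp]: "agree u \<omega> \<omega>"
  by (simp add: agree_def)

lemma agree_sym: "agree u \<omega> \<omega>' \<Longrightarrow> agree u \<omega>' \<omega>"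
  by (simp add: agree_def)

lemma agree_mono: "agree u \<omega> \<omega>' \<Longrightarrow> v \<le> u \<Longrightarrow> agree v \<omega> \<omega>'"
  by (simp add: agree_def)

lemma those_eq_Some: "those xs = Some ys \<longleftrightarrow> xs = map Some ys"
proof (induction xs arbitrary: ys)
  case (Cons x xs)
  then show ?case by (cases x; cases ys) auto
qed auto

lemma those_map_Some [simp]: "those (map Some xs) = Some xs"
  by (simp add: those_eq_Some)

lemma eval_Comp_eq_Some:
  "eval \<omega> (Comp f gs) xs = Some y \<longleftrightarrow>
    (\<exists>ys. map (\<lambda>g. eval \<omega> g xs) gs = map Some ys \<and> eval \<omega> f ys = Some y)"
  by (auto simp: bind_eq_Some_conv those_eq_Some)

lemma eval_CompI:
  assumes "map (\<lambda>g. eval \<omega> g xs) gs = map Some ys" "eval \<omega> f ys = r"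
  shows "eval \<omega> (Comp f gs) xs = r"
  using assms by simp

lemma map_Proj: "b \<le> length xs \<Longrightarrow>
    map (\<lambda>g. eval \<omega> g xs) (map Proj [a..<b]) = map Some (drop a (take b xs))"
  by (rule nth_equalityI) auto

lemma map_Proj_append:
  "length xs = n \<Longrightarrow> length ys = p \<Longrightarrow>
    map (\<lambda>g. eval \<omega> g (xs @ ys)) (map Proj [n..<n + p]) = map Some ys"
  by (subst map_Proj) auto

text \<open>Both recursions pass through the same intermediate values, so the second step function
  has to imitate the first only along these.\<close>

lemma rec_nat_bind_mono:
  assumes "rec_nat a (\<lambda>k r. Option.bind r (G k)) n = Some y"
    and "\<And>z. a = Some z \<Longrightarrow> a' = Some z"
    and "\<And>k y z. k < n \<Longrightarrow> rec_nat a (\<lambda>k r. Option.bind r (G k)) k = Some y \<Longrightarrow>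
      G k y = Some z \<Longrightarrow> G' k y = Some z"
  shows "rec_nat a' (\<lambda>k r. Option.bind r (G' k)) n = Some y"
  using assms
proof (induction n arbitrary: y)
  case (Suc n)
  from Suc.prems(1) obtain x where x: "rec_nat a (\<lambda>k r. Option.bind r (G k)) n = Some x"
    and g: "G n x = Some y" by (auto simp: bind_eq_Some_conv)
  have "rec_nat a' (\<lambda>k r. Option.bind r (G' k)) n = Some x"
    using Suc.IH[OF x] Suc.prems by simp
  then show ?case using Suc.prems(3)[OF _ x g] by simp
qed simp

text \<open>The least zero lies at or below the zero whose predecessors are known to be defined, so
  its own predecessors are defined too and, by minimality, positive.\<close>

lemma eval_Mu_eq_Some:
  "eval \<omega> (Mu f) xs = Some n \<longleftrightarrow>
    eval \<omega> f (n # xs) = Some 0 \<and> (\<forall>k<n. \<exists>y>0. eval \<omega> f (k # xs) = Some y)"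
proof
  assume *: "eval \<omega> (Mu f) xs = Some n"
  define P where "P n \<longleftrightarrow> eval \<omega> f (n # xs) = Some 0" for n
  from * have ex: "\<exists>n. P n \<and> (\<forall>k<n. eval \<omega> f (k # xs) \<noteq> None)" and n: "n = (LEAST n. P n)"
    by (auto simp: P_def split: if_splits)
  then obtain n0 where n0: "P n0" "\<forall>k<n0. eval \<omega> f (k # xs) \<noteq> None" by blast
  have "P n" unfolding n using n0(1) by (rule LeastI)
  moreover have "n \<le> n0" unfolding n using n0(1) by (rule Least_le)
  moreover have "\<not> P k" if "k < n" for k using that unfolding n by (rule not_less_Least)
  ultimately show "eval \<omega> f (n # xs) = Some 0 \<and> (\<forall>k<n. \<exists>y>0. eval \<omega> f (k # xs) = Some y)"
    using n0(2) unfolding P_def by (metis gr0I less_le_trans not_None_eq)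
next
  assume *: "eval \<omega> f (n # xs) = Some 0 \<and> (\<forall>k<n. \<exists>y>0. eval \<omega> f (k # xs) = Some y)"
  then have "(LEAST n. eval \<omega> f (n # xs) = Some 0) = n"
    by (intro Least_equality) (auto simp: not_less [symmetric])
  moreover have "\<exists>n. eval \<omega> f (n # xs) = Some 0 \<and> (\<forall>k<n. eval \<omega> f (k # xs) \<noteq> None)"
    using * by (intro exI[of _ n]) (metis option.distinct(1))
  ultimately show "eval \<omega> (Mu f) xs = Some n" by (simp only: eval.simps if_P)
qed

text \<open>The parameters \<open>ys\<close> of the new oracle are appended at the end of the argument list because all
  constructors except \<^const>\<open>Comp\<close> and \<^const>\<open>Query\<close> then carry over unchanged.\<close>

lemma eval_oracle_subst:
  assumes q: "\<And>\<omega> ys i j. length ys = p \<Longrightarrow>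
    eval \<omega> q (i # j # ys) = Some (of_bool (\<theta> \<omega> ys (i, j)))"
  shows "\<exists>e'. \<forall>\<omega> ys xs y. length xs = n \<longrightarrow> length ys = p \<longrightarrow>
    eval (\<theta> \<omega> ys) e xs = Some y \<longrightarrow> eval \<omega> e' (xs @ ys) = Some y"
proof (induction e arbitrary: n)
  case Zero
  show ?case by (rule exI[of _ Zero]) simp
next
  case Succ
  show ?case by (rule exI[of _ Succ]) (auto split: list.splits)
next
  case (Proj i)
  show ?case by (rule exI[of _ "Proj i"]) (auto simp: nth_append)
next
  case Query
  \<comment> \<open>A query becomes a call of \<open>q\<close>, which receives the index and the
    trailing parameters.\<close>
  have "eval \<omega> (Comp q (Proj 0 # Proj 1 # map Proj [n..<n + p])) (xs @ ys) = Some y"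
    if len: "length xs = n" "length ys = p" and y: "eval (\<theta> \<omega> ys) Query xs = Some y"
    for \<omega> ys xs y
  proof -
    obtain i j zs where xs: "xs = i # j # zs"
      using y by (auto split: list.splits)
    have "map (\<lambda>g. eval \<omega> g (xs @ ys)) (Proj 0 # Proj 1 # map Proj [n..<n + p]) =
        map Some (i # j # ys)"
      using map_Proj_append[OF len, of \<omega>] xs by simp
    moreover have "eval \<omega> q (i # j # ys) = Some y"
      using q[OF len(2)] y xs by simp
    ultimately show ?thesis by (rule eval_CompI)
  qed
  then show ?case by blast
next
  case (Comp f gs)
  obtain f' where f': "\<And>\<omega> ys xs y. length xs = length gs \<Longrightarrow> length ys = p \<Longrightarrow>
      eval (\<theta> \<omega> ys) f xs = Some y \<Longrightarrow> eval \<omega> f' (xs @ ys) = Some y"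
    using Comp.IH(1)[of "length gs"] by blast
  have "\<exists>h. \<forall>g\<in>set gs. \<forall>\<omega> ys xs y. length xs = n \<longrightarrow> length ys = p \<longrightarrow>
      eval (\<theta> \<omega> ys) g xs = Some y \<longrightarrow> eval \<omega> (h g) (xs @ ys) = Some y"
    using Comp.IH(2)[of _ n] by (intro bchoice ballI)
  then obtain h where h: "\<And>g \<omega> ys xs y. g \<in> set gs \<Longrightarrow> length xs = n \<Longrightarrow> length ys = p \<Longrightarrow>
      eval (\<theta> \<omega> ys) g xs = Some y \<Longrightarrow> eval \<omega> (h g) (xs @ ys) = Some y" by blast
  have "eval \<omega> (Comp f' (map h gs @ map Proj [n..<n + p])) (xs @ ys) = Some y"
    if len: "length xs = n" "length ys = p" and y: "eval (\<theta> \<omega> ys) (Comp f gs) xs = Some y"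
    for \<omega> ys xs y
  proof -
    obtain zs where zs: "map (\<lambda>g. eval (\<theta> \<omega> ys) g xs) gs = map Some zs"
      "eval (\<theta> \<omega> ys) f zs = Some y"
      using y unfolding eval_Comp_eq_Some by blast
    have lz: "length zs = length gs" using arg_cong[OF zs(1), of length] by simp
    have "map (\<lambda>g. eval \<omega> g (xs @ ys)) (map h gs) = map Some zs"
    proof (rule nth_equalityI)
      fix i assume "i < length (map (\<lambda>g. eval \<omega> g (xs @ ys)) (map h gs))"
      then have i: "i < length gs" by simp
      have "eval (\<theta> \<omega> ys) (gs ! i) xs = Some (zs ! i)"
        using arg_cong[OF zs(1), of "\<lambda>l. l ! i"] i lz by simp
      then show "map (\<lambda>g. eval \<omega> g (xs @ ys)) (map h gs) ! i = map Some zs ! i"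
        using h[OF _ len] i lz by simp
    qed (simp add: lz)
    then have "map (\<lambda>g. eval \<omega> g (xs @ ys)) (map h gs @ map Proj [n..<n + p]) =
        map Some (zs @ ys)"
      using map_Proj_append[OF len, of \<omega>] by simp
    then show ?thesis using f'[OF lz len(2) zs(2)] by (rule eval_CompI)
  qed
  then show ?case by blast
next
  case (PrimRec f g)
  \<comment> \<open>The counter is the first of the \<open>n\<close> arguments, so \<open>f\<close>
    receives one fewer. For \<open>n = 0\<close> the recursion is undefined, and the truncated
    \<open>n - 1\<close> does no harm.\<close>
  obtain f' where f': "\<And>\<omega> ys xs y. length xs = n - 1 \<Longrightarrow> length ys = p \<Longrightarrow>
      eval (\<theta> \<omega> ys) f xs = Some y \<Longrightarrow> eval \<omega> f' (xs @ ys) = Some y"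
    using PrimRec.IH(1)[of "n - 1"] by blast
  obtain g' where g': "\<And>\<omega> ys xs y. length xs = Suc n \<Longrightarrow> length ys = p \<Longrightarrow>
      eval (\<theta> \<omega> ys) g xs = Some y \<Longrightarrow> eval \<omega> g' (xs @ ys) = Some y"
    using PrimRec.IH(2)[of "Suc n"] by blast
  have "eval \<omega> (PrimRec f' g') (xs @ ys) = Some y"
    if len: "length xs = n" "length ys = p" and y: "eval (\<theta> \<omega> ys) (PrimRec f g) xs = Some y"
    for \<omega> ys xs y
  proof (cases xs)
    case Nil
    with y show ?thesis by simp
  next
    case (Cons m zs)
    have *: "rec_nat (eval (\<theta> \<omega> ys) f zs)
        (\<lambda>k r. Option.bind r (\<lambda>y. eval (\<theta> \<omega> ys) g (k # y # zs))) m = Some y"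
      using y Cons by simp
    have "eval \<omega> g' (k # x # zs @ ys) = Some z"
      if "eval (\<theta> \<omega> ys) g (k # x # zs) = Some z" for k x z
      using g'[of "k # x # zs" ys \<omega> z] len Cons that by simp
    moreover have "eval \<omega> f' (zs @ ys) = Some z" if "eval (\<theta> \<omega> ys) f zs = Some z" for z
      using f'[of zs ys \<omega> z] len Cons that by simp
    ultimately have "rec_nat (eval \<omega> f' (zs @ ys))
        (\<lambda>k r. Option.bind r (\<lambda>y. eval \<omega> g' (k # y # zs @ ys))) m = Some y"
      by (intro rec_nat_bind_mono[OF *])
    then show ?thesis using Cons by simp
  qed
  then show ?case by blast
next
  case (Mu f)
  obtain f' where f': "\<And>\<omega> ys xs y. length xs = Suc n \<Longrightarrow> length ys = p \<Longrightarrow>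
      eval (\<theta> \<omega> ys) f xs = Some y \<Longrightarrow> eval \<omega> f' (xs @ ys) = Some y"
    using Mu.IH[of "Suc n"] by blast
  have "eval \<omega> (Mu f') (xs @ ys) = Some y"
    if len: "length xs = n" "length ys = p" and y: "eval (\<theta> \<omega> ys) (Mu f) xs = Some y"
    for \<omega> ys xs y
  proof -
    have "eval \<omega> f' (k # xs @ ys) = Some z" if "eval (\<theta> \<omega> ys) f (k # xs) = Some z" for k z
      using f'[of "k # xs" ys \<omega> z] len that by simp
    then show ?thesis using y unfolding eval_Mu_eq_Some by (metis append_Cons)
  qed
  then show ?case by blast
qed

section \<open>Bounding how much of the oracle a program consults\<close>

definition add_prog :: recf where
  "add_prog = PrimRec (Proj 0) (Comp Succ [Proj 1])"

lemma eval_add_prog: "eval \<omega> add_prog [x, y] = Some (x + y)"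
proof -
  have "rec_nat (Some y) (\<lambda>k r. Option.bind r (\<lambda>z. eval \<omega> (Comp Succ [Proj 1]) [k, z, y])) x =
      Some (x + y)"
    by (induction x) (auto simp: those_eq_Some)
  then show ?thesis by (simp add: add_prog_def)
qed

lemma eval_add_Comp:
  "eval \<omega> g xs = Some x \<Longrightarrow> eval \<omega> h xs = Some y \<Longrightarrow>
    eval \<omega> (Comp add_prog [g, h]) xs = Some (x + y)"
  by (rule eval_CompI[of _ _ _ "[x, y]"]) (auto simp: eval_add_prog)

definition sum_prog :: "recf list \<Rightarrow> recf" where
  "sum_prog gs = foldr (\<lambda>g r. Comp add_prog [g, r]) gs Zero"

lemma eval_sum_prog:
  "map (\<lambda>g. eval \<omega> g xs) gs = map Some us \<Longrightarrow> eval \<omega> (sum_prog gs) xs = Some (sum_list us)"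
proof (induction gs arbitrary: us)
  case (Cons g gs)
  then obtain u us' where us: "us = u # us'" "eval \<omega> g xs = Some u"
    "map (\<lambda>g. eval \<omega> g xs) gs = map Some us'" by (cases us) auto
  then show ?case using eval_add_Comp[OF us(2) Cons.IH[OF us(3)]] by (simp add: sum_prog_def)
qed (simp add: sum_prog_def)

text \<open>The use function of computability theory, as a program that runs on the same oracle.
  Nothing is required where \<open>e\<close> is undefined, so the construction can go by induction
  over programs that may diverge.\<close>

definition use_prog :: "nat \<Rightarrow> recf \<Rightarrow> recf \<Rightarrow> bool" where
  "use_prog n e e' \<longleftrightarrow> (\<forall>\<omega> xs y. length xs = n \<longrightarrow> eval \<omega> e xs = Some y \<longrightarrow>
    (\<exists>u. eval \<omega> e' xs = Some u \<and> (\<forall>\<omega>'. agree u \<omega> \<omega>' \<longrightarrow> eval \<omega>' e xs = Some y)))"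

lemma use_progE:
  assumes "use_prog n e e'" "length xs = n" "eval \<omega> e xs = Some y"
  obtains u where "eval \<omega> e' xs = Some u" "\<And>\<omega>'. agree u \<omega> \<omega>' \<Longrightarrow> eval \<omega>' e xs = Some y"
  using assms unfolding use_prog_def by blast

text \<open>The composite is fixed by every inner value and then by the outer program at those
  values. The sum of the bounds dominates each of them and needs no program for maxima.\<close>

lemma use_prog_Comp:
  assumes f: "use_prog (length gs) f f'" and h: "\<And>g. g \<in> set gs \<Longrightarrow> use_prog n g (h g)"
  shows "use_prog n (Comp f gs) (Comp add_prog [sum_prog (map h gs), Comp f' gs])"
  unfolding use_prog_def
proof (intro allI impI)
  fix \<omega> xs y assume len: "length xs = n" and y: "eval \<omega> (Comp f gs) xs = Some y"
  obtain zs where zs: "map (\<lambda>g. eval \<omega> g xs) gs = map Some zs" "eval \<omega> f zs = Some y"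
    using y unfolding eval_Comp_eq_Some by blast
  have lz: "length zs = length gs" using arg_cong[OF zs(1), of length] by simp
  obtain u where u: "eval \<omega> f' zs = Some u" "\<And>\<omega>'. agree u \<omega> \<omega>' \<Longrightarrow> eval \<omega>' f zs = Some y"
    using use_progE[OF f lz zs(2)] by blast
  have nth: "eval \<omega> (gs ! i) xs = Some (zs ! i)" if "i < length gs" for i
    using arg_cong[OF zs(1), of "\<lambda>l. l ! i"] that lz by simp
  have "\<exists>w. \<forall>i\<in>{..<length gs}. eval \<omega> (h (gs ! i)) xs = Some (w i) \<and>
      (\<forall>\<omega>'. agree (w i) \<omega> \<omega>' \<longrightarrow> eval \<omega>' (gs ! i) xs = Some (zs ! i))"
  proof (rule bchoice, rule ballI)
    fix i assume "i \<in> {..<length gs}"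
    then have "i < length gs" by simp
    then show "\<exists>w. eval \<omega> (h (gs ! i)) xs = Some w \<and>
      (\<forall>\<omega>'. agree w \<omega> \<omega>' \<longrightarrow> eval \<omega>' (gs ! i) xs = Some (zs ! i))"
      using use_progE[OF h len nth[of i]] by (metis nth_mem)
  qed
  then obtain w where w: "\<And>i. i < length gs \<Longrightarrow> eval \<omega> (h (gs ! i)) xs = Some (w i)"
    "\<And>i \<omega>'. i < length gs \<Longrightarrow> agree (w i) \<omega> \<omega>' \<Longrightarrow> eval \<omega>' (gs ! i) xs = Some (zs ! i)" by auto
  define us where "us = map w [0..<length gs]"
  have 1: "eval \<omega> (sum_prog (map h gs)) xs = Some (sum_list us)"
    by (rule eval_sum_prog, rule nth_equalityI) (auto simp: us_def w)
  have 2: "eval \<omega> (Comp f' gs) xs = Some u"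
    by (rule eval_CompI[OF zs(1) u(1)])
  have "eval \<omega>' (Comp f gs) xs = Some y" if ag: "agree (sum_list us + u) \<omega> \<omega>'" for \<omega>'
  proof (rule eval_CompI)
    show "map (\<lambda>g. eval \<omega>' g xs) gs = map Some zs"
    proof (rule nth_equalityI)
      fix i assume "i < length (map (\<lambda>g. eval \<omega>' g xs) gs)"
      then have i: "i < length gs" by simp
      have "w i \<le> sum_list us" using i by (intro member_le_sum_list) (auto simp: us_def)
      then have "agree (w i) \<omega> \<omega>'" using agree_mono[OF ag] by simp
      from w(2)[OF i this] show "map (\<lambda>g. eval \<omega>' g xs) gs ! i = map Some zs ! i"
        using i lz by simp
    qed (simp add: lz)
    show "eval \<omega>' f zs = Some y" using u(2)[OF agree_mono[OF ag]] by simp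
  qed
  then show "\<exists>u. eval \<omega> (Comp add_prog [sum_prog (map h gs), Comp f' gs]) xs = Some u \<and>
      (\<forall>\<omega>'. agree u \<omega> \<omega>' \<longrightarrow> eval \<omega>' (Comp f gs) xs = Some y)"
    using eval_add_Comp[OF 1 2] by blast
qed

text \<open>The accumulator now carries the bound and no longer the value. The step therefore runs
  the original recursion again in order to know at which value the use of \<open>g\<close> is to be
  taken.\<close>

lemma use_prog_PrimRec:
  assumes f: "use_prog n f f'" and g: "use_prog (Suc (Suc n)) g g'"
  shows "use_prog (Suc n) (PrimRec f g)
    (PrimRec f' (Comp add_prog [Proj 1, Comp g' (Proj 0 #
      Comp (PrimRec f g) (Proj 0 # map Proj [2..<2 + n]) # map Proj [2..<2 + n])]))"
    (is "use_prog _ ?e (PrimRec f' ?s)")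
  unfolding use_prog_def
proof (intro allI impI)
  fix \<omega> xs y assume len: "length xs = Suc n" and y: "eval \<omega> ?e xs = Some y"
  obtain m ys where xs: "xs = m # ys" using len by (cases xs) auto
  have ly: "length ys = n" using len xs by simp
  have projs: "map (\<lambda>g. eval \<omega> g (k # z # ys)) (map Proj [2..<2 + n]) = map Some ys" for k z
    using map_Proj_append[of "[k, z]" 2 ys n \<omega>] ly by simp
  have "eval \<omega> ?e (m # ys) = Some y \<Longrightarrow>
      \<exists>u. eval \<omega> (PrimRec f' ?s) (m # ys) = Some u \<and>
        (\<forall>\<omega>'. agree u \<omega> \<omega>' \<longrightarrow> eval \<omega>' ?e (m # ys) = Some y)"
  proof (induction m arbitrary: y)
    case 0
    then have "eval \<omega> f ys = Some y" by simp
    then show ?case using use_progE[OF f ly] by simp metis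
  next
    case (Suc m)
    obtain x where x: "eval \<omega> ?e (m # ys) = Some x" "eval \<omega> g (m # x # ys) = Some y"
      using Suc.prems by (auto simp: bind_eq_Some_conv)
    obtain u where u: "eval \<omega> (PrimRec f' ?s) (m # ys) = Some u"
      "\<And>\<omega>'. agree u \<omega> \<omega>' \<Longrightarrow> eval \<omega>' ?e (m # ys) = Some x"
      using Suc.IH[OF x(1)] by blast
    obtain w where w: "eval \<omega> g' (m # x # ys) = Some w"
      "\<And>\<omega>'. agree w \<omega> \<omega>' \<Longrightarrow> eval \<omega>' g (m # x # ys) = Some y"
      using use_progE[OF g _ x(2)] ly by auto
    have r: "eval \<omega> (Comp ?e (Proj 0 # map Proj [2..<2 + n])) (m # u # ys) = Some x"
    proof (rule eval_CompI[OF _ x(1)])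
      show "map (\<lambda>g. eval \<omega> g (m # u # ys)) (Proj 0 # map Proj [2..<2 + n]) = map Some (m # ys)"
        using projs[of m u] by simp
    qed
    have "eval \<omega> ?s (m # u # ys) = Some (u + w)"
    proof (rule eval_add_Comp)
      show "eval \<omega> (Comp g' (Proj 0 #
          Comp (PrimRec f g) (Proj 0 # map Proj [2..<2 + n]) # map Proj [2..<2 + n]))
          (m # u # ys) = Some w"
      proof (rule eval_CompI[OF _ w(1)])
        show "map (\<lambda>g. eval \<omega> g (m # u # ys)) (Proj 0 #
          Comp (PrimRec f g) (Proj 0 # map Proj [2..<2 + n]) # map Proj [2..<2 + n]) =
          map Some (m # x # ys)"
          using projs[of m u] r by (simp del: eval.simps(5,6))
      qed
    qed simp
    then have "eval \<omega> (PrimRec f' ?s) (Suc m # ys) = Some (u + w)"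
      using u(1) by (simp del: eval.simps(5))
    moreover have "eval \<omega>' ?e (Suc m # ys) = Some y" if ag: "agree (u + w) \<omega> \<omega>'" for \<omega>'
      using u(2)[OF agree_mono[OF ag]] w(2)[OF agree_mono[OF ag]] by simp
    ultimately show ?case by blast
  qed
  with y show "\<exists>u. eval \<omega> (PrimRec f' ?s) xs = Some u \<and>
        (\<forall>\<omega>'. agree u \<omega> \<omega>' \<longrightarrow> eval \<omega>' ?e xs = Some y)"
    unfolding xs by blast
qed

text \<open>The outcome of the search is fixed by all tests up to and including the successful one,
  so their uses are added up. How many tests there are is found by running the search
  itself.\<close>

lemma use_prog_Mu:
  assumes f: "use_prog (Suc n) f f'"
  shows "use_prog n (Mu f)
    (Comp (PrimRec (Comp f' (Zero # map Proj [0..<n]))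
        (Comp add_prog [Proj 1, Comp f' (Comp Succ [Proj 0] # map Proj [2..<2 + n])]))
      (Mu f # map Proj [0..<n]))"
    (is "use_prog _ _ (Comp ?s _)")
  unfolding use_prog_def
proof (intro allI impI)
  fix \<omega> xs y assume len: "length xs = n" and y: "eval \<omega> (Mu f) xs = Some y"
  have projs: "map (\<lambda>g. eval \<omega> g (k # z # xs)) (map Proj [2..<2 + n]) = map Some xs" for k z
    using map_Proj_append[of "[k, z]" 2 xs n \<omega>] len by simp
  have projs0: "map (\<lambda>g. eval \<omega> g xs) (map Proj [0..<n]) = map Some xs"
    using map_Proj_append[of "[]" 0 xs n \<omega>] len by simp
  have "(\<forall>k\<le>m. \<exists>y. eval \<omega> f (k # xs) = Some y) \<Longrightarrow> \<exists>u. eval \<omega> ?s (m # xs) = Some u \<and>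
    (\<forall>\<omega>'. agree u \<omega> \<omega>' \<longrightarrow> (\<forall>k\<le>m. eval \<omega>' f (k # xs) = eval \<omega> f (k # xs)))" for m
  proof (induction m)
    case 0
    then obtain y where y: "eval \<omega> f (0 # xs) = Some y" by blast
    obtain u where u: "eval \<omega> f' (0 # xs) = Some u"
      "\<And>\<omega>'. agree u \<omega> \<omega>' \<Longrightarrow> eval \<omega>' f (0 # xs) = Some y"
      using use_progE[OF f _ y] len by auto
    have "eval \<omega> (Comp f' (Zero # map Proj [0..<n])) xs = Some u"
      by (rule eval_CompI[OF _ u(1)]) (use projs0 in simp)
    then have "eval \<omega> ?s (0 # xs) = Some u" by simp
    then show ?case using u(2) y by auto
  next
    case (Suc m)
    then obtain u where u: "eval \<omega> ?s (m # xs) = Some u"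
      "\<And>\<omega>' k. agree u \<omega> \<omega>' \<Longrightarrow> k \<le> m \<Longrightarrow> eval \<omega>' f (k # xs) = eval \<omega> f (k # xs)"
      by (metis le_SucI)
    obtain y where y: "eval \<omega> f (Suc m # xs) = Some y" using Suc.prems by blast
    obtain w where w: "eval \<omega> f' (Suc m # xs) = Some w"
      "\<And>\<omega>'. agree w \<omega> \<omega>' \<Longrightarrow> eval \<omega>' f (Suc m # xs) = Some y"
      using use_progE[OF f _ y] len by auto
    have "eval \<omega> (Comp add_prog [Proj 1, Comp f' (Comp Succ [Proj 0] # map Proj [2..<2 + n])])
        (m # u # xs) = Some (u + w)"
    proof (rule eval_add_Comp)
      show "eval \<omega> (Comp f' (Comp Succ [Proj 0] # map Proj [2..<2 + n])) (m # u # xs) = Some w"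
        by (rule eval_CompI[OF _ w(1)]) (use projs in \<open>simp add: those_eq_Some\<close>)
    qed simp
    then have "eval \<omega> ?s (Suc m # xs) = Some (u + w)"
      using u(1) by (simp del: eval.simps(5))
    moreover have "eval \<omega>' f (k # xs) = eval \<omega> f (k # xs)"
      if ag: "agree (u + w) \<omega> \<omega>'" and k: "k \<le> Suc m" for \<omega>' k
      using u(2)[OF agree_mono[OF ag]] w(2)[OF agree_mono[OF ag]] y k
      by (cases "k = Suc m") auto
    ultimately show ?case by blast
  qed
  moreover have "\<forall>k\<le>y. \<exists>z. eval \<omega> f (k # xs) = Some z"
    using y unfolding eval_Mu_eq_Some by (metis le_neq_implies_less)
  ultimately obtain u where u: "eval \<omega> ?s (y # xs) = Some u"
    "\<And>\<omega>' k. agree u \<omega> \<omega>' \<Longrightarrow> k \<le> y \<Longrightarrow> eval \<omega>' f (k # xs) = eval \<omega> f (k # xs)" by metis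
  have "eval \<omega> (Comp ?s (Mu f # map Proj [0..<n])) xs = Some u"
    by (rule eval_CompI[OF _ u(1)]) (use projs0 y in \<open>simp del: eval.simps(5-)\<close>)
  moreover have "eval \<omega>' (Mu f) xs = Some y" if "agree u \<omega> \<omega>'" for \<omega>'
    using u(2)[OF that] y unfolding eval_Mu_eq_Some by auto
  ultimately show "\<exists>u. eval \<omega> (Comp ?s (Mu f # map Proj [0..<n])) xs = Some u \<and>
      (\<forall>\<omega>'. agree u \<omega> \<omega>' \<longrightarrow> eval \<omega>' (Mu f) xs = Some y)" by blast
qed

lemma ex_use_prog: "\<exists>e'. use_prog n e e'"
proof (induction e arbitrary: n)
  case Zero
  show ?case unfolding use_prog_def by (rule exI[of _ Zero]) auto
next
  case Succ
  show ?case unfolding use_prog_def by (rule exI[of _ Zero]) auto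
next
  case (Proj i)
  show ?case unfolding use_prog_def by (rule exI[of _ Zero]) auto
next
  case Query
  \<comment> \<open>The number exceeds both coordinates, so the square of that side contains the
    queried index.\<close>
  have "use_prog n Query (Comp Succ [Comp add_prog [Proj 0, Proj 1]])"
    unfolding use_prog_def
  proof (intro allI impI)
    fix \<omega> xs y assume "eval \<omega> Query xs = Some y"
    then obtain i j zs where xs: "xs = i # j # zs" and y: "y = of_bool (\<omega> (i, j))"
      by (auto split: list.splits)
    have "eval \<omega> (Comp Succ [Comp add_prog [Proj 0, Proj 1]]) xs = Some (Suc (i + j))"
      by (rule eval_CompI[of _ _ _ "[i + j]"])
        (auto simp: xs eval_add_Comp simp del: eval.simps(5))
    moreover have "eval \<omega>' Query xs = Some y" if "agree (Suc (i + j)) \<omega> \<omega>'" for \<omega>'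
      using that by (auto simp: agree_def xs y)
    ultimately show "\<exists>u. eval \<omega> (Comp Succ [Comp add_prog [Proj 0, Proj 1]]) xs = Some u \<and>
        (\<forall>\<omega>'. agree u \<omega> \<omega>' \<longrightarrow> eval \<omega>' Query xs = Some y)" by blast
  qed
  then show ?case by blast
next
  case (Comp f gs)
  obtain f' where f': "use_prog (length gs) f f'" using Comp.IH(1) by blast
  have "\<exists>h. \<forall>g\<in>set gs. use_prog n g (h g)" using Comp.IH(2) by (intro bchoice ballI)
  then show ?case using use_prog_Comp[OF f'] by blast
next
  case (PrimRec f g)
  show ?case
  proof (cases n)
    \<comment> \<open>A recursion without arguments is undefined, so the requirement is
      vacuous.\<close>
    case 0
    then show ?thesis by (intro exI[of _ Zero]) (simp add: use_prog_def)
  next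
    case (Suc m)
    then show ?thesis using PrimRec.IH use_prog_PrimRec by blast
  qed
next
  case (Mu f)
  then show ?case using use_prog_Mu by blast
qed

section \<open>Total computable functionals\<close>

text \<open>The arguments are \<open>v 0, \<dots>, v (n - 1)\<close>. With a function instead of a list the closure rules,
  including those for binders, apply by higher-order unification: the body of a binder takes the
  bound variable as \<open>v 0\<close> and the outer arguments shifted by one.\<close>

definition computable :: "nat \<Rightarrow> (bits \<Rightarrow> (nat \<Rightarrow> nat) \<Rightarrow> nat) \<Rightarrow> bool" where
  "computable n F \<longleftrightarrow> (\<exists>e. \<forall>\<omega> v. eval \<omega> e (map v [0..<n]) = Some (F \<omega> v))"

lemma computableI: "(\<And>\<omega> v. eval \<omega> e (map v [0..<n]) = Some (F \<omega> v)) \<Longrightarrow> computable n F"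
  unfolding computable_def by blast

lemma computableE:
  assumes "computable n F"
  obtains e where "\<And>\<omega> v. eval \<omega> e (map v [0..<n]) = Some (F \<omega> v)"
  using assms unfolding computable_def by blast

text \<open>A program receives only the first \<open>n\<close> values. This licenses replacing
  \<open>v\<close> by any valuation equal to it there, in particular one built from a list.\<close>

lemma computable_cong_args:
  assumes "computable n F" "\<And>i. i < n \<Longrightarrow> v i = w i"
  shows "F \<omega> v = F \<omega> w"
proof -
  have "map v [0..<n] = map w [0..<n]" using assms(2) by simp
  then show ?thesis using assms(1) by (metis computable_def option.inject)
qed

lemma computable_var: "i < n \<Longrightarrow> computable n (\<lambda>\<omega> v. v i)"
  by (rule computableI[of "Proj i"]) simp

lemma computable_comp:
  assumes F: "computable (length Gs) F" and G: "\<And>G. G \<in> set Gs \<Longrightarrow> computable n G"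
  shows "computable n (\<lambda>\<omega> v. F \<omega> (\<lambda>i. (Gs ! i) \<omega> v))"
proof -
  obtain f where f: "\<And>\<omega> v. eval \<omega> f (map v [0..<length Gs]) = Some (F \<omega> v)"
    using computableE[OF F] by blast
  have "\<exists>h. \<forall>G\<in>set Gs. \<forall>\<omega> v. eval \<omega> (h G) (map v [0..<n]) = Some (G \<omega> v)"
    using G unfolding computable_def by (intro bchoice ballI)
  then obtain h where h: "\<And>G \<omega> v. G \<in> set Gs \<Longrightarrow> eval \<omega> (h G) (map v [0..<n]) = Some (G \<omega> v)"
    by blast
  show ?thesis
  proof (rule computableI[of "Comp f (map h Gs)"], rule eval_CompI)
    fix \<omega> v
    show "map (\<lambda>g. eval \<omega> g (map v [0..<n])) (map h Gs) =
        map Some (map (\<lambda>i. (Gs ! i) \<omega> v) [0..<length Gs])"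
      by (rule nth_equalityI) (auto simp: h)
  qed (rule f)
qed

lemma computable_comp1:
  assumes "computable (Suc 0) (\<lambda>\<omega> v. f \<omega> (v 0))" "computable n F"
  shows "computable n (\<lambda>\<omega> v. f \<omega> (F \<omega> v))"
  using computable_comp[of "[F]" "\<lambda>\<omega> v. f \<omega> (v 0)" n] assms by simp

lemma computable_comp2:
  assumes "computable (Suc (Suc 0)) (\<lambda>\<omega> v. f \<omega> (v 0) (v (Suc 0)))" "computable n F" "computable n G"
  shows "computable n (\<lambda>\<omega> v. f \<omega> (F \<omega> v) (G \<omega> v))"
  using computable_comp[of "[F, G]" "\<lambda>\<omega> v. f \<omega> (v 0) (v (Suc 0))" n] assms by auto

lemma computable_Suc: "computable n F \<Longrightarrow> computable n (\<lambda>\<omega> v. Suc (F \<omega> v))"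
  by (rule computable_comp1[of "\<lambda>\<omega>. Suc"]) (auto intro: computableI[of Succ])

lemma computable_const: "computable n (\<lambda>\<omega> v. c)"
proof (induction c)
  case 0
  show ?case by (rule computableI[of Zero]) simp
qed (rule computable_Suc)

lemma computable_oracle: "computable n F \<Longrightarrow> computable n G \<Longrightarrow>
    computable n (\<lambda>\<omega> v. of_bool (\<omega> (F \<omega> v, G \<omega> v)))"
  by (rule computable_comp2[of "\<lambda>\<omega> i j. of_bool (\<omega> (i, j))"]) (auto intro: computableI[of Query])

lemma map_upt_2: "map v [0..<Suc (Suc n)] = v 0 # v (Suc 0) # map (\<lambda>i. v (Suc (Suc i))) [0..<n]"
  by (simp add: upt_conv_Cons map_Suc_upt [symmetric] comp_def del: upt_Suc)

lemma map_upt_1: "map v [0..<Suc n] = v 0 # map (\<lambda>i. v (Suc i)) [0..<n]"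
  by (simp add: upt_conv_Cons map_Suc_upt [symmetric] comp_def del: upt_Suc)

lemma computable_rec_nat:
  assumes A: "computable n A" and B: "computable n B"
    and G: "computable (Suc (Suc n)) (\<lambda>\<omega> v. G \<omega> (v 0) (v (Suc 0)) (\<lambda>i. v (Suc (Suc i))))"
  shows "computable n (\<lambda>\<omega> v. rec_nat (A \<omega> v) (\<lambda>k y. G \<omega> k y v) (B \<omega> v))"
proof -
  obtain a where a: "\<And>\<omega> v. eval \<omega> a (map v [0..<n]) = Some (A \<omega> v)" using computableE[OF A] by blast
  obtain b where b: "\<And>\<omega> v. eval \<omega> b (map v [0..<n]) = Some (B \<omega> v)" using computableE[OF B] by blast
  obtain g where g': "\<And>\<omega> v. eval \<omega> g (map v [0..<Suc (Suc n)]) =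
      Some (G \<omega> (v 0) (v (Suc 0)) (\<lambda>i. v (Suc (Suc i))))" using computableE[OF G] by blast
  \<comment> \<open>\<open>case_nat\<close> puts a value in front of a valuation, as consing does
    for a list.\<close>
  have g: "eval \<omega> g (k # y # map v [0..<n]) = Some (G \<omega> k y v)" for \<omega> k y v
    using g'[of \<omega> "case_nat k (case_nat y v)"] unfolding map_upt_2 by simp
  show ?thesis
  proof (rule computableI[of "Comp (PrimRec a g) (b # map Proj [0..<n])"], rule eval_CompI)
    fix \<omega> v
    show "map (\<lambda>g. eval \<omega> g (map v [0..<n])) (b # map Proj [0..<n]) =
        map Some (B \<omega> v # map v [0..<n])"
      using b by simp
    have "rec_nat (Some (A \<omega> v)) (\<lambda>k r. Option.bind r (\<lambda>y. eval \<omega> g (k # y # map v [0..<n]))) m =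
        Some (rec_nat (A \<omega> v) (\<lambda>k y. G \<omega> k y v) m)" for m
      by (induction m) (auto simp: g)
    then show "eval \<omega> (PrimRec a g) (B \<omega> v # map v [0..<n]) =
        Some (rec_nat (A \<omega> v) (\<lambda>k y. G \<omega> k y v) (B \<omega> v))"
      by (simp add: a)
  qed
qed

lemma computable_LEAST:
  assumes P: "computable (Suc n) (\<lambda>\<omega> v. of_bool (P \<omega> (v 0) (\<lambda>i. v (Suc i))))"
    and ex: "\<And>\<omega> v. \<exists>k. P \<omega> k v"
  shows "computable n (\<lambda>\<omega> v. LEAST k. P \<omega> k v)"
proof -
  \<comment> \<open>\<open>Mu\<close> searches for a zero, so truth is turned into 0 and falsehood
    into 1.\<close>
  have "computable (Suc n) (\<lambda>\<omega> v. rec_nat 1 (\<lambda>k y. 0) (of_bool (P \<omega> (v 0) (\<lambda>i. v (Suc i)))))"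
    by (intro computable_rec_nat P computable_const)
  then obtain g where g': "\<And>\<omega> v. eval \<omega> g (map v [0..<Suc n]) =
      Some (rec_nat 1 (\<lambda>k y. 0) (of_bool (P \<omega> (v 0) (\<lambda>i. v (Suc i)))))" using computableE by blast
  have g: "eval \<omega> g (k # map v [0..<n]) = Some (if P \<omega> k v then 0 else 1)" for \<omega> k v
    using g'[of \<omega> "case_nat k v"] unfolding map_upt_1 by simp
  show ?thesis
  proof (rule computableI)
    fix \<omega> v
    define m where "m = (LEAST k. P \<omega> k v)"
    have "\<not> P \<omega> k v" if "k < m" for k using that unfolding m_def by (rule not_less_Least)
    moreover have "P \<omega> m v" unfolding m_def by (rule LeastI_ex[OF ex])
    ultimately show "eval \<omega> (Mu g) (map v [0..<n]) = Some (LEAST k. P \<omega> k v)"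
      unfolding eval_Mu_eq_Some m_def [symmetric] g by auto
  qed
qed

text \<open>Makes it possible to run a functional on an oracle that is computed from the given one
  and the arguments, such as an oracle with some bits overwritten by the digits of a number.\<close>

lemma computable_oracle_subst:
  assumes F: "computable n F" and len: "length Gs = n"
    and Q: "computable (Suc (Suc p)) (\<lambda>\<omega> v. of_bool (Q \<omega> (v 0) (v (Suc 0)) (\<lambda>i. v (Suc (Suc i)))))"
    and G: "\<And>G. G \<in> set Gs \<Longrightarrow> computable p G"
  shows "computable p (\<lambda>\<omega> v. F (\<lambda>(i, j). Q \<omega> i j v) (\<lambda>i. (Gs ! i) \<omega> v))"
proof -
  obtain f where f: "\<And>\<omega> v. eval \<omega> f (map v [0..<n]) = Some (F \<omega> v)" using computableE[OF F] by blast
  obtain q where q': "\<And>\<omega> v. eval \<omega> q (map v [0..<Suc (Suc p)]) =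
      Some (of_bool (Q \<omega> (v 0) (v (Suc 0)) (\<lambda>i. v (Suc (Suc i)))))" using computableE[OF Q] by blast
  have q: "eval \<omega> q (k # y # map v [0..<p]) = Some (of_bool (Q \<omega> k y v))" for \<omega> k y v
    using q'[of \<omega> "case_nat k (case_nat y v)"] unfolding map_upt_2 by simp
  have Q': "Q \<omega> i j v = Q \<omega> i j w" if "\<And>i. i < p \<Longrightarrow> v i = w i" for \<omega> i j v w
  proof -
    have "map v [0..<p] = map w [0..<p]" using that by simp
    then have "(of_bool (Q \<omega> i j v) :: nat) = of_bool (Q \<omega> i j w)"
      using q by (metis option.inject)
    then show ?thesis by (simp add: of_bool_eq_iff)
  qed
  have "\<exists>f'. \<forall>\<omega> ys xs y. length xs = n \<longrightarrow> length ys = p \<longrightarrow>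
      eval (\<lambda>(i, j). Q \<omega> i j (\<lambda>k. ys ! k)) f xs = Some y \<longrightarrow> eval \<omega> f' (xs @ ys) = Some y"
  proof (rule eval_oracle_subst)
    fix \<omega> and ys :: "nat list" and i j assume "length ys = p"
    then show "eval \<omega> q (i # j # ys) =
        Some (of_bool ((\<lambda>(i, j). Q \<omega> i j (\<lambda>k. ys ! k)) (i, j)))"
      using q[of \<omega> i j "\<lambda>k. ys ! k"] map_nth[of ys] by simp
  qed
  then obtain f' where f': "\<And>\<omega> ys xs y. length xs = n \<Longrightarrow> length ys = p \<Longrightarrow>
      eval (\<lambda>(i, j). Q \<omega> i j (\<lambda>k. ys ! k)) f xs = Some y \<Longrightarrow> eval \<omega> f' (xs @ ys) = Some y" by blast
  \<comment> \<open>The simulating program expects the arguments of \<open>F\<close> followed by the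
    parameters of \<open>Q\<close>; composing with projections supplies the latter.\<close>
  let ?F = "\<lambda>\<omega> v. F (\<lambda>(i, j). Q \<omega> i j (\<lambda>i. v (n + i))) v"
  have "computable (n + p) ?F"
  proof (rule computableI)
    fix \<omega> and v :: "nat \<Rightarrow> nat"
    have *: "map v [0..<n + p] = map v [0..<n] @ map (\<lambda>i. v (n + i)) [0..<p]"
      by (rule nth_equalityI) (auto simp: nth_append)
    have "(\<lambda>(i, j). Q \<omega> i j (\<lambda>k. map (\<lambda>i. v (n + i)) [0..<p] ! k)) =
        (\<lambda>(i, j). Q \<omega> i j (\<lambda>i. v (n + i)))"
      by (intro ext) (auto intro!: Q' simp del: map_map)
    then show "eval \<omega> f' (map v [0..<n + p]) = Some (?F \<omega> v)"
      unfolding * by (intro f') (simp_all add: f)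
  qed
  then have "computable (length (Gs @ map (\<lambda>i \<omega> v. v i) [0..<p])) ?F" by (simp add: len)
  then have "computable p (\<lambda>\<omega> v. ?F \<omega> (\<lambda>i. ((Gs @ map (\<lambda>i \<omega> v. v i) [0..<p]) ! i) \<omega> v))"
    by (rule computable_comp) (auto intro: G computable_var)
  moreover have "?F \<omega> (\<lambda>i. ((Gs @ map (\<lambda>i \<omega> v. v i) [0..<p]) ! i) \<omega> v) =
      F (\<lambda>(i, j). Q \<omega> i j v) (\<lambda>i. (Gs ! i) \<omega> v)" for \<omega> v
  proof -
    have "(\<lambda>(i, j). Q \<omega> i j (\<lambda>i. ((Gs @ map (\<lambda>i \<omega> v. v i) [0..<p]) ! (n + i)) \<omega> v)) =
        (\<lambda>(i, j). Q \<omega> i j v)"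
      by (intro ext) (auto intro!: Q' simp: nth_append len)
    then show ?thesis
      by (simp, intro computable_cong_args[OF F]) (simp add: nth_append len)
  qed
  ultimately show ?thesis by simp
qed

lemma computable_oracle_subst1:
  assumes "computable (Suc 0) (\<lambda>\<omega> v. f \<omega> (v 0))" "computable p G"
    and "computable (Suc (Suc p)) (\<lambda>\<omega> v. of_bool (Q \<omega> (v 0) (v (Suc 0)) (\<lambda>i. v (Suc (Suc i)))))"
  shows "computable p (\<lambda>\<omega> v. f (\<lambda>(i, j). Q \<omega> i j v) (G \<omega> v))"
  using computable_oracle_subst[OF assms(1) _ assms(3), of "[G]"] assms(2) by simp

lemma computable_add: "computable n F \<Longrightarrow> computable n G \<Longrightarrow> computable n (\<lambda>\<omega> v. F \<omega> v + G \<omega> v)"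
proof (rule computable_comp2[of "\<lambda>\<omega> x y. x + y"])
  have "rec_nat y (\<lambda>k z. Suc z) x = x + y" for x y by (induction x) auto
  moreover have "computable (Suc (Suc 0)) (\<lambda>\<omega> v. rec_nat (v (Suc 0)) (\<lambda>k z. Suc z) (v 0))"
    by (intro computable_rec_nat computable_Suc computable_var) auto
  ultimately show "computable (Suc (Suc 0)) (\<lambda>\<omega> v. v 0 + v (Suc 0))" by simp
qed

lemma computable_mult: "computable n F \<Longrightarrow> computable n G \<Longrightarrow> computable n (\<lambda>\<omega> v. F \<omega> v * G \<omega> v)"
proof (rule computable_comp2[of "\<lambda>\<omega> x y. x * y"])
  have "rec_nat 0 (\<lambda>k z. z + y) x = x * y" for x y :: nat by (induction x) auto
  moreover have "computable (Suc (Suc 0)) (\<lambda>\<omega> v. rec_nat 0 (\<lambda>k z. z + v (Suc 0)) (v 0))"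
    by (intro computable_rec_nat computable_add computable_const computable_var) auto
  ultimately show "computable (Suc (Suc 0)) (\<lambda>\<omega> v. v 0 * v (Suc 0))" by simp
qed

lemma computable_diff: "computable n F \<Longrightarrow> computable n G \<Longrightarrow> computable n (\<lambda>\<omega> v. F \<omega> v - G \<omega> v)"
proof (rule computable_comp2[of "\<lambda>\<omega> x y. x - y"])
  have "rec_nat 0 (\<lambda>k z. k) x = x - 1" for x by (cases x) auto
  moreover have "computable (Suc 0) (\<lambda>\<omega> v. rec_nat 0 (\<lambda>k z. k) (v 0))"
    by (intro computable_rec_nat computable_const computable_var) auto
  ultimately have p: "computable (Suc 0) (\<lambda>\<omega> v. v 0 - 1)" by simp
  have "rec_nat x (\<lambda>k z. z - 1) y = x - y" for x y :: nat by (induction y) auto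
  moreover have "computable (Suc (Suc 0)) (\<lambda>\<omega> v. rec_nat (v 0) (\<lambda>k z. z - 1) (v (Suc 0)))"
    by (intro computable_rec_nat computable_comp1[OF p] computable_var) auto
  ultimately show "computable (Suc (Suc 0)) (\<lambda>\<omega> v. v 0 - v (Suc 0))" by simp
qed

lemma computable_if:
  assumes "computable n (\<lambda>\<omega> v. of_bool (P \<omega> v))" "computable n F" "computable n G"
  shows "computable n (\<lambda>\<omega> v. if P \<omega> v then F \<omega> v else G \<omega> v)"
proof -
  have "computable n (\<lambda>\<omega> v. of_bool (P \<omega> v) * F \<omega> v + (1 - of_bool (P \<omega> v)) * G \<omega> v)"
    by (intro computable_add computable_mult computable_diff computable_const assms)
  then show ?thesis by (rule back_subst[of "computable n"]) (intro ext, simp)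
qed

lemma computable_not:
  assumes "computable n (\<lambda>\<omega> v. of_bool (P \<omega> v))"
  shows "computable n (\<lambda>\<omega> v. of_bool (\<not> P \<omega> v))"
proof -
  have "computable n (\<lambda>\<omega> v. 1 - of_bool (P \<omega> v))"
    by (intro computable_diff computable_const assms)
  then show ?thesis by (rule back_subst[of "computable n"]) (intro ext, simp)
qed

lemma computable_conj:
  assumes "computable n (\<lambda>\<omega> v. of_bool (P \<omega> v))" "computable n (\<lambda>\<omega> v. of_bool (Q \<omega> v))"
  shows "computable n (\<lambda>\<omega> v. of_bool (P \<omega> v \<and> Q \<omega> v))"
  using computable_mult[OF assms] by (simp add: of_bool_conj)

lemma computable_disj:
  assumes "computable n (\<lambda>\<omega> v. of_bool (P \<omega> v))" "computable n (\<lambda>\<omega> v. of_bool (Q \<omega> v))"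
  shows "computable n (\<lambda>\<omega> v. of_bool (P \<omega> v \<or> Q \<omega> v))"
  using computable_not[OF computable_conj[OF computable_not[OF assms(1)]
      computable_not[OF assms(2)]]] by simp

lemma computable_imp:
  assumes "computable n (\<lambda>\<omega> v. of_bool (P \<omega> v))" "computable n (\<lambda>\<omega> v. of_bool (Q \<omega> v))"
  shows "computable n (\<lambda>\<omega> v. of_bool (P \<omega> v \<longrightarrow> Q \<omega> v))"
  unfolding imp_conv_disj by (rule computable_disj[OF computable_not[OF assms(1)] assms(2)])

lemma computable_less:
  assumes "computable n F" "computable n G"
  shows "computable n (\<lambda>\<omega> v. of_bool (F \<omega> v < G \<omega> v))"
proof -
  have "computable n (\<lambda>\<omega> v. 1 - (1 - (G \<omega> v - F \<omega> v)))"
    by (intro computable_diff computable_const assms)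
  then show ?thesis by (rule back_subst[of "computable n"]) (intro ext, simp)
qed

lemma computable_le: "computable n F \<Longrightarrow> computable n G \<Longrightarrow>
    computable n (\<lambda>\<omega> v. of_bool (F \<omega> v \<le> G \<omega> v))"
  using computable_not[OF computable_less[of n G F]] by (simp add: not_less)

lemma computable_eq: "computable n F \<Longrightarrow> computable n G \<Longrightarrow>
    computable n (\<lambda>\<omega> v. of_bool (F \<omega> v = G \<omega> v))"
  using computable_conj[OF computable_le[of n F G] computable_le[of n G F]] by (simp add: eq_iff)

lemma computable_shift:
  assumes F: "computable n F"
  shows "computable (Suc n) (\<lambda>\<omega> v. F \<omega> (\<lambda>i. v (Suc i)))"
proof -
  let ?Gs = "map (\<lambda>i \<omega> v. v (Suc i)) [0..<n]"
  have "computable (Suc n) (\<lambda>\<omega> v. F \<omega> (\<lambda>i. (?Gs ! i) \<omega> v))"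
    using F by (intro computable_comp) (auto intro: computable_var)
  moreover have "F \<omega> (\<lambda>i. (?Gs ! i) \<omega> v) = F \<omega> (\<lambda>i. v (Suc i))" for \<omega> v
    by (rule computable_cong_args[OF F]) simp
  ultimately show ?thesis by simp
qed

text \<open>The step of a recursion has the accumulator as variable 1, which the term of a finite
  sum or product must skip.\<close>

lemma computable_skip:
  assumes F: "computable (Suc n) (\<lambda>\<omega> v. F \<omega> (v 0) (\<lambda>i. v (Suc i)))"
  shows "computable (Suc (Suc n)) (\<lambda>\<omega> v. F \<omega> (v 0) (\<lambda>i. v (Suc (Suc i))))"
proof -
  let ?Gs = "(\<lambda>\<omega> v. v 0) # map (\<lambda>i \<omega> v. v (Suc (Suc i))) [0..<n]"
  have "computable (Suc (Suc n)) (\<lambda>\<omega> v. F \<omega> ((?Gs ! 0) \<omega> v) (\<lambda>i. (?Gs ! Suc i) \<omega> v))"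
    by (rule computable_comp[of ?Gs "\<lambda>\<omega> v. F \<omega> (v 0) (\<lambda>i. v (Suc i))"])
      (use F in \<open>auto intro: computable_var\<close>)
  moreover have "F \<omega> ((?Gs ! 0) \<omega> v) (\<lambda>i. (?Gs ! Suc i) \<omega> v) =
      F \<omega> (v 0) (\<lambda>i. v (Suc (Suc i)))" for \<omega> v
    using computable_cong_args[OF F, of "case_nat (v 0) (\<lambda>i. (?Gs ! Suc i) \<omega> v)"
        "case_nat (v 0) (\<lambda>i. v (Suc (Suc i)))"]
    by (auto split: nat.splits)
  ultimately show ?thesis by simp
qed

lemma computable_sum:
  assumes "computable (Suc n) (\<lambda>\<omega> v. F \<omega> (v 0) (\<lambda>i. v (Suc i)))" "computable n B"
  shows "computable n (\<lambda>\<omega> v. \<Sum>k<B \<omega> v. F \<omega> k v)"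
proof -
  have "computable (Suc (Suc n)) (\<lambda>\<omega> v. F \<omega> (v 0) (\<lambda>i. v (Suc (Suc i))))"
    by (rule computable_skip[OF assms(1)])
  then have "computable n (\<lambda>\<omega> v. rec_nat 0 (\<lambda>k y. y + F \<omega> k v) (B \<omega> v))"
    by (intro computable_rec_nat computable_add computable_const computable_var assms(2)) auto
  moreover have "rec_nat 0 (\<lambda>k y. y + F \<omega> k v) m = (\<Sum>k<m. F \<omega> k v)" for \<omega> v m
    by (induction m) auto
  ultimately show ?thesis by simp
qed

lemma computable_prod:
  assumes "computable (Suc n) (\<lambda>\<omega> v. F \<omega> (v 0) (\<lambda>i. v (Suc i)))" "computable n B"
  shows "computable n (\<lambda>\<omega> v. \<Prod>k<B \<omega> v. F \<omega> k v)"
proof -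
  have "computable n (\<lambda>\<omega> v. rec_nat 1 (\<lambda>k y. y * F \<omega> k v) (B \<omega> v))"
    using computable_skip[OF assms(1)] by (intro computable_rec_nat computable_mult
        computable_const computable_var assms(2)) auto
  moreover have "rec_nat 1 (\<lambda>k y. y * F \<omega> k v) m = (\<Prod>k<m. F \<omega> k v)" for \<omega> v m
    by (induction m) auto
  ultimately show ?thesis by simp
qed

lemma computable_ex_less:
  assumes "computable (Suc n) (\<lambda>\<omega> v. of_bool (P \<omega> (v 0) (\<lambda>i. v (Suc i))))" "computable n B"
  shows "computable n (\<lambda>\<omega> v. of_bool (\<exists>k<B \<omega> v. P \<omega> k v))"
proof -
  have "computable n (\<lambda>\<omega> v. of_bool (0 < (\<Sum>k<B \<omega> v. of_bool (P \<omega> k v) :: nat)))"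
    by (intro computable_less computable_const computable_sum assms)
  moreover have "0 < (\<Sum>k<m. of_bool (P \<omega> k v) :: nat) \<longleftrightarrow> (\<exists>k<m. P \<omega> k v)" for \<omega> v m
    by (auto simp: zero_less_iff_neq_zero)
  ultimately show ?thesis by simp
qed

lemma computable_all_less:
  assumes "computable (Suc n) (\<lambda>\<omega> v. of_bool (P \<omega> (v 0) (\<lambda>i. v (Suc i))))" "computable n B"
  shows "computable n (\<lambda>\<omega> v. of_bool (\<forall>k<B \<omega> v. P \<omega> k v))"
  using computable_not[OF computable_ex_less[OF computable_not[OF assms(1)] assms(2)]] by simp

lemma computable_power: "computable n F \<Longrightarrow> computable n G \<Longrightarrow> computable n (\<lambda>\<omega> v. F \<omega> v ^ G \<omega> v)"
proof (rule computable_comp2[of "\<lambda>\<omega> x y. x ^ y"])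
  have "rec_nat 1 (\<lambda>k z. z * x) y = x ^ y" for x y :: nat by (induction y) auto
  moreover have "computable (Suc (Suc 0)) (\<lambda>\<omega> v. rec_nat 1 (\<lambda>k z. z * v 0) (v (Suc 0)))"
    by (intro computable_rec_nat computable_mult computable_const computable_var) auto
  ultimately show "computable (Suc (Suc 0)) (\<lambda>\<omega> v. v 0 ^ v (Suc 0))" by simp
qed

lemma computable_div: "computable n F \<Longrightarrow> computable n G \<Longrightarrow> computable n (\<lambda>\<omega> v. F \<omega> v div G \<omega> v)"
proof (rule computable_comp2[of "\<lambda>\<omega> x y. x div y"])
  \<comment> \<open>The first disjunct stops the search at 0 when \<open>y = 0\<close>, in
    accordance with \<open>x div 0 = 0\<close>.\<close>
  have *: "(LEAST q. y = 0 \<or> x < Suc q * y) = x div y" for x y :: nat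
  proof (cases "y = 0")
    case False
    then show ?thesis
      by (intro Least_equality)
        (auto simp: dividend_less_div_times less_Suc_eq_le [symmetric] less_mult_imp_div_less)
  qed auto
  have "computable (Suc (Suc 0)) (\<lambda>\<omega> v. LEAST q. v (Suc 0) = 0 \<or> v 0 < Suc q * v (Suc 0))"
  proof (intro computable_LEAST computable_disj computable_eq computable_less computable_mult
      computable_Suc computable_const computable_var)
    fix v :: "nat \<Rightarrow> nat"
    show "\<exists>q. v (Suc 0) = 0 \<or> v 0 < Suc q * v (Suc 0)"
      by (intro exI[of _ "v 0"]) (cases "v (Suc 0)"; simp)
  qed auto
  then show "computable (Suc (Suc 0)) (\<lambda>\<omega> v. v 0 div v (Suc 0))" by (simp only: *)
qed

lemmas computable_intros = computable_const computable_Suc computable_add computable_mult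
  computable_diff computable_div computable_power computable_if computable_not computable_conj
  computable_disj computable_imp computable_less computable_le computable_eq computable_sum
  computable_ex_less computable_all_less computable_oracle

lemma computable_odd: "computable n F \<Longrightarrow> computable n (\<lambda>\<omega> v. of_bool (odd (F \<omega> v)))"
proof (rule computable_comp1[of "\<lambda>\<omega> x. of_bool (odd x)"])
  have "computable (Suc 0) (\<lambda>\<omega> v. of_bool (2 * (v 0 div 2) < v 0))"
    by (intro computable_intros computable_var) auto
  moreover have "2 * (x div 2) < x \<longleftrightarrow> odd x" for x :: nat by presburger
  ultimately show "computable (Suc 0) (\<lambda>\<omega> v. of_bool (odd (v 0)))" by simp
qed

lemma computable_prod_encode: "computable n F \<Longrightarrow> computable n G \<Longrightarrow>
    computable n (\<lambda>\<omega> v. prod_encode (F \<omega> v, G \<omega> v))"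
  unfolding prod_encode_def triangle_def by (simp, intro computable_intros) auto

text \<open>Inverts the pairing by search. A component never exceeds its code, so the quantifier
  over the other component can be bounded and the test is decidable.\<close>

lemma computable_fst_prod_decode: "computable n F \<Longrightarrow> computable n (\<lambda>\<omega> v. fst (prod_decode (F \<omega> v)))"
proof (rule computable_comp1[of "\<lambda>\<omega> x. fst (prod_decode x)"])
  have *: "(LEAST a. \<exists>b<Suc x. prod_encode (a, b) = x) = fst (prod_decode x)" for x
  proof (rule Least_equality)
    have "snd (prod_decode x) < Suc x"
      using le_prod_encode_2[of "snd (prod_decode x)" "fst (prod_decode x)"]
          by (simp del: le_prod_encode_2)
    moreover have "prod_encode (fst (prod_decode x), snd (prod_decode x)) = x" by simp
    ultimately show "\<exists>b<Suc x. prod_encode (fst (prod_decode x), b) = x" by blast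
  qed auto
  have "computable (Suc 0) (\<lambda>\<omega> v. LEAST a. \<exists>b<Suc (v 0). prod_encode (a, b) = v 0)"
  proof (intro computable_LEAST computable_intros computable_prod_encode computable_var)
    fix v :: "nat \<Rightarrow> nat"
    have "snd (prod_decode (v 0)) < Suc (v 0)"
      using le_prod_encode_2[of "snd (prod_decode (v 0))" "fst (prod_decode (v 0))"]
      by (simp del: le_prod_encode_2)
    moreover have "prod_encode (fst (prod_decode (v 0)), snd (prod_decode (v 0))) = v 0" by simp
    ultimately show "\<exists>k. \<exists>b<Suc (v 0). prod_encode (k, b) = v 0" by blast
  qed auto
  then show "computable (Suc 0) (\<lambda>\<omega> v. fst (prod_decode (v 0)))" by (simp only: *)
qed

lemma computable_snd_prod_decode: "computable n F \<Longrightarrow> computable n (\<lambda>\<omega> v. snd (prod_decode (F \<omega> v)))"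
proof (rule computable_comp1[of "\<lambda>\<omega> x. snd (prod_decode x)"])
  have *: "(LEAST b. prod_encode (fst (prod_decode x), b) = x) = snd (prod_decode x)" for x
    by (rule Least_equality) (simp, metis le_refl prod_encode_inverse snd_conv)
  have "computable (Suc 0) (\<lambda>\<omega> v. LEAST b. prod_encode (fst (prod_decode (v 0)), b) = v 0)"
  proof (intro computable_LEAST computable_intros computable_prod_encode
      computable_fst_prod_decode computable_var)
    fix v :: "nat \<Rightarrow> nat"
    have "prod_encode (fst (prod_decode (v 0)), snd (prod_decode (v 0))) = v 0" by simp
    then show "\<exists>k. prod_encode (fst (prod_decode (v 0)), k) = v 0" by blast
  qed auto
  then show "computable (Suc 0) (\<lambda>\<omega> v. snd (prod_decode (v 0)))" by (simp only: *)
qed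

section \<open>Uniform continuity of computable functionals\<close>

text \<open>Tychonoff's theorem: agreement on a square restricts finitely many coordinates, so the
  neighbourhoods, one around each point, form an open cover.\<close>

lemma compact_bits:
  fixes u :: "bits \<Rightarrow> nat"
  obtains W where "finite W" "\<And>\<omega>'. \<exists>\<omega>\<in>W. agree (u \<omega>) \<omega> \<omega>'"
proof -
  let ?T = "product_topology (\<lambda>_. discrete_topology UNIV) UNIV :: bits topology"
  have top: "topspace ?T = UNIV" by simp
  have "compact_space ?T"
    by (simp add: compact_space_product_topology compact_space_discrete_topology)
  moreover have "openin ?T {\<omega>'. agree k \<omega> \<omega>'}" for k \<omega>
  proof -
    have "{\<omega>'. agree k \<omega> \<omega>'} =
        (\<Pi>\<^sub>E q\<in>UNIV. if fst q < k \<and> snd q < k then {\<omega> q} else UNIV)"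
      by (auto simp: agree_def PiE_def Pi_def split: if_splits)
    moreover have "openin ?T (\<Pi>\<^sub>E q\<in>UNIV. if fst q < k \<and> snd q < k then {\<omega> q} else UNIV)"
    proof (rule product_topology_basis)
      show "finite {q. (if fst q < k \<and> snd q < k then {\<omega> q} else UNIV) \<noteq>
          topspace (discrete_topology UNIV)}"
        by (rule finite_subset[of _ "{..<k} \<times> {..<k}"]) (auto split: if_splits)
    qed simp
    ultimately show ?thesis by simp
  qed
  ultimately obtain F where F: "finite F" "F \<subseteq> range (\<lambda>\<omega>. {\<omega>'. agree (u \<omega>) \<omega> \<omega>'})"
    "topspace ?T \<subseteq> \<Union>F"
    unfolding compact_space_def compactin_def
    by (elim conjE allE[of _ "range (\<lambda>\<omega>. {\<omega>'. agree (u \<omega>) \<omega> \<omega>'})"])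
      (use agree_refl in auto)
  obtain W where "finite W" "F = (\<lambda>\<omega>. {\<omega>'. agree (u \<omega>) \<omega> \<omega>'}) ` W"
    using finite_subset_image[OF F(1,2)] by blast
  with F(3) top show thesis by (intro that[of W]) auto
qed

lemma agree_trans: "agree u \<omega>1 \<omega>2 \<Longrightarrow> agree u \<omega>2 \<omega>3 \<Longrightarrow> agree u \<omega>1 \<omega>3"
  by (simp add: agree_def)

text \<open>Finitely many of the neighbourhoods on which \<open>f\<close> is constant cover the
  space. A square that contains all of their squares decides in which of them an oracle
  lies.\<close>

lemma locally_constant_uniform:
  assumes loc: "\<And>\<omega>. \<exists>u. \<forall>\<omega>'. agree u \<omega> \<omega>' \<longrightarrow> f \<omega>' = f \<omega>"
  shows "finite (range f)" "\<exists>k. \<forall>\<omega> \<omega>'. agree k \<omega> \<omega>' \<longrightarrow> f \<omega> = f \<omega>'"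
proof -
  obtain u where u: "\<And>\<omega> \<omega>'. agree (u \<omega>) \<omega> \<omega>' \<Longrightarrow> f \<omega>' = f \<omega>"
    using loc by metis
  obtain W where W: "finite W" "\<And>\<omega>'. \<exists>\<omega>\<in>W. agree (u \<omega>) \<omega> \<omega>'"
    using compact_bits[of u] by blast
  have "range f \<subseteq> f ` W" using W(2) u by fastforce
  then show "finite (range f)" using W(1) by (metis finite_imageI finite_subset)
  define k where "k = (\<Sum>\<omega>\<in>W. u \<omega>)"
  have "f \<omega> = f \<omega>'" if ag: "agree k \<omega> \<omega>'" for \<omega> \<omega>'
  proof -
    obtain w where w: "w \<in> W" "agree (u w) w \<omega>" using W(2) by blast
    have "u w \<le> k" unfolding k_def using w(1) W(1) by (intro member_le_sum) auto
    then have "agree (u w) w \<omega>'" using agree_mono[OF ag] w(2) agree_trans by blast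
    then show ?thesis using u w(2) by metis
  qed
  then show "\<exists>k. \<forall>\<omega> \<omega>'. agree k \<omega> \<omega>' \<longrightarrow> f \<omega> = f \<omega>'" by blast
qed

text \<open>The use is again a total functional, so it is locally constant in its turn and can be
  tested inside a search.\<close>

lemma computable_use:
  assumes "computable n F"
  obtains U where "computable n U" "\<And>\<omega> \<omega>' v. agree (U \<omega> v) \<omega> \<omega>' \<Longrightarrow> F \<omega>' v = F \<omega> v"
proof -
  obtain f where f: "\<And>\<omega> v. eval \<omega> f (map v [0..<n]) = Some (F \<omega> v)"
    using computableE[OF assms] by blast
  obtain e where "use_prog n f e" using ex_use_prog by blast
  then have "\<exists>u. eval \<omega> e (map v [0..<n]) = Some u \<and>
      (\<forall>\<omega>'. agree u \<omega> \<omega>' \<longrightarrow> F \<omega>' v = F \<omega> v)" for \<omega> v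
    using use_progE[of n f e "map v [0..<n]" \<omega> "F \<omega> v"] f by (auto, metis)
  then obtain U where "\<And>\<omega> v. eval \<omega> e (map v [0..<n]) = Some (U \<omega> v)"
    "\<And>\<omega> \<omega>' v. agree (U \<omega> v) \<omega> \<omega>' \<Longrightarrow> F \<omega>' v = F \<omega> v"
    by metis
  then show thesis by (intro that[of U]) (auto intro: computableI)
qed

lemma computable_locally_constant:
  "computable n F \<Longrightarrow> \<exists>u. \<forall>\<omega>'. agree u \<omega> \<omega>' \<longrightarrow> F \<omega>' v = F \<omega> v"
  by (metis computable_use)

section \<open>Oracles supported on a finite square and the computable modulus\<close>

lemma binary_digits: "\<exists>s<(2::nat) ^ n. \<forall>j<n. odd (s div 2 ^ j) \<longleftrightarrow> P j" for n :: nat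
proof (induction n)
  case (Suc n)
  then obtain s :: nat where s: "s < 2 ^ n" "\<forall>j<n. odd (s div 2 ^ j) \<longleftrightarrow> P j" by blast
  define t where "t = s + of_bool (P n) * 2 ^ n"
  have "odd (t div 2 ^ j) \<longleftrightarrow> P j" if "j < Suc n" for j
  proof (cases "j = n")
    case True
    then show ?thesis using s(1) by (simp add: t_def)
  next
    case False
    then have "j < n" using that by simp
    \<comment> \<open>The new summand is an even multiple of \<open>2 ^ j\<close>, so it leaves the
      parity of the quotient alone.\<close>
    then have "(2::nat) ^ n = 2 ^ j * (2 * 2 ^ (n - Suc j))"
      by (simp flip: power_Suc power_add)
    then have "t = s + 2 * (of_bool (P n) * 2 ^ (n - Suc j)) * 2 ^ j"
      by (simp add: t_def)
    then have "t div 2 ^ j = 2 * (of_bool (P n) * 2 ^ (n - Suc j)) + s div 2 ^ j"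
      by (metis div_mult_self1 power_not_zero zero_neq_numeral)
    then show ?thesis using s(2) \<open>j < n\<close> by simp
  qed
  moreover have "t < 2 ^ Suc n" using s(1) by (simp add: t_def)
  ultimately show ?case by blast
qed auto

text \<open>Lists the oracles that vanish outside a square by numbers, so that a quantifier over
  oracles becomes a bounded quantifier over numbers.\<close>

definition grid_bits :: "nat \<Rightarrow> nat \<Rightarrow> bits" where
  "grid_bits k s = (\<lambda>(i, j). i < k \<and> j < k \<and> odd (s div 2 ^ (i * k + j)))"

lemma ex_grid_bits_agree: "\<exists>s<2 ^ (k * k). agree k (grid_bits k s) \<omega>"
proof -
  obtain s :: nat where s: "s < 2 ^ (k * k)"
    "\<And>l. l < k * k \<Longrightarrow> odd (s div 2 ^ l) \<longleftrightarrow> \<omega> (l div k, l mod k)"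
    using binary_digits[of "k * k" "\<lambda>l. \<omega> (l div k, l mod k)"] by blast
  have "grid_bits k s (i, j) = \<omega> (i, j)" if "i < k" "j < k" for i j
  proof -
    have "i * k + j < k * k"
      using that mult_le_mono1[of "Suc i" k k] by simp
    then show ?thesis using that s(2)[of "i * k + j"] by (simp add: grid_bits_def)
  qed
  then show ?thesis using s(1) unfolding agree_def by blast
qed

text \<open>The use of \<open>f\<close> is itself a computable functional, hence bounded. So there is a \<open>k\<close>
    for which the
  use on every oracle that vanishes off the \<open>k\<close>-grid is at most \<open>k\<close>, and such a \<open>k\<close> can be found by
  searching; any oracle has the same computation as its restriction to the grid.\<close>

lemma computable_fan:
  assumes f: "computable (Suc 0) (\<lambda>\<omega> v. f \<omega> (v 0))"
  obtains K where "computable (Suc 0) (\<lambda>\<omega> v. K (v 0))"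
    "\<And>m \<omega> \<omega>'. agree (K m) \<omega> \<omega>' \<Longrightarrow> f \<omega> m = f \<omega>' m"
proof -
  obtain U where U: "computable (Suc 0) U"
    "\<And>\<omega> \<omega>' v. agree (U \<omega> v) \<omega> \<omega>' \<Longrightarrow> f \<omega>' (v 0) = f \<omega> (v 0)"
    using computable_use[OF f] by blast
  define u where "u \<omega> m = U \<omega> (\<lambda>_. m)" for \<omega> m
  have "U = (\<lambda>\<omega> v. u \<omega> (v 0))"
    unfolding u_def by (intro ext computable_cong_args[OF U(1)]) simp
  with U(1) have cfu: "computable (Suc 0) (\<lambda>\<omega> v. u \<omega> (v 0))" by simp
  have u: "f \<omega>' m = f \<omega> m" if "agree (u \<omega> m) \<omega> \<omega>'" for \<omega> \<omega>' m
    using U(2)[of \<omega> "\<lambda>_. m" \<omega>'] that by (simp add: u_def)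
  have ex: "\<exists>k. \<forall>s<2 ^ (k * k). u (grid_bits k s) m \<le> k" for m
  proof -
    have "finite (range (\<lambda>\<omega>. u \<omega> m))"
      using computable_locally_constant[OF cfu, of _ "\<lambda>_. m"]
      by (intro locally_constant_uniform)
    then obtain B where "\<And>\<omega>. u \<omega> m \<le> B"
      unfolding finite_nat_set_iff_bounded_le by blast
    then show ?thesis by blast
  qed
  define K where "K m = (LEAST k. \<forall>s<2 ^ (k * k). u (grid_bits k s) m \<le> k)" for m
  have K: "\<forall>s<2 ^ (K m * K m). u (grid_bits (K m) s) m \<le> K m" for m
    unfolding K_def by (rule LeastI_ex[OF ex])
  show thesis
  proof (rule that)
    show "computable (Suc 0) (\<lambda>\<omega> v. K (v 0))"
      unfolding K_def grid_bits_def
      using ex[unfolded grid_bits_def]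
      by (intro computable_LEAST computable_intros computable_oracle_subst1[OF cfu]
          computable_odd computable_var) auto
    fix m \<omega> \<omega>' assume ag: "agree (K m) \<omega> \<omega>'"
    obtain s where s: "s < 2 ^ (K m * K m)" "agree (K m) (grid_bits (K m) s) \<omega>"
      using ex_grid_bits_agree by blast
    have "agree (u (grid_bits (K m) s) m) (grid_bits (K m) s) \<omega>"
      "agree (u (grid_bits (K m) s) m) (grid_bits (K m) s) \<omega>'"
      using K s agree_mono agree_trans[OF s(2) ag] by blast+
    then show "f \<omega> m = f \<omega>' m" using u by metis
  qed
qed

section \<open>Rational-valued computable functionals\<close>

text \<open>An even code \<open>p\<close> stands for the integer \<open>p / 2\<close> and an odd one for \<open>- (p + 1) / 2\<close>. So the
  quotient of the integers coded by \<open>p\<close> and \<open>q\<close> is nonnegative if \<open>p\<close> and \<open>q\<close> have the same parity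
  and nonpositive otherwise, in which case it is rounded up to \<open>0\<close>.\<close>

definition approx_code :: "nat \<Rightarrow> nat \<Rightarrow> nat" where
  "approx_code c m = (let p = fst (prod_decode c); q = snd (prod_decode c) in
    if odd p \<longleftrightarrow> odd q then Suc p div 2 * 2 ^ m div (Suc q div 2) else 0)"

lemma computable_approx_code: "computable n F \<Longrightarrow> computable n G \<Longrightarrow>
    computable n (\<lambda>\<omega> v. approx_code (F \<omega> v) (G \<omega> v))"
proof (rule computable_comp2[of "\<lambda>\<omega> c m. approx_code c m"])
  have "odd p = odd q \<longleftrightarrow> (odd p \<longrightarrow> odd q) \<and> (odd q \<longrightarrow> odd p)" for p q :: nat by blast
  then show "computable (Suc (Suc 0)) (\<lambda>\<omega> v. approx_code (v 0) (v (Suc 0)))"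
    unfolding approx_code_def Let_def
    by (simp only:) (intro computable_intros computable_odd computable_fst_prod_decode
        computable_snd_prod_decode computable_var; simp)
qed

text \<open>\<open>Suc n div 2\<close> is the absolute value for either parity, so only the sign
  depends on the case.\<close>

lemma int_decode_eq: "int_decode n = (if odd n then - int (Suc n div 2) else int (Suc n div 2))"
  by (auto simp: int_decode_def sum_decode_def elim!: oddE)

lemma enum_rat_eq: "enum_rat c = (case prod_decode c of (p, q) \<Rightarrow>
    real_of_int (int_decode p) / real_of_int (int_decode q))"
  by (simp add: enum_rat_def nat_to_rat_surj_def of_rat_rat split: prod.splits)
    (metis Fract_of_int_quotient of_rat_divide of_rat_of_int_eq)

lemma abs_divide_two_power: "\<bar>x\<bar> / 2 ^ m = \<bar>x / 2 ^ m :: real\<bar>"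
  by (simp add: abs_divide)

lemma approx_code_error: "\<bar>real (approx_code c m) / 2 ^ m - max 0 (enum_rat c)\<bar> \<le> 1 / 2 ^ m"
proof -
  obtain p q where pq: "prod_decode c = (p, q)" by fastforce
  define P Q where "P = Suc p div 2" and "Q = Suc q div 2"
  have e: "enum_rat c = (if odd p = odd q then real P / real Q else - (real P / real Q))"
    unfolding enum_rat_eq pq prod.case int_decode_eq P_def [symmetric] Q_def [symmetric] by simp
  show ?thesis
  proof (cases "odd p = odd q")
    case False
    then have "approx_code c m = 0" by (simp add: approx_code_def pq)
    moreover have "enum_rat c \<le> 0" unfolding e using False by simp
    ultimately show ?thesis by simp
  next
    case True
    \<comment> \<open>This includes \<open>Q = 0\<close>, where natural and real division both give
      0.\<close>
    have "approx_code c m = nat \<lfloor>real (P * 2 ^ m) / real Q\<rfloor>"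
      unfolding floor_divide_of_nat_eq using True
          by (simp add: approx_code_def pq P_def Q_def Let_def)
    then have "real (approx_code c m) = of_int \<lfloor>real (P * 2 ^ m) / real Q\<rfloor>"
      by simp
    then have "\<bar>real (approx_code c m) - real P * 2 ^ m / real Q\<bar> \<le> 1"
      using floor_correct[of "real P * 2 ^ m / real Q"] unfolding of_nat_mult of_nat_power
      by (simp add: abs_le_iff) linarith
    then have "\<bar>real (approx_code c m) - real P * 2 ^ m / real Q\<bar> / 2 ^ m \<le> 1 / 2 ^ m"
      by (intro divide_right_mono) auto
    moreover have "\<bar>real (approx_code c m) - real P * 2 ^ m / real Q\<bar> / 2 ^ m =
        \<bar>real (approx_code c m) / 2 ^ m - real P / real Q\<bar>"
      by (subst abs_divide_two_power) (simp add: diff_divide_distrib)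
    ultimately show ?thesis using True e by simp
  qed
qed

lemma enum_rat_prod_encode: "enum_rat (prod_encode (2 * a, 2 * b)) = real a / real b"
  by (simp add: enum_rat_eq int_decode_eq)

text \<open>With neither a reduced form nor signed numbers, arithmetic needs only functionals with
  natural values, and comparing two rationals comes down to comparing two naturals. The
  \<open>Suc\<close> excludes a zero denominator.\<close>

definition computable_rat :: "nat \<Rightarrow> (bits \<Rightarrow> (nat \<Rightarrow> nat) \<Rightarrow> real) \<Rightarrow> bool" where
  "computable_rat n R \<longleftrightarrow> (\<exists>A B C. computable n A \<and> computable n B \<and> computable n C \<and>
    (\<forall>\<omega> v. R \<omega> v = (real (A \<omega> v) - real (B \<omega> v)) / real (Suc (C \<omega> v))))"

lemma computable_ratI:
  assumes "computable n A" "computable n B" "computable n C" "\<And>\<omega> v. 0 < C \<omega> v"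
    "\<And>\<omega> v. R \<omega> v = (real (A \<omega> v) - real (B \<omega> v)) / real (C \<omega> v)"
  shows "computable_rat n R"
  unfolding computable_rat_def
  using assms by (intro exI[of _ A] exI[of _ B] exI[of _ "\<lambda>\<omega> v. C \<omega> v - 1"]) (auto intro!:
      computable_intros)

lemma computable_ratE:
  assumes "computable_rat n R"
  obtains A B C where "computable n A" "computable n B" "computable n C" "\<And>\<omega> v. 0 < C \<omega> v"
    "\<And>\<omega> v. R \<omega> v = (real (A \<omega> v) - real (B \<omega> v)) / real (C \<omega> v)"
proof -
  obtain A B C where "computable n A" "computable n B" "computable n C"
    "\<And>\<omega> v. R \<omega> v = (real (A \<omega> v) - real (B \<omega> v)) / real (Suc (C \<omega> v))"
    using assms unfolding computable_rat_def by blast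
  then show thesis by (intro that[of A B "\<lambda>\<omega> v. Suc (C \<omega> v)"]) (auto intro: computable_Suc)
qed

lemma computable_rat_of_nat: "computable n F \<Longrightarrow> computable_rat n (\<lambda>\<omega> v. real (F \<omega> v))"
  by (rule computable_ratI[of n F "\<lambda>_ _. 0" "\<lambda>_ _. 1"]) (auto intro: computable_intros)

lemma computable_rat_const: "computable_rat n (\<lambda>\<omega> v. of_rat r)"
proof -
  obtain a b where r: "r = Fract a b" "b > 0" by (cases r) auto
  have "of_rat r = (real (nat a) - real (nat (- a))) / real (nat b)"
    using r by (simp add: of_rat_rat)
  then show ?thesis
    by (intro computable_ratI[of n "\<lambda>_ _. nat a" "\<lambda>_ _. nat (- a)" "\<lambda>_ _. nat b"])
      (use r in \<open>auto intro: computable_intros\<close>)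
qed

lemma computable_rat_diff:
  assumes "computable_rat n R" "computable_rat n S"
  shows "computable_rat n (\<lambda>\<omega> v. R \<omega> v - S \<omega> v)"
proof -
  obtain A B C where R: "computable n A" "computable n B" "computable n C" "\<And>\<omega> v. 0 < C \<omega> v"
    "\<And>\<omega> v. R \<omega> v = (real (A \<omega> v) - real (B \<omega> v)) / real (C \<omega> v)"
    using computable_ratE[OF assms(1)] by blast
  obtain A' B' C' where S: "computable n A'" "computable n B'" "computable n C'" "\<And>\<omega> v. 0 < C' \<omega> v"
    "\<And>\<omega> v. S \<omega> v = (real (A' \<omega> v) - real (B' \<omega> v)) / real (C' \<omega> v)"
    using computable_ratE[OF assms(2)] by blast
  show ?thesis
  proof (rule computable_ratI)
    show "computable n (\<lambda>\<omega> v. A \<omega> v * C' \<omega> v + B' \<omega> v * C \<omega> v)"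
      "computable n (\<lambda>\<omega> v. B \<omega> v * C' \<omega> v + A' \<omega> v * C \<omega> v)"
      "computable n (\<lambda>\<omega> v. C \<omega> v * C' \<omega> v)"
      using R S by (auto intro: computable_intros)
    fix \<omega> v
    show "0 < C \<omega> v * C' \<omega> v" using R(4) S(4) by simp
    show "R \<omega> v - S \<omega> v = (real (A \<omega> v * C' \<omega> v + B' \<omega> v * C \<omega> v) -
        real (B \<omega> v * C' \<omega> v + A' \<omega> v * C \<omega> v)) / real (C \<omega> v * C' \<omega> v)"
      using R(4)[of \<omega> v] S(4)[of \<omega> v] unfolding R(5) S(5) by (simp add: field_simps)
  qed
qed

lemma computable_rat_add:
  assumes "computable_rat n R" "computable_rat n S"
  shows "computable_rat n (\<lambda>\<omega> v. R \<omega> v + S \<omega> v)"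
  using computable_rat_diff[OF assms(1) computable_rat_diff[OF computable_rat_of_nat[of n
      "\<lambda>_ _. 0"] assms(2)]]
  by (simp add: computable_const)

lemma computable_rat_divide_nat:
  assumes "computable_rat n R" "computable n F" "\<And>\<omega> v. 0 < F \<omega> v"
  shows "computable_rat n (\<lambda>\<omega> v. R \<omega> v / real (F \<omega> v))"
proof -
  obtain A B C where R: "computable n A" "computable n B" "computable n C" "\<And>\<omega> v. 0 < C \<omega> v"
    "\<And>\<omega> v. R \<omega> v = (real (A \<omega> v) - real (B \<omega> v)) / real (C \<omega> v)"
    using computable_ratE[OF assms(1)] by blast
  then show ?thesis
    by (intro computable_ratI[of n A B "\<lambda>\<omega> v. C \<omega> v * F \<omega> v"]) (auto intro: computable_intros assms)
qed

lemma computable_rat_if: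
  assumes "computable n (\<lambda>\<omega> v. of_bool (P \<omega> v))" "computable_rat n R" "computable_rat n S"
  shows "computable_rat n (\<lambda>\<omega> v. if P \<omega> v then R \<omega> v else S \<omega> v)"
proof -
  obtain A B C where R: "computable n A" "computable n B" "computable n C" "\<And>\<omega> v. 0 < C \<omega> v"
    "\<And>\<omega> v. R \<omega> v = (real (A \<omega> v) - real (B \<omega> v)) / real (C \<omega> v)"
    using computable_ratE[OF assms(2)] by blast
  obtain A' B' C' where S: "computable n A'" "computable n B'" "computable n C'" "\<And>\<omega> v. 0 < C' \<omega> v"
    "\<And>\<omega> v. S \<omega> v = (real (A' \<omega> v) - real (B' \<omega> v)) / real (C' \<omega> v)"
    using computable_ratE[OF assms(3)] by blast
  show ?thesis
    by (rule computable_ratI[of n "\<lambda>\<omega> v. if P \<omega> v then A \<omega> v else A' \<omega> v"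
          "\<lambda>\<omega> v. if P \<omega> v then B \<omega> v else B' \<omega> v"
          "\<lambda>\<omega> v. if P \<omega> v then C \<omega> v else C' \<omega> v"])
      (use R S assms(1) in \<open>auto intro: computable_if\<close>)
qed

lemma computable_rat_less:
  assumes "computable_rat n R" "computable_rat n S"
  shows "computable n (\<lambda>\<omega> v. of_bool (R \<omega> v < S \<omega> v))"
proof -
  obtain A B C where D: "computable n A" "computable n B" "computable n C" "\<And>\<omega> v. 0 < C \<omega> v"
    "\<And>\<omega> v. S \<omega> v - R \<omega> v = (real (A \<omega> v) - real (B \<omega> v)) / real (C \<omega> v)"
    using computable_ratE[OF computable_rat_diff[OF assms(2,1)]] by blast
  have "R \<omega> v < S \<omega> v \<longleftrightarrow> B \<omega> v < A \<omega> v" for \<omega> v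
  proof -
    have "R \<omega> v < S \<omega> v \<longleftrightarrow> 0 < S \<omega> v - R \<omega> v" by simp
    also have "\<dots> \<longleftrightarrow> B \<omega> v < A \<omega> v"
      unfolding D(5) using D(4)[of \<omega> v] by (simp add: zero_less_divide_iff)
    finally show ?thesis .
  qed
  then show ?thesis using computable_less[OF D(2,1)] by simp
qed

text \<open>The number of summands varies with the arguments, so the sum is brought over one common
  denominator, the product of all of them.\<close>

lemma computable_rat_sum:
  assumes "computable_rat (Suc n) (\<lambda>\<omega> v. R \<omega> (v 0) (\<lambda>i. v (Suc i)))" "computable n B"
  shows "computable_rat n (\<lambda>\<omega> v. \<Sum>k<B \<omega> v. R \<omega> k v)"
proof -
  obtain X Y Z where XYZ: "computable (Suc n) X" "computable (Suc n) Y" "computable (Suc n) Z"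
      "\<And>\<omega> v. 0 < Z \<omega> v"
    "\<And>\<omega> v. R \<omega> (v 0) (\<lambda>i. v (Suc i)) = (real (X \<omega> v) - real (Y \<omega> v)) / real (Z \<omega> v)"
    using computable_ratE[OF assms(1)] by blast
  let ?c = "case_nat :: nat \<Rightarrow> (nat \<Rightarrow> nat) \<Rightarrow> nat \<Rightarrow> nat"
  define P where "P \<omega> v = (\<Prod>k<B \<omega> v. Z \<omega> (?c k v))" for \<omega> v
  have c: "?c (v 0) (\<lambda>i. v (Suc i)) = v" for v
    by (auto split: nat.splits)
  have R: "R \<omega> k v = (real (X \<omega> (?c k v)) - real (Y \<omega> (?c k v))) / real (Z \<omega> (?c k v))" for \<omega> k v
    using XYZ(5)[of \<omega> "?c k v"] by simp
  have P: "computable n P" unfolding P_def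
    by (intro computable_prod assms(2)) (simp add: c XYZ)
  have P': "computable (Suc n) (\<lambda>\<omega> v. P \<omega> (\<lambda>i. v (Suc i)))"
    by (rule computable_shift[OF P])
  have pos: "0 < P \<omega> v" for \<omega> v using XYZ(4) by (simp add: P_def prod_pos)
  have W: "computable n (\<lambda>\<omega> v. \<Sum>k<B \<omega> v. W \<omega> (?c k v) * (P \<omega> v div Z \<omega> (?c k v)))"
    if "computable (Suc n) W" for W
    by (intro computable_sum computable_mult computable_div assms(2) P') (simp_all add: c XYZ that)
  show ?thesis
  proof (rule computable_ratI[OF W[OF XYZ(1)] W[OF XYZ(2)] P pos])
    fix \<omega> v
    have "R \<omega> k v = (real (X \<omega> (?c k v) * (P \<omega> v div Z \<omega> (?c k v))) -
        real (Y \<omega> (?c k v) * (P \<omega> v div Z \<omega> (?c k v)))) / real (P \<omega> v)" if "k < B \<omega> v" for k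
    proof -
      \<comment> \<open>Divisibility makes the quotient of naturals exact.\<close>
      have "Z \<omega> (?c k v) dvd P \<omega> v" unfolding P_def using that by (intro dvd_prodI) auto
      then have "real (P \<omega> v div Z \<omega> (?c k v)) = real (P \<omega> v) / real (Z \<omega> (?c k v))"
        by (rule real_of_nat_div)
      then show ?thesis
        unfolding R using pos[of \<omega> v] XYZ(4)[of \<omega> "?c k v"] by (simp add: field_simps)
    qed
    then show "(\<Sum>k<B \<omega> v. R \<omega> k v) =
      (real (\<Sum>k<B \<omega> v. X \<omega> (?c k v) * (P \<omega> v div Z \<omega> (?c k v))) -
       real (\<Sum>k<B \<omega> v. Y \<omega> (?c k v) * (P \<omega> v div Z \<omega> (?c k v)))) / real (P \<omega> v)"
      by (simp add: sum_subtractf diff_divide_distrib sum_divide_distrib)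
  qed
qed

section \<open>Continuous functions on the coin space\<close>

interpretation coin: prob_space coin
  unfolding coin_def by (intro prob_space_PiM prob_space_measure_pmf)

lemma space_coin [simp]: "space coin = UNIV"
  by (simp add: coin_def space_PiM PiE_UNIV_domain)

text \<open>All that the measure theory needs to know about a computable function: it yields
  measurability and boundedness, and makes almost everywhere equal functions equal.\<close>

definition ucont :: "(bits \<Rightarrow> real) \<Rightarrow> bool" where
  "ucont f \<longleftrightarrow> (\<forall>\<epsilon>>0. \<exists>k. \<forall>\<omega> \<omega>'. agree k \<omega> \<omega>' \<longrightarrow> \<bar>f \<omega> - f \<omega>'\<bar> < \<epsilon>)"

text \<open>Picks one representative from each of the finitely many classes of oracles that agree on
  the square.\<close>

definition blank :: "nat \<Rightarrow> bits \<Rightarrow> bits" where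
  "blank k \<omega> = (\<lambda>(i, j). i < k \<and> j < k \<and> \<omega> (i, j))"

lemma agree_blank: "agree k \<omega> (blank k \<omega>)"
  by (simp add: agree_def blank_def)

lemma blank_eq_iff: "blank k \<omega> = blank k \<omega>' \<longleftrightarrow> agree k \<omega> \<omega>'"
  by (auto simp: blank_def agree_def fun_eq_iff)

lemma finite_range_blank: "finite (range (blank k))"
  by (rule locally_constant_uniform) (metis blank_eq_iff)

lemma sets_coin_agree [measurable]: "{\<omega>'. agree k \<omega> \<omega>'} \<in> sets coin"
proof -
  have [measurable]: "(\<lambda>\<omega>. \<omega> q) \<in> coin \<rightarrow>\<^sub>M count_space UNIV" for q
    unfolding coin_def by (rule measurable_compose[OF measurable_component_singleton]) auto
  have "{\<omega>'\<in>space coin. \<forall>i\<in>{..<k}. \<forall>j\<in>{..<k}. \<omega> (i, j) = \<omega>' (i, j)} \<in> sets coin"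
    by measurable
  then show ?thesis by (simp add: agree_def Ball_def)
qed

lemma simple_function_blank: "simple_function coin (\<lambda>\<omega>. f (blank k \<omega>))"
proof -
  have "simple_function coin (blank k)"
    unfolding simple_function_def
  proof (intro conjI ballI)
    fix \<sigma> assume "\<sigma> \<in> blank k ` space coin"
    then obtain \<omega> where "\<sigma> = blank k \<omega>" by auto
    then have "blank k -` {\<sigma>} \<inter> space coin = {\<omega>'. agree k \<omega> \<omega>'}"
      by (auto simp: blank_eq_iff agree_sym)
    then show "blank k -` {\<sigma>} \<inter> space coin \<in> sets coin" by simp
  qed (simp add: finite_range_blank)
  from simple_function_compose[OF this, of f] show ?thesis by (simp add: comp_def)
qed

text \<open>\<open>f\<close> is the pointwise limit of the simple functions that evaluate it at
  these representatives.\<close>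

lemma ucont_measurable [measurable_dest]:
  assumes f: "ucont f"
  shows "f \<in> borel_measurable coin"
proof -
  have "(\<lambda>k. f (blank k \<omega>)) \<longlonglongrightarrow> f \<omega>" for \<omega>
  proof (rule LIMSEQ_I)
    fix \<epsilon> :: real assume "0 < \<epsilon>"
    then obtain k where k: "\<And>\<omega> \<omega>'. agree k \<omega> \<omega>' \<Longrightarrow> \<bar>f \<omega> - f \<omega>'\<bar> < \<epsilon>"
      using f unfolding ucont_def by blast
    then show "\<exists>k0. \<forall>k\<ge>k0. norm (f (blank k \<omega>) - f \<omega>) < \<epsilon>"
      using agree_mono[OF agree_sym[OF agree_blank]] by (intro exI[of _ k]) auto
  qed
  then show ?thesis
    by (rule borel_measurable_LIMSEQ_real)
      (rule borel_measurable_simple_function, rule simple_function_blank)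
qed

lemma ucont_bounded:
  assumes f: "ucont f"
  obtains B where "\<And>\<omega>. \<bar>f \<omega>\<bar> \<le> B"
proof -
  obtain k where k: "\<And>\<omega> \<omega>'. agree k \<omega> \<omega>' \<Longrightarrow> \<bar>f \<omega> - f \<omega>'\<bar> < 1"
    using f unfolding ucont_def by (metis zero_less_one)
  have fin: "finite ((\<lambda>\<omega>. \<bar>f \<omega>\<bar>) ` range (blank k))" using finite_range_blank by blast
  show thesis
  proof (rule that)
    fix \<omega>
    have "\<bar>f (blank k \<omega>)\<bar> \<le> Max ((\<lambda>\<omega>. \<bar>f \<omega>\<bar>) ` range (blank k))"
      by (intro Max_ge fin) auto
    then show "\<bar>f \<omega>\<bar> \<le> Max ((\<lambda>\<omega>. \<bar>f \<omega>\<bar>) ` range (blank k)) + 1"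
      using k[OF agree_blank, of \<omega>] by linarith
  qed
qed

lemma ucont_integrable: "ucont f \<Longrightarrow> integrable coin f"
  by (rule ucont_bounded, assumption, rule coin.integrable_const_bound) (auto intro: ucont_measurable)

lemma prod_emb_pmf:
  "prod_emb UNIV (\<lambda>q. measure_pmf (p q)) J (Pi\<^sub>E J F) = {\<omega>. \<forall>q\<in>J. \<omega> q \<in> F q}"
  by (rule set_eqI) (simp add: prod_emb_def space_PiM PiE_UNIV_domain restrict_PiE_iff Pi_iff)

text \<open>A cylinder fixes \<open>k * k\<close> independent fair bits.\<close>

lemma emeasure_agree_pos: "0 < emeasure coin {\<omega>'. agree k \<omega> \<omega>'}"
proof -
  let ?J = "{..<k} \<times> {..<k}" and ?M = "\<lambda>_ :: nat \<times> nat. measure_pmf (bernoulli_pmf (1/2))"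
  have "{\<omega>'. agree k \<omega> \<omega>'} = prod_emb UNIV ?M ?J (\<Pi>\<^sub>E q\<in>?J. {\<omega> q})"
    unfolding prod_emb_pmf by (auto simp: agree_def)
  then have "emeasure coin {\<omega>'. agree k \<omega> \<omega>'} = (\<Prod>q\<in>?J. emeasure (?M q) {\<omega> q})"
    unfolding coin_def by (simp only:) (intro emeasure_PiM_emb; simp add: prob_space_measure_pmf)
  also have "\<dots> = (\<Prod>q\<in>?J. ennreal (1/2))"
  proof (rule prod.cong)
    fix q
    have "pmf (bernoulli_pmf (1/2)) (\<omega> q) = 1/2" by (cases "\<omega> q") auto
    then show "emeasure (?M q) {\<omega> q} = ennreal (1/2)" by (simp only: emeasure_pmf_single)
  qed simp
  also have "\<dots> = ennreal ((1/2) ^ (k * k))" by (simp only: prod_constant ennreal_power) simp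
  also have "\<dots> > 0" by simp
  finally show ?thesis .
qed

text \<open>Continuous functions that differ at one point differ on a cylinder around it, which is
  not null. Identities required only almost surely thereby become available at the point under
  study.\<close>

lemma ucont_AE_eq:
  assumes f: "ucont f" and g: "ucont g" and ae: "AE \<omega> in coin. f \<omega> = g \<omega>"
  shows "f \<omega> = g \<omega>"
proof (rule ccontr)
  assume ne: "f \<omega> \<noteq> g \<omega>"
  \<comment> \<open>Half of the gap: two movements smaller than this cannot close it.\<close>
  define \<epsilon> where "\<epsilon> = \<bar>f \<omega> - g \<omega>\<bar> / 2"
  have "0 < \<epsilon>" using ne by (simp add: \<epsilon>_def)
  obtain k where k: "\<And>\<omega> \<omega>'. agree k \<omega> \<omega>' \<Longrightarrow> \<bar>f \<omega> - f \<omega>'\<bar> < \<epsilon>"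
    using f \<open>0 < \<epsilon>\<close> unfolding ucont_def by blast
  obtain l where l: "\<And>\<omega> \<omega>'. agree l \<omega> \<omega>' \<Longrightarrow> \<bar>g \<omega> - g \<omega>'\<bar> < \<epsilon>"
    using g \<open>0 < \<epsilon>\<close> unfolding ucont_def by blast
  have "f \<omega>' \<noteq> g \<omega>'" if "agree (max k l) \<omega> \<omega>'" for \<omega>'
  proof
    assume "f \<omega>' = g \<omega>'"
    then have "\<bar>f \<omega> - g \<omega>\<bar> \<le> \<bar>f \<omega> - f \<omega>'\<bar> + \<bar>g \<omega> - g \<omega>'\<bar>" by linarith
    then show False
      using k[OF agree_mono[OF that]] l[OF agree_mono[OF that]] unfolding \<epsilon>_def by simp
  qed
  then have "AE \<omega>' in coin. \<omega>' \<notin> {\<omega>'. agree (max k l) \<omega> \<omega>'}"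
    using ae by (auto elim!: eventually_mono)
  then have "emeasure coin {\<omega>'. agree (max k l) \<omega> \<omega>'} = 0"
    using AE_iff_measurable[OF sets_coin_agree, of "\<lambda>\<omega>'. \<omega>' \<notin> {\<omega>'. agree (max k l) \<omega> \<omega>'}"
        "max k l" \<omega>] by simp
  then show False using emeasure_agree_pos[of "max k l" \<omega>] by simp
qed

section \<open>Invariance of the coin measure under flipping a bit\<close>

definition flip :: "nat \<times> nat \<Rightarrow> bits \<Rightarrow> bits" where
  "flip q \<omega> = (\<lambda>r. if r = q then \<not> \<omega> r else \<omega> r)"

lemma flip_measurable [measurable]: "flip q \<in> coin \<rightarrow>\<^sub>M coin"
proof -
  have "(\<lambda>\<omega>. flip q \<omega> i) \<in> coin \<rightarrow>\<^sub>M measure_pmf (bernoulli_pmf (1/2))" for i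
  proof -
    have "(\<lambda>\<omega>. (if i = q then Not else id) (\<omega> i)) \<in> coin \<rightarrow>\<^sub>M measure_pmf (bernoulli_pmf (1/2))"
      unfolding coin_def by (rule measurable_compose[OF measurable_component_singleton]) auto
    moreover have "(\<lambda>\<omega>. (if i = q then Not else id) (\<omega> i)) = (\<lambda>\<omega>. flip q \<omega> i)"
      by (auto simp: flip_def)
    ultimately show ?thesis by (simp only:)
  qed
  then show ?thesis
    by (subst (2) coin_def, intro measurable_PiM_single') (auto simp: space_PiM PiE_UNIV_domain)
qed

text \<open>The product measure is determined on cylinders. Flipping negates at most one factor of a
  cylinder, and a fair coin is invariant under negation.\<close>

lemma distr_coin_flip: "distr coin coin (flip q) = coin"
proof -
  let ?M = "\<lambda>_ :: nat \<times> nat. measure_pmf (bernoulli_pmf (1/2))"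
  interpret product_prob_space ?M UNIV
    by unfold_locales
  have "distr coin coin (flip q) = PiM UNIV ?M"
  proof (rule PiM_eq)
    show "sets (distr coin coin (flip q)) = sets (PiM UNIV ?M)" by (simp add: coin_def)
    fix J :: "(nat \<times> nat) set" and F :: "nat \<times> nat \<Rightarrow> bool set"
    assume J: "finite J"
    define F' where "F' i = (if i = q then Not -` F i else F i)" for i
    have [measurable]: "prod_emb UNIV ?M J (Pi\<^sub>E J F) \<in> sets coin"
      unfolding coin_def using J by (intro sets_PiM_I) auto
    have "map_pmf Not (bernoulli_pmf (1/2)) = bernoulli_pmf (1/2)"
    proof (rule pmf_eqI)
      fix b
      have "pmf (map_pmf Not (bernoulli_pmf (1/2))) (Not (\<not> b)) = pmf (bernoulli_pmf (1/2)) (\<not> b)"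
        by (rule pmf_map_inj') (auto simp: inj_def)
      then show "pmf (map_pmf Not (bernoulli_pmf (1/2))) b = pmf (bernoulli_pmf (1/2)) b"
        by (cases b) auto
    qed
    then have "emeasure (measure_pmf (bernoulli_pmf (1/2))) (Not -` A) =
        emeasure (measure_pmf (bernoulli_pmf (1/2))) A" for A
      using emeasure_map_pmf[of Not "bernoulli_pmf (1/2)" A] by simp
    then have F': "emeasure (?M i) (F' i) = emeasure (?M i) (F i)" for i by (simp add: F'_def)
    have "flip q -` prod_emb UNIV ?M J (Pi\<^sub>E J F) \<inter> space coin = prod_emb UNIV ?M J (Pi\<^sub>E J F')"
      unfolding prod_emb_pmf by (auto simp: flip_def F'_def)
    then have "emeasure (distr coin coin (flip q)) (prod_emb UNIV ?M J (Pi\<^sub>E J F)) =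
        emeasure coin (prod_emb UNIV ?M J (Pi\<^sub>E J F'))"
      by (simp add: emeasure_distr)
    also have "\<dots> = (\<Prod>i\<in>J. emeasure (?M i) (F' i))"
      unfolding coin_def using J by (intro emeasure_PiM_emb) auto
    finally show "emeasure (distr coin coin (flip q)) (prod_emb UNIV ?M J (Pi\<^sub>E J F)) =
        (\<Prod>i\<in>J. emeasure (?M i) (F i))" by (simp add: F')
  qed
  then show ?thesis by (simp add: coin_def)
qed

lemma integral_coin_flip:
  assumes "ucont f"
  shows "(\<integral>\<omega>. f (flip q \<omega>) \<partial>coin) = (\<integral>\<omega>. f \<omega> \<partial>coin)"
proof -
  have "(\<integral>\<omega>. f \<omega> \<partial>distr coin coin (flip q)) = (\<integral>\<omega>. f (flip q \<omega>) \<partial>coin)"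
    using assms by (intro integral_distr) auto
  then show ?thesis by (simp add: distr_coin_flip)
qed

lemma agree_resample:
  "agree k \<omega> \<omega>' \<Longrightarrow> agree k \<eta> \<eta>' \<Longrightarrow> agree k (resample p \<omega> \<eta>) (resample p \<omega>' \<eta>')"
  by (simp add: agree_def resample_def)

lemma ucont_resample: "ucont f \<Longrightarrow> ucont (\<lambda>\<omega>'. f (resample p \<omega> \<omega>'))"
  unfolding ucont_def by (meson agree_refl agree_resample)

lemma integral_coin_abs_le:
  fixes f :: "bits \<Rightarrow> real"
  assumes "integrable coin f" "\<And>\<omega>. \<bar>f \<omega>\<bar> \<le> B"
  shows "\<bar>\<integral>\<omega>. f \<omega> \<partial>coin\<bar> \<le> B"
proof -
  have "f \<omega> \<le> B" "- B \<le> f \<omega>" for \<omega> using assms(2)[of \<omega>] by linarith+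
  then show ?thesis
    using coin.integral_le_const[OF assms(1), of B] coin.integral_ge_const[OF assms(1), of "- B"]
    by (auto simp: abs_le_iff)
qed

lemma expect_from_diff_le:
  assumes f: "ucont f" and g: "ucont g" and le: "\<And>\<omega>. \<bar>f \<omega> - g \<omega>\<bar> \<le> B"
  shows "\<bar>expect_from p f \<omega> - expect_from p g \<omega>\<bar> \<le> B"
proof -
  have i: "integrable coin (\<lambda>\<omega>'. f (resample p \<omega> \<omega>'))" "integrable coin (\<lambda>\<omega>'. g (resample p \<omega> \<omega>'))"
    by (intro ucont_integrable ucont_resample f g)+
  show ?thesis
    unfolding expect_from_def Bochner_Integration.integral_diff[OF i, symmetric]
    by (intro integral_coin_abs_le Bochner_Integration.integrable_diff i le)
qed

lemma ucont_expect_from: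
  assumes f: "ucont f"
  shows "ucont (expect_from p f)"
  unfolding ucont_def
proof (intro allI impI)
  fix \<epsilon> :: real assume "0 < \<epsilon>"
  \<comment> \<open>Integration only preserves the weak inequality, so the integrand is kept within
    half of the bound.\<close>
  then obtain k where k: "\<And>\<omega> \<omega>'. agree k \<omega> \<omega>' \<Longrightarrow> \<bar>f \<omega> - f \<omega>'\<bar> < \<epsilon> / 2"
    using f unfolding ucont_def by (metis half_gt_zero)
  have "\<bar>expect_from p f \<omega> - expect_from p f \<omega>'\<bar> < \<epsilon>" if ag: "agree k \<omega> \<omega>'" for \<omega> \<omega>'
  proof -
    have "\<bar>f (resample p \<omega> \<omega>'') - f (resample p \<omega>' \<omega>'')\<bar> \<le> \<epsilon> / 2" for \<omega>''
      by (intro less_imp_le k agree_resample ag agree_refl)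
    then have "\<bar>\<integral>\<omega>''. f (resample p \<omega> \<omega>'') - f (resample p \<omega>' \<omega>'') \<partial>coin\<bar> \<le> \<epsilon> / 2"
      by (intro integral_coin_abs_le Bochner_Integration.integrable_diff ucont_integrable
          ucont_resample f)
    then have "\<bar>expect_from p f \<omega> - expect_from p f \<omega>'\<bar> \<le> \<epsilon> / 2"
      unfolding expect_from_def
      by (subst (asm) Bochner_Integration.integral_diff) (intro ucont_integrable ucont_resample f)+
    then show ?thesis using \<open>0 < \<epsilon>\<close> by simp
  qed
  then show "\<exists>k. \<forall>\<omega> \<omega>'. agree k \<omega> \<omega>' \<longrightarrow> \<bar>expect_from p f \<omega> - expect_from p f \<omega>'\<bar> < \<epsilon>" by blast
qed

text \<open>The pointwise counterpart of \<open>depends_only_below\<close>, polymorphic because it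
  is also applied to numerical codes and to decisions whether to bet.\<close>

definition below :: "nat \<times> nat \<Rightarrow> (bits \<Rightarrow> 'a) \<Rightarrow> bool" where
  "below p f \<longleftrightarrow> (\<forall>\<omega> \<omega>'. (\<forall>q. q \<prec> p \<longrightarrow> \<omega> q = \<omega>' q) \<longrightarrow> f \<omega> = f \<omega>')"

lemma belowD: "below p f \<Longrightarrow> (\<And>q. q \<prec> p \<Longrightarrow> \<omega> q = \<omega>' q) \<Longrightarrow> f \<omega> = f \<omega>'"
  unfolding below_def by blast

lemma below_expect_from: "below p (expect_from p f)"
  unfolding below_def
proof (intro allI impI)
  fix \<omega> \<omega>' :: bits assume "\<forall>q. q \<prec> p \<longrightarrow> \<omega> q = \<omega>' q"
  then have "resample p \<omega> = resample p \<omega>'" by (simp add: resample_def fun_eq_iff)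
  then show "expect_from p f \<omega> = expect_from p f \<omega>'" by (simp add: expect_from_def)
qed

lemma expect_from_below:
  assumes "below p f"
  shows "expect_from p f \<omega> = f \<omega>"
proof -
  have "f (resample p \<omega> \<omega>') = f \<omega>" for \<omega>'
    by (rule belowD[OF assms]) (simp add: resample_def)
  then show ?thesis using coin.prob_space by (simp add: expect_from_def)
qed

lemma below_imp_depends_only_below:
  assumes "below p f"
  shows "depends_only_below p f"
proof -
  have "f \<omega> = f (restrict \<omega> {q. q \<prec> p})" for \<omega>
    by (rule belowD[OF assms]) simp
  then show ?thesis unfolding depends_only_below_def by blast
qed

text \<open>Flipping a bit that is being resampled preserves the measure and reverses the sign of
  the integrand. The martingale property of the constructed process rests on this symmetry.\<close>

lemma expect_from_antisymmetric:
  fixes p q :: "nat \<times> nat"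
  assumes f: "ucont f" and anti: "\<And>\<omega>. f (flip q \<omega>) = - f \<omega>" and q: "\<not> q \<prec> p"
  shows "expect_from p f \<omega> = 0"
proof -
  have "resample p \<omega> (flip q \<omega>') = flip q (resample p \<omega> \<omega>')" for \<omega>'
    using q by (auto simp: resample_def flip_def fun_eq_iff)
  then have "expect_from p f \<omega> = (\<integral>\<omega>'. - f (resample p \<omega> \<omega>') \<partial>coin)"
    using integral_coin_flip[OF ucont_resample[OF f, of p \<omega>], of q]
    by (simp add: expect_from_def anti)
  then show ?thesis by (simp add: expect_from_def)
qed

section \<open>Upcrossings\<close>

text \<open>The strategy holds one share at time \<open>s\<close> if the price has been below \<open>\<alpha>\<close> and has not exceeded
  \<open>\<beta>\<close> since then. Stated without recursion, this is visibly computable.\<close>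

definition holding :: "(nat \<Rightarrow> real) \<Rightarrow> real \<Rightarrow> real \<Rightarrow> nat \<Rightarrow> bool" where
  "holding x \<alpha> \<beta> s \<longleftrightarrow> (\<exists>q<Suc s. x q < \<alpha> \<and> (\<forall>r<Suc s. q \<le> r \<longrightarrow> \<not> \<beta> < x r))"

lemma holding_0: "\<alpha> < \<beta> \<Longrightarrow> holding x \<alpha> \<beta> 0 \<longleftrightarrow> x 0 < \<alpha>"
  by (auto simp: holding_def)

text \<open>The recursive rule behind the strategy, on which the bookkeeping proceeds by induction.
  Since \<open>\<alpha> < \<beta>\<close>, a share just bought is not sold at the same
  moment.\<close>

lemma holding_Suc:
  assumes "\<alpha> < \<beta>"
  shows "holding x \<alpha> \<beta> (Suc s) \<longleftrightarrow> x (Suc s) < \<alpha> \<or> holding x \<alpha> \<beta> s \<and> x (Suc s) \<le> \<beta>"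
proof
  assume "holding x \<alpha> \<beta> (Suc s)"
  then obtain q where q: "q \<le> Suc s" "x q < \<alpha>" "\<And>r. q \<le> r \<Longrightarrow> r \<le> Suc s \<Longrightarrow> x r \<le> \<beta>"
    unfolding holding_def by (metis less_Suc_eq_le not_less)
  show "x (Suc s) < \<alpha> \<or> holding x \<alpha> \<beta> s \<and> x (Suc s) \<le> \<beta>"
  proof (cases "q = Suc s")
    case False
    then have "holding x \<alpha> \<beta> s"
      unfolding holding_def using q by (intro exI[of _ q]) (auto simp: not_less)
    then show ?thesis using q by auto
  qed (use q in auto)
next
  assume "x (Suc s) < \<alpha> \<or> holding x \<alpha> \<beta> s \<and> x (Suc s) \<le> \<beta>"
  then show "holding x \<alpha> \<beta> (Suc s)"
  proof
    assume "x (Suc s) < \<alpha>"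
    then show ?thesis
      unfolding holding_def using assms by (intro exI[of _ "Suc s"]) (auto simp: less_Suc_eq)
  next
    assume "holding x \<alpha> \<beta> s \<and> x (Suc s) \<le> \<beta>"
    then obtain q where "q < Suc s" "x q < \<alpha>" "\<forall>r<Suc s. q \<le> r \<longrightarrow> \<not> \<beta> < x r" "x (Suc s) \<le> \<beta>"
      unfolding holding_def by blast
    then show ?thesis
      unfolding holding_def by (intro exI[of _ q]) (auto simp: less_Suc_eq)
  qed
qed

text \<open>The first share is bought at a price below \<open>\<alpha>\<close>, so this initial
  amount pays for it.\<close>

definition capital :: "(nat \<Rightarrow> real) \<Rightarrow> real \<Rightarrow> real \<Rightarrow> nat \<Rightarrow> real" where
  "capital x \<alpha> \<beta> t = \<alpha> + (\<Sum>s<t. if holding x \<alpha> \<beta> s then x (Suc s) - x s else 0)"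

definition sales :: "(nat \<Rightarrow> real) \<Rightarrow> real \<Rightarrow> real \<Rightarrow> nat \<Rightarrow> nat" where
  "sales x \<alpha> \<beta> t = (\<Sum>s<t. of_bool (holding x \<alpha> \<beta> s \<and> \<not> holding x \<alpha> \<beta> (Suc s)))"

text \<open>A pathwise form of Doob's upcrossing inequality. The invariant works because a sale
  takes place above \<open>\<beta>\<close>, leaving \<open>\<alpha>\<close> for the next purchase
  and a profit of at least \<open>\<beta> - \<alpha>\<close>, whereas a purchase below
  \<open>\<alpha>\<close> is always affordable.\<close>

lemma capital_ge:
  assumes "\<alpha> < \<beta>"
  shows "(if holding x \<alpha> \<beta> t then x t else \<alpha>) + (\<beta> - \<alpha>) * real (sales x \<alpha> \<beta> t)
    \<le> capital x \<alpha> \<beta> t"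
proof (induction t)
  case 0
  then show ?case using assms by (auto simp: capital_def sales_def holding_0)
next
  case (Suc t)
  have c: "capital x \<alpha> \<beta> (Suc t) =
      capital x \<alpha> \<beta> t + (if holding x \<alpha> \<beta> t then x (Suc t) - x t else 0)"
    by (simp add: capital_def)
  have s: "sales x \<alpha> \<beta> (Suc t) =
      sales x \<alpha> \<beta> t + of_bool (holding x \<alpha> \<beta> t \<and> \<not> holding x \<alpha> \<beta> (Suc t))"
    by (simp add: sales_def)
  show ?case
  proof (cases "holding x \<alpha> \<beta> t")
    case True
    show ?thesis
    proof (cases "holding x \<alpha> \<beta> (Suc t)")
      case False
      then have "\<beta> < x (Suc t)" using True holding_Suc[OF assms, of x t] by auto
      then show ?thesis using Suc.IH True False unfolding c s by (simp add: algebra_simps)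
    qed (use Suc.IH True c s in simp)
  next
    case False
    then have "holding x \<alpha> \<beta> (Suc t) \<Longrightarrow> x (Suc t) < \<alpha>"
      using holding_Suc[OF assms, of x t] by auto
    then show ?thesis using Suc.IH False unfolding c s by auto
  qed
qed

lemma capital_ge_sales:
  assumes "0 \<le> \<alpha>" "\<alpha> < \<beta>" "\<And>t. 0 \<le> x t"
  shows "(\<beta> - \<alpha>) * real (sales x \<alpha> \<beta> t) \<le> capital x \<alpha> \<beta> t"
  using capital_ge[OF assms(2), of x t] assms(1) assms(3)[of t] by (simp split: if_splits)

lemma capital_nonneg:
  assumes "0 \<le> \<alpha>" "\<alpha> < \<beta>" "\<And>t. 0 \<le> x t"
  shows "0 \<le> capital x \<alpha> \<beta> t"
  using capital_ge_sales[OF assms] assms(2)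
      by (meson diff_ge_0_iff_ge less_imp_le mult_nonneg_nonneg of_nat_0_le_iff order_trans)

lemma sales_unbounded:
  assumes "\<alpha> < \<beta>" and low: "\<And>t. \<exists>s\<ge>t. x s < \<alpha>" and high: "\<And>t. \<exists>s\<ge>t. \<beta> < x s"
  shows "\<exists>t. n \<le> sales x \<alpha> \<beta> t"
proof (induction n)
  case (Suc n)
  then obtain t where t: "n \<le> sales x \<alpha> \<beta> t" by blast
  obtain s where s: "t \<le> s" "x s < \<alpha>" using low by blast
  obtain r where r: "s \<le> r" "\<beta> < x r" using high by blast
  have hs: "holding x \<alpha> \<beta> s"
    using s assms(1) by (cases s) (auto simp: holding_0 holding_Suc)
  have hr: "\<not> holding x \<alpha> \<beta> r"
    using r assms(1) by (cases r) (auto simp: holding_0 holding_Suc)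
  have "\<exists>q\<ge>s. holding x \<alpha> \<beta> q \<and> \<not> holding x \<alpha> \<beta> (Suc q)"
  proof (rule ccontr)
    assume neg: "\<not> ?thesis"
    from r(1) have "holding x \<alpha> \<beta> r" by (induction rule: dec_induct) (use hs neg in auto)
    then show False using hr by simp
  qed
  then obtain q where q: "s \<le> q" "holding x \<alpha> \<beta> q" "\<not> holding x \<alpha> \<beta> (Suc q)" by blast
  have "sales x \<alpha> \<beta> t \<le> sales x \<alpha> \<beta> q"
    unfolding sales_def using s(1) q(1) by (intro sum_mono2) auto
  then have "Suc n \<le> sales x \<alpha> \<beta> (Suc q)" using t q by (simp add: sales_def)
  then show ?case by blast
qed simp

lemma capital_at_top:
  assumes "0 \<le> \<alpha>" "\<alpha> < \<beta>" "\<And>t. 0 \<le> x t"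
    and low: "\<And>t. \<exists>s\<ge>t. x s < \<alpha>" and high: "\<And>t. \<exists>s\<ge>t. \<beta> < x s"
  shows "filterlim (capital x \<alpha> \<beta>) at_top sequentially"
  unfolding filterlim_at_top eventually_sequentially
proof
  fix Z :: real
  obtain n :: nat where n: "Z / (\<beta> - \<alpha>) \<le> real n" using real_arch_simple by blast
  obtain t where t: "n \<le> sales x \<alpha> \<beta> t" using sales_unbounded[OF assms(2) low high] by blast
  have "Z \<le> capital x \<alpha> \<beta> s" if "t \<le> s" for s
  proof -
    have "sales x \<alpha> \<beta> t \<le> sales x \<alpha> \<beta> s"
      unfolding sales_def using that by (intro sum_mono2) auto
    then have "Z / (\<beta> - \<alpha>) \<le> real (sales x \<alpha> \<beta> s)" using n t by linarith
    then have "Z \<le> (\<beta> - \<alpha>) * real (sales x \<alpha> \<beta> s)"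
      using assms(2) by (simp add: divide_le_eq mult.commute)
    then show ?thesis using capital_ge_sales[of \<alpha> \<beta> x s, OF assms(1-3)] by linarith
  qed
  then show "\<exists>t. \<forall>s\<ge>t. Z \<le> capital x \<alpha> \<beta> s" by blast
qed

text \<open>If the lower and upper limits coincide, their value is infinite, as it is nonnegative
  and not real. Otherwise there is room for two rationals between them; rational thresholds keep the
  strategy computable.\<close>

lemma nonconvergent_cases:
  fixes x :: "nat \<Rightarrow> real"
  assumes nonneg: "\<And>t. 0 \<le> x t" and nc: "\<not> convergent x"
  obtains "filterlim x at_top sequentially"
  | \<alpha> \<beta> where "0 \<le> (of_rat \<alpha> :: real)" "of_rat \<alpha> < (of_rat \<beta> :: real)"
      "\<And>t. \<exists>s\<ge>t. x s < of_rat \<alpha>" "\<And>t. \<exists>s\<ge>t. of_rat \<beta> < x s"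
proof -
  define L where "L = liminf (\<lambda>t. ereal (x t))"
  define S where "S = limsup (\<lambda>t. ereal (x t))"
  have L0: "0 \<le> L" unfolding L_def using nonneg by (intro Liminf_bounded) auto
  have "L \<le> S" unfolding L_def S_def by (rule Liminf_le_Limsup) simp
  show thesis
  proof (cases "L = S")
    case True
    then have lim: "(\<lambda>t. ereal (x t)) \<longlonglongrightarrow> L"
      unfolding L_def S_def by (intro tendsto_iff_Liminf_eq_Limsup[THEN iffD2]) auto
    show thesis
    proof (cases L)
      case (real r)
      then show thesis using lim nc by (auto simp: convergent_def)
    next
      case PInf
      then show thesis using lim that(1) by (simp add: tendsto_PInfty_eq_at_top)
    qed (use L0 in auto)
  next
    case False
    with \<open>L \<le> S\<close> have "L < S" by simp
    \<comment> \<open>The rational thresholds will lie between \<open>a\<close> and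
      \<open>b\<close>, which leaves the strict slack that the two crossing arguments need.\<close>
    then obtain a where a: "L < ereal a" "ereal a < S" using ereal_dense2 by blast
    then obtain b where b: "ereal a < ereal b" "ereal b < S" using ereal_dense2 by blast
    have "a < b" using b by simp
    obtain \<alpha> where \<alpha>: "a < of_rat \<alpha>" "of_rat \<alpha> < b" using of_rat_dense[OF \<open>a < b\<close>] by blast
    obtain \<beta> where \<beta>: "of_rat \<alpha> < (of_rat \<beta> :: real)" "of_rat \<beta> < b" using of_rat_dense[OF \<alpha>(2)]
        by blast
    have "0 \<le> a" using L0 a(1) by (cases L) auto
    have "\<exists>s\<ge>t. x s < of_rat \<alpha>" for t
    proof (rule ccontr)
      assume "\<not> ?thesis"
      then have "ereal a \<le> L" unfolding L_def
        using \<alpha>(1) by (intro Liminf_bounded eventually_sequentiallyI[of t]) force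
      then show False using a by simp
    qed
    moreover have "\<exists>s\<ge>t. of_rat \<beta> < x s" for t
    proof (rule ccontr)
      assume "\<not> ?thesis"
      then have "S \<le> ereal b" unfolding S_def
        using \<beta>(2) by (intro Limsup_bounded eventually_sequentiallyI[of t]) force
      then show False using b by simp
    qed
    moreover have "0 \<le> (of_rat \<alpha> :: real)" using \<open>0 \<le> a\<close> \<alpha>(1) by linarith
    ultimately show thesis using that(2) \<beta>(1) by blast
  qed
qed

section \<open>Averages over the bits of one row\<close>

text \<open>A finite counterpart of \<open>resample\<close> for a single row, with the binary digits
  of \<open>s\<close> as the fresh bits.\<close>

definition set_row :: "nat \<Rightarrow> nat \<Rightarrow> nat \<Rightarrow> bits \<Rightarrow> bits" where
  "set_row m n s \<omega> = (\<lambda>(i, j). i = m \<and> n \<le> j \<and> odd (s div 2 ^ j) \<or> \<not> (i = m \<and> n \<le> j) \<and> \<omega> (i, j))"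

text \<open>All \<open>2 ^ k\<close> numbers are used for every \<open>n\<close>. For
  \<open>n \<le> k\<close> each filling of the bits from \<open>n\<close> to \<open>k - 1\<close> is
  then counted \<open>2 ^ n\<close> times, and averages at successive columns share a
  denominator.\<close>

definition row_average :: "nat \<Rightarrow> (bits \<Rightarrow> real) \<Rightarrow> nat \<Rightarrow> nat \<Rightarrow> bits \<Rightarrow> real" where
  "row_average k f m n \<omega> = (\<Sum>s<2 ^ k. f (set_row m n s \<omega>)) / 2 ^ k"

lemma row_average_flip: "row_average k f m n (flip (m, n) \<omega>) = row_average k f m n \<omega>"
proof -
  have "set_row m n s (flip (m, n) \<omega>) = set_row m n s \<omega>" for s
    by (auto simp: set_row_def flip_def fun_eq_iff)
  then show ?thesis by (simp add: row_average_def)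
qed

text \<open>Pair each \<open>s\<close> with the number that differs from it in the \<open>n\<close>-th binary digit.\<close>

lemma row_average_flip_add:
  assumes "n < k"
  shows "row_average k f m (Suc n) \<omega> + row_average k f m (Suc n) (flip (m, n) \<omega>) =
    2 * row_average k f m n \<omega>"
proof -
  let ?S = "{..<(2::nat) ^ k}"
  have b: "odd (flip_bit n s div 2 ^ j) \<longleftrightarrow> (n = j \<longleftrightarrow> even (s div 2 ^ j))" for s j :: nat
    unfolding bit_iff_odd [symmetric] by (simp add: bit_flip_bit_iff) (simp add: bit_iff_odd)
  have inv: "flip_bit n (flip_bit n s) = s" for s :: nat
    by (rule bit_eqI) (auto simp: bit_flip_bit_iff)
  have less: "flip_bit n s < 2 ^ k" if "s < 2 ^ k" for s :: nat
    using that assms unfolding take_bit_nat_eq_self_iff [symmetric] take_bit_flip_bit_eq by simp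
  have pair: "f (set_row m (Suc n) s \<omega>) + f (set_row m (Suc n) s (flip (m, n) \<omega>)) =
      f (set_row m n s \<omega>) + f (set_row m n (flip_bit n s) \<omega>)" for s
  proof (cases "odd (s div 2 ^ n) = \<omega> (m, n)")
    case True
    have 1: "set_row m (Suc n) s \<omega> = set_row m n s \<omega>"
      using True by (auto simp: set_row_def fun_eq_iff Suc_le_eq le_less)
    have 2: "set_row m (Suc n) s (flip (m, n) \<omega>) = set_row m n (flip_bit n s) \<omega>"
      using True by (auto simp: set_row_def flip_def fun_eq_iff Suc_le_eq le_less b)
    show ?thesis unfolding 1 2 by simp
  next
    case False
    have 1: "set_row m (Suc n) s \<omega> = set_row m n (flip_bit n s) \<omega>"
      using False by (auto simp: set_row_def fun_eq_iff Suc_le_eq le_less b)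
    have 2: "set_row m (Suc n) s (flip (m, n) \<omega>) = set_row m n s \<omega>"
      using False by (auto simp: set_row_def flip_def fun_eq_iff Suc_le_eq le_less)
    show ?thesis unfolding 1 2 by simp
  qed
  have "(\<Sum>s\<in>?S. f (set_row m n (flip_bit n s) \<omega>)) = (\<Sum>s\<in>?S. f (set_row m n s \<omega>))"
    by (rule sum.reindex_bij_witness[of _ "flip_bit n" "flip_bit n"]) (auto simp: inv less)
  then have "(\<Sum>s\<in>?S. f (set_row m (Suc n) s \<omega>) + f (set_row m (Suc n) s (flip (m, n) \<omega>))) =
      2 * (\<Sum>s\<in>?S. f (set_row m n s \<omega>))"
    unfolding pair by (simp add: sum.distrib)
  then show ?thesis
    unfolding row_average_def by (simp add: sum.distrib add_divide_distrib [symmetric])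
qed

text \<open>The overwritten bits lie outside the square that \<open>f\<close> reads.\<close>

lemma row_average_eq:
  assumes f: "\<And>\<omega> \<omega>'. agree k \<omega> \<omega>' \<Longrightarrow> f \<omega> = f \<omega>'" and "k \<le> n"
  shows "row_average k f m n \<omega> = f \<omega>"
proof -
  have "f (set_row m n s \<omega>) = f \<omega>" for s
    using \<open>k \<le> n\<close> by (intro f) (auto simp: agree_def set_row_def)
  then show ?thesis by (simp add: row_average_def)
qed

lemma below_mono:
  fixes p q :: "nat \<times> nat"
  assumes "below p f" "p \<preceq> q"
  shows "below q f"
proof -
  have "r \<prec> q" if "r \<prec> p" for r :: "nat \<times> nat"
    using that assms(2) by (auto simp: lex_less_def lex_le_def)
  then show ?thesis using assms(1) unfolding below_def by blast
qed

lemma below_row_average: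
  assumes f: "below (Suc m, 0) f"
  shows "below (m, n) (row_average k f m n)"
  unfolding below_def
proof (intro allI impI)
  fix \<omega> \<omega>' :: bits assume ag: "\<forall>q. q \<prec> (m, n) \<longrightarrow> \<omega> q = \<omega>' q"
  have "f (set_row m n s \<omega>) = f (set_row m n s \<omega>')" for s
  proof (rule belowD[OF f])
    fix q :: "nat \<times> nat" assume "q \<prec> (Suc m, 0)"
    then show "set_row m n s \<omega> q = set_row m n s \<omega>' q"
      using ag by (cases q) (auto simp: set_row_def lex_less_def less_Suc_eq)
  qed
  then show "row_average k f m n \<omega> = row_average k f m n \<omega>'" by (simp add: row_average_def)
qed

lemma computable_rat_comp2:
  assumes "computable_rat (Suc (Suc 0)) (\<lambda>\<omega> v. R \<omega> (v 0) (v (Suc 0)))" "computable n F"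
      "computable n G"
  shows "computable_rat n (\<lambda>\<omega> v. R \<omega> (F \<omega> v) (G \<omega> v))"
proof -
  obtain A B C where R: "computable (Suc (Suc 0)) A" "computable (Suc (Suc 0)) B"
      "computable (Suc (Suc 0)) C"
    "\<And>\<omega> v. 0 < C \<omega> v"
    "\<And>\<omega> v. R \<omega> (v 0) (v (Suc 0)) = (real (A \<omega> v) - real (B \<omega> v)) / real (C \<omega> v)"
    using computable_ratE[OF assms(1)] by blast
  let ?w = "\<lambda>\<omega> v i. ([F, G] ! i) \<omega> v"
  have c: "computable n (\<lambda>\<omega> v. X \<omega> (?w \<omega> v))" if "computable (Suc (Suc 0)) X" for X
    by (rule computable_comp) (use that assms in auto)
  show ?thesis
  proof (rule computable_ratI[OF c[OF R(1)] c[OF R(2)] c[OF R(3)] R(4)])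
    show "R \<omega> (F \<omega> v) (G \<omega> v) =
        (real (A \<omega> (?w \<omega> v)) - real (B \<omega> (?w \<omega> v))) / real (C \<omega> (?w \<omega> v))" for \<omega> v
      using R(5)[of \<omega> "?w \<omega> v"] by simp
  qed
qed

lemma computable_rat_comp1:
  assumes "computable_rat (Suc 0) (\<lambda>\<omega> v. R \<omega> (v 0))" "computable n F"
  shows "computable_rat n (\<lambda>\<omega> v. R \<omega> (F \<omega> v))"
proof -
  obtain A B C where R: "computable (Suc 0) A" "computable (Suc 0) B" "computable (Suc 0) C"
      "\<And>\<omega> v. 0 < C \<omega> v"
    "\<And>\<omega> v. R \<omega> (v 0) = (real (A \<omega> v) - real (B \<omega> v)) / real (C \<omega> v)"
    using computable_ratE[OF assms(1)] by blast
  let ?w = "\<lambda>\<omega> v i. ([F] ! i) \<omega> v"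
  have c: "computable n (\<lambda>\<omega> v. X \<omega> (?w \<omega> v))" if "computable (Suc 0) X" for X
    by (rule computable_comp) (use that assms in auto)
  show ?thesis
  proof (rule computable_ratI[OF c[OF R(1)] c[OF R(2)] c[OF R(3)] R(4)])
    show "R \<omega> (F \<omega> v) =
        (real (A \<omega> (?w \<omega> v)) - real (B \<omega> (?w \<omega> v))) / real (C \<omega> (?w \<omega> v))" for \<omega> v
      using R(5)[of \<omega> "?w \<omega> v"] by simp
  qed
qed

lemma ucont_computable_rat:
  assumes "computable_rat n R"
  shows "ucont (\<lambda>\<omega>. R \<omega> v)"
proof -
  obtain A B C where R: "computable n A" "computable n B" "computable n C"
    "\<And>\<omega> v. R \<omega> v = (real (A \<omega> v) - real (B \<omega> v)) / real (C \<omega> v)"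
    using computable_ratE[OF assms] by metis
  have "\<exists>u. \<forall>\<omega>'. agree u \<omega> \<omega>' \<longrightarrow> R \<omega>' v = R \<omega> v" for \<omega>
  proof -
    obtain u1 u2 u3 where u: "\<And>\<omega>'. agree u1 \<omega> \<omega>' \<Longrightarrow> A \<omega>' v = A \<omega> v"
      "\<And>\<omega>'. agree u2 \<omega> \<omega>' \<Longrightarrow> B \<omega>' v = B \<omega> v" "\<And>\<omega>'. agree u3 \<omega> \<omega>' \<Longrightarrow> C \<omega>' v = C \<omega> v"
      using computable_locally_constant R(1-3) by metis
    have "R \<omega>' v = R \<omega> v" if "agree (u1 + u2 + u3) \<omega> \<omega>'" for \<omega>'
      unfolding R(4) using u(1)[OF agree_mono[OF that]] u(2)[OF agree_mono[OF that]]
        u(3)[OF agree_mono[OF that]] by simp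
    then show ?thesis by blast
  qed
  then obtain k where "\<And>\<omega> \<omega>'. agree k \<omega> \<omega>' \<Longrightarrow> R \<omega> v = R \<omega>' v"
    using locally_constant_uniform(2)[of "\<lambda>\<omega>. R \<omega> v"] by blast
  then show ?thesis
    unfolding ucont_def by (metis abs_zero diff_self)
qed

lemma below_diff:
  assumes "below p f" "below p g"
  shows "below p (\<lambda>\<omega>. f \<omega> - g \<omega>)"
  unfolding below_def
proof (intro allI impI)
  fix \<omega> \<omega>' :: bits assume "\<forall>q. q \<prec> p \<longrightarrow> \<omega> q = \<omega>' q"
  then have "f \<omega> = f \<omega>'" "g \<omega> = g \<omega>'" using assms by (auto intro: belowD)
  then show "f \<omega> - g \<omega> = f \<omega>' - g \<omega>'" by simp
qed

lemma lex_less_le_trans: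
  fixes p q r :: "nat \<times> nat"
  shows "p \<prec> q \<Longrightarrow> q \<preceq> r \<Longrightarrow> p \<prec> r"
  by (auto simp: lex_less_def lex_le_def)

lemma not_lex_less_refl:
  fixes p :: "nat \<times> nat"
  shows "\<not> p \<prec> p"
  by (simp add: lex_less_def)

lemma lex_at_top_neq_bot: "lex_at_top \<noteq> bot"
proof -
  have "\<not> eventually (\<lambda>_. False) lex_at_top"
  proof
    assume "eventually (\<lambda>_. False) lex_at_top"
    then obtain p :: "nat \<times> nat" where "\<And>q. \<not> p \<prec> q"
      unfolding eventually_lex_at_top by blast
    from this[of "(Suc (fst p), 0)"] show False by (simp add: lex_less_def)
  qed
  then show ?thesis by (simp add: trivial_limit_def)
qed

lemma filterlim_fst_lex_at_top: "filterlim fst sequentially lex_at_top"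
  unfolding filterlim_at_top eventually_lex_at_top
proof
  fix Z :: nat
  show "\<exists>p. \<forall>q. p \<prec> q \<longrightarrow> Z \<le> fst q"
    by (rule exI[of _ "(Z, 0)"]) (auto simp: lex_less_def)
qed

lemma filterlim_row_starts: "filterlim (\<lambda>m. (m, 0)) lex_at_top sequentially"
  unfolding filterlim_iff eventually_lex_at_top eventually_sequentially
proof (intro allI impI)
  fix P :: "nat \<times> nat \<Rightarrow> bool"
  assume "\<exists>p. \<forall>q. p \<prec> q \<longrightarrow> P q"
  then obtain p where p: "\<And>q. p \<prec> q \<Longrightarrow> P q" by blast
  show "\<exists>M. \<forall>m\<ge>M. P (m, 0)"
    by (rule exI[of _ "Suc (fst p)"]) (auto intro!: p simp: lex_less_def)
qed

section \<open>The rational martingale\<close>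

text \<open>\<open>a\<close> gives numerators over \<open>2 ^ m\<close>; the error allows for both
  the approximation by a code and its rounding. Row \<open>m\<close> is played for
  \<open>N (Suc m)\<close>, which depends on the rows up to \<open>m\<close>, hence the shift in
  \<open>k_modulus\<close>. Positivity of \<open>k\<close> gives every row a time of its
  own.\<close>

locale row_approximation =
  fixes N :: "nat \<Rightarrow> bits \<Rightarrow> real" and a :: "bits \<Rightarrow> nat \<Rightarrow> nat" and k :: "nat \<Rightarrow> nat"
  assumes ucont_N: "ucont (N m)"
    and N_nonneg: "0 \<le> N m \<omega>"
    and N_martingale: "j \<le> m \<Longrightarrow> expect_from (j, 0) (N m) \<omega> = N j \<omega>"
    and computable_a: "computable (Suc 0) (\<lambda>\<omega> v. a \<omega> (v 0))"
    and a_approx: "\<bar>real (a \<omega> m) / 2 ^ m - N m \<omega>\<bar> \<le> 2 / 2 ^ m"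
    and below_a: "below (m, 0) (\<lambda>\<omega>. a \<omega> m)"
    and computable_k: "computable (Suc 0) (\<lambda>\<omega> v. k (v 0))"
    and k_pos: "0 < k m"
    and k_modulus: "agree (k m) \<omega> \<omega>' \<Longrightarrow> a \<omega> (Suc m) = a \<omega>' (Suc m)"
begin

definition A :: "nat \<Rightarrow> bits \<Rightarrow> real" where
  "A m \<omega> = real (a \<omega> (Suc m)) / 2 ^ Suc m"

definition avg :: "nat \<Rightarrow> nat \<Rightarrow> bits \<Rightarrow> real" where
  "avg m n = row_average (k m) (A m) m n"

text \<open>The rows before \<open>m\<close> take this many times, one for each bit that
  matters.\<close>

definition start :: "nat \<Rightarrow> nat" where
  "start m = (\<Sum>i<m. k i)"

definition row :: "nat \<Rightarrow> nat" where
  "row t = (LEAST m. t < start (Suc m))"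

definition col :: "nat \<Rightarrow> nat" where
  "col t = t - start (row t)"

definition idx :: "nat \<times> nat \<Rightarrow> nat" where
  "idx p = start (fst p) + min (snd p) (k (fst p))"

text \<open>Time \<open>t\<close> reveals bit \<open>col t\<close> of row \<open>row t\<close>. No bets are placed on the bits of row \<open>m\<close>
  from \<open>k m\<close> on, so \<open>idx\<close> is constant from there to the end of the row.\<close>

definition D :: "nat \<Rightarrow> bits \<Rightarrow> real" where
  "D t \<omega> = avg (row t) (Suc (col t)) \<omega> - avg (row t) (col t) \<omega>"

lemma start_Suc: "start (Suc m) = start m + k m"
  by (simp add: start_def)

lemma start_mono: "m \<le> n \<Longrightarrow> start m \<le> start n"
  unfolding start_def by (intro sum_mono2) auto

lemma start_ge: "m \<le> start m"
proof (induction m)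
  case (Suc m)
  then show ?case using k_pos[of m] by (simp add: start_Suc)
qed simp

lemma ex_row: "\<exists>m. t < start (Suc m)"
  using start_ge[of "Suc t"] by (intro exI[of _ t]) simp

lemma less_start_Suc_row: "t < start (Suc (row t))"
  unfolding row_def by (rule LeastI_ex[OF ex_row])

lemma start_row_le: "start (row t) \<le> t"
proof (cases "row t")
  case (Suc m)
  then have "\<not> t < start (Suc m)"
    using not_less_Least[of m "\<lambda>m. t < start (Suc m)"] unfolding row_def by simp
  then show ?thesis using Suc by simp
qed (simp add: start_def)

lemma start_row_col: "start (row t) + col t = t"
  by (simp add: col_def start_row_le)

lemma col_less: "col t < k (row t)"
  using less_start_Suc_row[of t] start_row_le[of t] by (simp add: col_def start_Suc)

lemma idx_row_col: "idx (row t, col t) = t"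
  using col_less[of t] start_row_col[of t] by (simp add: idx_def)

text \<open>\<open>idx p\<close> counts the times whose bit precedes \<open>p\<close>. Monotonicity
  and the limit of \<open>idx\<close> follow from this equivalence, as does the fact that later bets
  are still undecided at \<open>p\<close>.\<close>

lemma less_idx_iff:
  fixes p :: "nat \<times> nat"
  shows "s < idx p \<longleftrightarrow> (row s, col s) \<prec> p"
proof -
  obtain m n where p: "p = (m, n)" by fastforce
  consider "row s < m" | "row s = m" | "m < row s" by linarith
  then show ?thesis
  proof cases
    case 1
    then have "s < start m" using less_start_Suc_row[of s] start_mono[of "Suc (row s)" m] by simp
    then show ?thesis using 1 by (simp add: p idx_def lex_less_def)
  next
    case 2
    then show ?thesis using start_row_col[of s] col_less[of s]
        by (auto simp: p idx_def lex_less_def)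
  next
    case 3
    then have "start m + k m \<le> s"
      using start_row_le[of s] start_mono[of "Suc m" "row s"] by (simp add: start_Suc)
    then show ?thesis using 3 by (simp add: p idx_def lex_less_def)
  qed
qed

lemma idx_mono:
  fixes p q :: "nat \<times> nat"
  assumes "p \<preceq> q"
  shows "idx p \<le> idx q"
proof (rule ccontr)
  assume "\<not> idx p \<le> idx q"
  then have "(row (idx q), col (idx q)) \<prec> q"
    using less_idx_iff[of "idx q" p] lex_less_le_trans[OF _ assms] by simp
  then show False using less_idx_iff[of "idx q" q] by simp
qed

lemma idx_row_end: "k m \<le> n \<Longrightarrow> idx (m, n) = idx (Suc m, 0)"
  by (simp add: idx_def start_Suc)

lemma filterlim_idx: "filterlim idx sequentially lex_at_top"
  unfolding filterlim_at_top eventually_lex_at_top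
proof
  fix Z
  have "Z \<le> idx q" if "(row Z, col Z) \<prec> q" for q :: "nat \<times> nat"
    using that less_idx_iff[of Z q] by simp
  then show "\<exists>p. \<forall>q. p \<prec> q \<longrightarrow> Z \<le> idx q" by blast
qed

lemma A_cong: "agree (k m) \<omega> \<omega>' \<Longrightarrow> A m \<omega> = A m \<omega>'"
  using k_modulus by (simp add: A_def)

lemma below_A: "below (Suc m, 0) (A m)"
  using below_a[of "Suc m"] by (simp add: A_def below_def)

lemma avg_end: "k m \<le> n \<Longrightarrow> avg m n \<omega> = A m \<omega>"
  unfolding avg_def by (intro row_average_eq A_cong)

lemma below_avg: "below (m, n) (avg m n)"
  unfolding avg_def by (rule below_row_average[OF below_A])

lemma below_D: "below (row t, Suc (col t)) (D t)"
proof -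
  have "below (row t, Suc (col t)) (avg (row t) (col t))"
    by (rule below_mono[OF below_avg]) (simp add: lex_le_def lex_less_def)
  then show ?thesis unfolding D_def by (intro below_diff below_avg)
qed

text \<open>The average before a bit is read is the midpoint of the averages for its two
  values.\<close>

lemma D_flip: "D t (flip (row t, col t) \<omega>) = - D t \<omega>"
  using row_average_flip_add[OF col_less[of t], of "A (row t)" "row t" \<omega>]
    row_average_flip[of "k (row t)" "A (row t)" "row t" "col t" \<omega>]
  unfolding D_def avg_def by linarith

lemma computable_start: "computable n F \<Longrightarrow> computable n (\<lambda>\<omega> v. start (F \<omega> v))"
  by (rule computable_comp1[of "\<lambda>\<omega>. start"], unfold start_def)
    (intro computable_sum computable_comp1[OF computable_k] computable_var; simp)+

lemma computable_row: "computable n F \<Longrightarrow> computable n (\<lambda>\<omega> v. row (F \<omega> v))"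
  by (rule computable_comp1[of "\<lambda>\<omega>. row"], unfold row_def)
    (intro computable_LEAST computable_less computable_start computable_Suc
        computable_var ex_row; simp)+

lemma computable_col: "computable n F \<Longrightarrow> computable n (\<lambda>\<omega> v. col (F \<omega> v))"
  unfolding col_def by (intro computable_diff computable_start computable_row)

lemma computable_rat_avg:
  assumes "computable n F" "computable n G"
  shows "computable_rat n (\<lambda>\<omega> v. avg (F \<omega> v) (G \<omega> v) \<omega>)"
proof (rule computable_rat_comp2[OF _ assms])
  \<comment> \<open>Overwriting the row is an oracle substitution: each bit of the new oracle is
    decidable from \<open>s\<close> and the old one.\<close>
  have "computable (Suc (Suc 0)) (\<lambda>\<omega> v. \<Sum>s<2 ^ k (v 0). a (set_row (v 0) (v (Suc 0)) s \<omega>) (Suc (v 0)))"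
    unfolding set_row_def
    by (intro computable_sum computable_oracle_subst1[OF computable_a] computable_intros
        computable_comp1[OF computable_k] computable_odd computable_var) auto
  then have "computable_rat (Suc (Suc 0)) (\<lambda>\<omega> v. real (\<Sum>s<2 ^ k (v 0).
      a (set_row (v 0) (v (Suc 0)) s \<omega>) (Suc (v 0))) / real (2 ^ Suc (v 0) * 2 ^ k (v 0)))"
    by (rule computable_rat_divide_nat[OF computable_rat_of_nat])
      (intro computable_intros computable_comp1[OF computable_k] computable_var, simp_all)
  then show "computable_rat (Suc (Suc 0)) (\<lambda>\<omega> v. avg (v 0) (v (Suc 0)) \<omega>)"
    by (simp add: avg_def row_average_def A_def sum_divide_distrib)
qed

lemma computable_rat_D: "computable n F \<Longrightarrow> computable_rat n (\<lambda>\<omega> v. D (F \<omega> v) \<omega>)"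
  unfolding D_def by (intro computable_rat_diff computable_rat_avg computable_row computable_col
      computable_Suc)

lemma ucont_avg: "ucont (avg m n)"
  using ucont_computable_rat[OF computable_rat_avg[of 0 "\<lambda>_ _. m" "\<lambda>_ _. n"]] computable_const
      by simp

lemma ucont_D: "ucont (D t)"
  using ucont_computable_rat[OF computable_rat_D[of 0 "\<lambda>_ _. t"]] computable_const by simp

end

lemma computable_rational_lexI:
  assumes M: "computable_rat (Suc (Suc 0)) (\<lambda>\<omega> v. M (v 0, v (Suc 0)) \<omega>)" and nonneg:
      "\<And>p \<omega>. 0 \<le> M p \<omega>"
  shows "computable_rational_lex M"
proof -
  obtain A B C where R: "computable (Suc (Suc 0)) A" "computable (Suc (Suc 0)) B"
      "computable (Suc (Suc 0)) C"
    "\<And>\<omega> v. 0 < C \<omega> v"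
    "\<And>\<omega> v. M (v 0, v (Suc 0)) \<omega> = (real (A \<omega> v) - real (B \<omega> v)) / real (C \<omega> v)"
    using computable_ratE[OF M] by blast
  \<comment> \<open>Truncated subtraction is exact because the value is nonnegative, and even codes
    stand for nonnegative integers.\<close>
  have "computable (Suc (Suc 0)) (\<lambda>\<omega> v. prod_encode (2 * (A \<omega> v - B \<omega> v), 2 * C \<omega> v))"
    by (intro computable_prod_encode computable_intros R(1-3))
  then obtain e where e: "\<And>\<omega> v. eval \<omega> e (map v [0..<Suc (Suc 0)]) =
      Some (prod_encode (2 * (A \<omega> v - B \<omega> v), 2 * C \<omega> v))" using computableE by blast
  have "\<exists>c. eval \<omega> e [m, n] = Some c \<and> M (m, n) \<omega> = enum_rat c" for m n \<omega>
  proof -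
    define v where "v i = (if i = 0 then m else n)" for i :: nat
    have "0 \<le> (real (A \<omega> v) - real (B \<omega> v)) / real (C \<omega> v)"
      using nonneg[of "(v 0, v (Suc 0))" \<omega>] R(5) by simp
    then have "B \<omega> v \<le> A \<omega> v" using R(4)[of \<omega> v] by (simp add: zero_le_divide_iff)
    then have "M (v 0, v (Suc 0)) \<omega> = enum_rat (prod_encode (2 * (A \<omega> v - B \<omega> v), 2 * C \<omega> v))"
      unfolding R(5) enum_rat_prod_encode by (simp add: of_nat_diff)
    then show ?thesis using e[of \<omega> v] by (simp add: v_def)
  qed
  then show ?thesis unfolding computable_rational_lex_def by blast
qed

lemma expect_from_add:
  assumes "ucont f" "ucont g"
  shows "expect_from p (\<lambda>\<omega>. f \<omega> + g \<omega>) \<omega> = expect_from p f \<omega> + expect_from p g \<omega>"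
  unfolding expect_from_def
  by (intro Bochner_Integration.integral_add ucont_integrable ucont_resample assms)

lemma belowI:
  "(\<And>\<omega> \<omega>'. (\<And>q. q \<prec> p \<Longrightarrow> \<omega> q = \<omega>' q) \<Longrightarrow> f \<omega> = f \<omega>') \<Longrightarrow> below p f"
  unfolding below_def by blast

lemma lex_le_Suc:
  fixes p :: "nat \<times> nat"
  shows "(i, j) \<prec> p \<Longrightarrow> (i, Suc j) \<preceq> p"
  by (cases p) (auto simp: lex_less_def lex_le_def)

section \<open>Betting on the bits as they are revealed\<close>

context row_approximation
begin

context
  fixes H :: "nat \<Rightarrow> bits \<Rightarrow> bool" and C :: rat
  assumes computable_H: "computable (Suc 0) (\<lambda>\<omega> v. of_bool (H (v 0) \<omega>))"
    and below_H: "below (row s, col s) (H s)"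
begin

definition bet :: "nat \<Rightarrow> bits \<Rightarrow> real" where
  "bet s \<omega> = (if H s \<omega> then D s \<omega> else 0)"

text \<open>The martingale transform of the increments by the decisions \<open>H\<close>. It is used
  twice: with the decision always to bet, for the price, and with the upcrossing strategy.\<close>

definition wealth :: "nat \<Rightarrow> bits \<Rightarrow> real" where
  "wealth t \<omega> = of_rat C + (\<Sum>s<t. bet s \<omega>)"

lemma wealth_Suc: "wealth (Suc t) = (\<lambda>\<omega>. wealth t \<omega> + bet t \<omega>)"
  by (simp add: wealth_def fun_eq_iff)

lemma computable_rat_bet: "computable_rat (Suc 0) (\<lambda>\<omega> v. bet (v 0) \<omega>)"
  unfolding bet_def using computable_rat_of_nat[OF computable_const, of "Suc 0" 0]
  by (intro computable_rat_if computable_H computable_rat_D computable_var) auto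

lemma computable_rat_wealth: "computable n F \<Longrightarrow> computable_rat n (\<lambda>\<omega> v. wealth (F \<omega> v) \<omega>)"
  by (rule computable_rat_comp1[of "\<lambda>\<omega> t. wealth t \<omega>"], unfold wealth_def)
    (intro computable_rat_add computable_rat_const computable_rat_sum computable_rat_comp1[OF
        computable_rat_bet] computable_var; simp)+

lemma ucont_bet: "ucont (bet s)"
  using ucont_computable_rat[OF computable_rat_bet, of "\<lambda>_. s"] by simp

lemma ucont_wealth: "ucont (wealth t)"
  using ucont_computable_rat[OF computable_rat_wealth[of 0 "\<lambda>_ _. t"]] computable_const by simp

text \<open>The decision is taken before the bit is seen, so only the increment changes
  sign.\<close>

lemma bet_flip: "bet s (flip (row s, col s) \<omega>) = - bet s \<omega>"
proof -
  have "H s (flip (row s, col s) \<omega>) = H s \<omega>"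
    by (rule belowD[OF below_H]) (auto simp: flip_def not_lex_less_refl)
  then show ?thesis by (simp add: bet_def D_flip)
qed

lemma below_bet: "below (row s, Suc (col s)) (bet s)"
proof (rule belowI)
  fix \<omega> \<omega>' :: bits assume *: "\<And>q. q \<prec> (row s, Suc (col s)) \<Longrightarrow> \<omega> q = \<omega>' q"
  have "below (row s, Suc (col s)) (H s)"
    by (rule below_mono[OF below_H]) (simp add: lex_le_def lex_less_def)
  from belowD[OF this *] belowD[OF below_D *] show "bet s \<omega> = bet s \<omega>'"
    by (simp add: bet_def)
qed

lemma below_wealth:
  assumes "t \<le> idx p"
  shows "below p (wealth t)"
proof (rule belowI)
  fix \<omega> \<omega>' :: bits assume *: "\<And>q. q \<prec> p \<Longrightarrow> \<omega> q = \<omega>' q"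
  have "bet s \<omega> = bet s \<omega>'" if "s < t" for s
  proof -
    have "(row s, col s) \<prec> p" using that assms by (simp flip: less_idx_iff)
    from belowD[OF below_mono[OF below_bet lex_le_Suc[OF this]] *] show ?thesis .
  qed
  then show "wealth t \<omega> = wealth t \<omega>'" by (simp add: wealth_def)
qed

text \<open>Each bet from time \<open>idx p\<close> on concerns a bit that is resampled, so it has
  expectation zero.\<close>

lemma expect_from_wealth:
  assumes "idx p \<le> t"
  shows "expect_from p (wealth t) \<omega> = wealth (idx p) \<omega>"
  using assms
proof (induction t rule: dec_induct)
  case base
  show ?case by (rule expect_from_below[OF below_wealth]) simp
next
  case (step t)
  have "expect_from p (bet t) \<omega> = 0"
  proof (rule expect_from_antisymmetric[OF ucont_bet bet_flip])
    show "\<not> (row t, col t) \<prec> p" using step(1) less_idx_iff[of t p] by simp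
  qed
  then show ?case
    using step.IH unfolding wealth_Suc by (simp add: expect_from_add[OF ucont_wealth ucont_bet])
qed

lemma lex_martingale_wealth: "lex_martingale (\<lambda>p. wealth (idx p))"
  unfolding lex_martingale_def
proof (intro conjI allI impI)
  fix p q :: "nat \<times> nat"
  show "integrable coin (wealth (idx p))" by (rule ucont_integrable[OF ucont_wealth])
  show "depends_only_below p (wealth (idx p))"
    by (rule below_imp_depends_only_below[OF below_wealth]) simp
  assume "p \<preceq> q"
  from expect_from_wealth[OF idx_mono[OF this]]
  show "AE \<omega> in coin. expect_from p (wealth (idx q)) \<omega> = wealth (idx p) \<omega>" by simp
qed

lemma computable_rational_lex_wealth:
  assumes "\<And>t \<omega>. 0 \<le> wealth t \<omega>"
  shows "computable_rational_lex (\<lambda>p. wealth (idx p))"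
proof (rule computable_rational_lexI[OF _ assms])
  have "computable (Suc (Suc 0)) (\<lambda>\<omega> v. if k (v 0) \<le> v (Suc 0) then start (v 0) + k (v 0)
      else start (v 0) + v (Suc 0))"
    by (intro computable_intros computable_start computable_comp1[OF computable_k]
        computable_var) auto
  moreover have "idx (m, n) = (if k m \<le> n then start m + k m else start m + n)" for m n
    by (simp add: idx_def)
  ultimately have "computable (Suc (Suc 0)) (\<lambda>\<omega> v. idx (v 0, v (Suc 0)))" by simp
  then show "computable_rat (Suc (Suc 0)) (\<lambda>\<omega> v. wealth (idx (v 0, v (Suc 0))) \<omega>)"
    by (rule computable_rat_wealth)
qed

lemma wealth_witness:
  assumes nonneg: "\<And>t \<omega>. 0 \<le> wealth t \<omega>"
    and top: "filterlim (\<lambda>t. wealth t \<omega>) at_top sequentially"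
  shows "\<exists>M k. lex_martingale M \<and> computable_rational_lex M \<and> (\<forall>p \<omega>'. 0 \<le> M p \<omega>') \<and>
    computable_nat k \<and> (\<forall>m n. k m \<le> n \<longrightarrow> M (m, n) = M (Suc m, 0)) \<and>
    Liminf lex_at_top (\<lambda>p. ereal (M p \<omega>)) = \<infinity>"
proof (intro exI conjI)
  show "lex_martingale (\<lambda>p. wealth (idx p))" by (rule lex_martingale_wealth)
  show "computable_rational_lex (\<lambda>p. wealth (idx p))"
    by (rule computable_rational_lex_wealth[OF nonneg])
  show "\<forall>p \<omega>'. 0 \<le> wealth (idx p) \<omega>'" using nonneg by blast
  show "\<forall>m n. k m \<le> n \<longrightarrow> wealth (idx (m, n)) = wealth (idx (Suc m, 0))"
    by (simp add: idx_row_end)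
  obtain e where e: "\<And>\<omega> v. eval \<omega> e (map v [0..<Suc 0]) = Some (k (v 0))"
    using computableE[OF computable_k] by blast
  show "computable_nat k"
    unfolding computable_nat_def using e[of _ "\<lambda>_. _"] by auto
  have "filterlim (\<lambda>p. wealth (idx p) \<omega>) at_top lex_at_top"
    by (rule filterlim_compose[OF top filterlim_idx])
  then have "((\<lambda>p. ereal (wealth (idx p) \<omega>)) \<longlongrightarrow> \<infinity>) lex_at_top"
    by (simp add: tendsto_PInfty_eq_at_top)
  then show "Liminf lex_at_top (\<lambda>p. ereal (wealth (idx p) \<omega>)) = \<infinity>"
    by (rule lim_imp_Liminf[OF lex_at_top_neq_bot])
qed

end

end

lemma below_holding:
  assumes "\<And>t. t \<le> s \<Longrightarrow> below p (\<lambda>\<omega>. x \<omega> t)"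
  shows "below p (\<lambda>\<omega>. holding (x \<omega>) \<alpha> \<beta> s)"
proof (rule belowI)
  fix \<omega> \<omega>' :: bits assume *: "\<And>q. q \<prec> p \<Longrightarrow> \<omega> q = \<omega>' q"
  have "x \<omega> t = x \<omega>' t" if "t < Suc s" for t
    using belowD[OF assms *] that by simp
  then show "holding (x \<omega>) \<alpha> \<beta> s = holding (x \<omega>') \<alpha> \<beta> s"
    unfolding holding_def by (metis (no_types, lifting))
qed

section \<open>Comparison with the conditional expectations of \<open>N\<close>\<close>

context row_approximation
begin

lemma row_start_add: "n < k m \<Longrightarrow> row (start m + n) = m"
  using start_row_le[of "start m + n"] less_start_Suc_row[of "start m + n"]
    start_mono[of "Suc m" "row (start m + n)"] start_mono[of "Suc (row (start m + n))" m]
    start_Suc[of m]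
  by (cases "row (start m + n)" m rule: linorder_cases) auto

lemma D_start_add: "n < k m \<Longrightarrow> D (start m + n) \<omega> = avg m (Suc n) \<omega> - avg m n \<omega>"
  by (simp add: D_def col_def row_start_add)

lemma ucont_A: "ucont (A m)"
proof -
  have "A m = avg m (k m)" by (intro ext) (simp add: avg_end)
  then show ?thesis by (simp add: ucont_avg)
qed

text \<open>The remaining increments of the row have expectation zero, so averages defined by
  counting are true conditional expectations.\<close>

lemma expect_from_avg:
  assumes "n \<le> j" "j \<le> k m"
  shows "expect_from (m, n) (avg m j) \<omega> = avg m n \<omega>"
  using assms
proof (induction j rule: dec_induct)
  case base
  show ?case by (rule expect_from_below[OF below_avg])
next
  case (step j)
  then have j: "j < k m" by simp
  let ?t = "start m + j"
  have t: "row ?t = m" "col ?t = j" using row_start_add[OF j] by (simp_all add: col_def)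
  have "avg m (Suc j) = (\<lambda>\<omega>. avg m j \<omega> + D ?t \<omega>)"
    by (intro ext) (simp add: D_start_add[OF j])
  moreover have "expect_from (m, n) (D ?t) \<omega> = 0"
    by (rule expect_from_antisymmetric[OF ucont_D D_flip])
      (use t step(1) in \<open>simp add: lex_less_def\<close>)
  ultimately show ?case
    using step.IH j by (simp add: expect_from_add[OF ucont_avg ucont_D])
qed

lemma expect_from_A: "expect_from (m, n) (A m) \<omega> = avg m n \<omega>"
proof (cases "n \<le> k m")
  case True
  have "A m = avg m (k m)" by (intro ext) (simp add: avg_end)
  then show ?thesis using expect_from_avg[OF True] by simp
next
  case False
  then have "A m = avg m n" by (intro ext) (simp add: avg_end)
  then show ?thesis using expect_from_below[OF below_avg, of m n \<omega>] by simp
qed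

lemma A_approx: "\<bar>A m \<omega> - N (Suc m) \<omega>\<bar> \<le> 1 / 2 ^ m"
  using a_approx[of \<omega> "Suc m"] by (simp add: A_def)

lemma avg_approx: "\<bar>avg m n \<omega> - expect_from (m, n) (N (Suc m)) \<omega>\<bar> \<le> 1 / 2 ^ m"
  using expect_from_diff_le[OF ucont_A[of m] ucont_N[of "Suc m"] A_approx, of "(m, n)" \<omega>]
      by (simp add: expect_from_A)

text \<open>Compares the gain within row \<open>m\<close> with that of the conditional expectation
  of \<open>N (Suc m)\<close>. Both are measured from the start of the row, since the preceding row
  ends with a different approximation of \<open>N m\<close>.\<close>

definition row_error :: "nat \<Rightarrow> nat \<Rightarrow> bits \<Rightarrow> real" where
  "row_error m n \<omega> = (avg m n \<omega> - avg m 0 \<omega>) - (expect_from (m, n) (N (Suc m)) \<omega> - N m \<omega>)"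

definition full_row_error :: "nat \<Rightarrow> bits \<Rightarrow> real" where
  "full_row_error m \<omega> = (A m \<omega> - avg m 0 \<omega>) - (N (Suc m) \<omega> - N m \<omega>)"

text \<open>One approximation error at either end of the increment.\<close>

lemma row_error_le: "\<bar>row_error m n \<omega>\<bar> \<le> 2 / 2 ^ m"
  using avg_approx[of m n \<omega>] avg_approx[of m 0 \<omega>] N_martingale[of m "Suc m" \<omega>]
  by (simp add: row_error_def)

lemma full_row_error_le: "\<bar>full_row_error m \<omega>\<bar> \<le> 2 / 2 ^ m"
  using A_approx[of m \<omega>] avg_approx[of m 0 \<omega>] N_martingale[of m "Suc m" \<omega>]
  by (simp add: full_row_error_def)

lemma sum_D_start_add:
  "n \<le> k m \<Longrightarrow> (\<Sum>s<start m + n. D s \<omega>) = (\<Sum>s<start m. D s \<omega>) + avg m n \<omega> - avg m 0 \<omega>"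
  by (induction n) (auto simp: D_start_add)

lemma sum_D_start: "(\<Sum>s<start m. D s \<omega>) = N m \<omega> - N 0 \<omega> + (\<Sum>i<m. full_row_error i \<omega>)"
proof (induction m)
  case (Suc m)
  then show ?case
    using sum_D_start_add[where n = "k m" and m = m and \<omega> = \<omega>]
    by (simp add: start_Suc avg_end full_row_error_def)
qed (simp add: start_def)

text \<open>The increments of \<open>N\<close> over completed rows telescope, and the row in
  progress contributes its error up to column \<open>n\<close>.\<close>

lemma sum_D_idx:
  "(\<Sum>s<idx (m, n). D s \<omega>) = expect_from (m, n) (N (Suc m)) \<omega> - N 0 \<omega> +
    (\<Sum>i<m. full_row_error i \<omega>) + row_error m n \<omega>"
proof -
  have "avg m (min n (k m)) \<omega> = avg m n \<omega>"
    by (cases "n \<le> k m") (simp_all add: min_def avg_end)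
  then show ?thesis
    using sum_D_start_add[where n = "min n (k m)" and m = m and \<omega> = \<omega>] sum_D_start[of \<omega> m]
    by (simp add: idx_def row_error_def)
qed

text \<open>The errors of the completed rows, and one more for the row in progress.\<close>

lemma sum_two_powers: "(\<Sum>i<m. 2 / 2 ^ i :: real) + 2 / 2 ^ m \<le> 4"
proof -
  have "(\<Sum>i<m. 2 / 2 ^ i :: real) = 4 - 4 / 2 ^ m" by (induction m) auto
  then show ?thesis by simp
qed

lemma expect_from_N_nonneg: "0 \<le> expect_from p (N m) \<omega>"
  unfolding expect_from_def by (intro Bochner_Integration.integral_nonneg N_nonneg)

text \<open>No index precedes \<open>(0, 0)\<close>. The starting capital has to be a constant, so
  it must not depend on the oracle through \<open>N 0\<close>.\<close>

lemma N_0_const: "N 0 \<omega> = N 0 (\<lambda>_. False)"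
proof -
  have "expect_from (0, 0) (N 0) = N 0" by (intro ext N_martingale) simp
  then have "below (0, 0) (N 0)" using below_expect_from[of "(0, 0)" "N 0"] by simp
  then show ?thesis by (rule belowD) (simp add: lex_less_def)
qed

lemma sum_D_ge: "- N 0 (\<lambda>_. False) - 4 \<le> (\<Sum>s<t. D s \<omega>)"
proof -
  let ?m = "row t" and ?n = "col t"
  have "\<bar>\<Sum>i<?m. full_row_error i \<omega>\<bar> \<le> (\<Sum>i<?m. 2 / 2 ^ i)"
    by (intro order_trans[OF sum_abs] sum_mono full_row_error_le)
  then have "\<bar>(\<Sum>i<?m. full_row_error i \<omega>) + row_error ?m ?n \<omega>\<bar> \<le> 4"
    using row_error_le[of ?m ?n \<omega>] sum_two_powers[of ?m] by linarith
  then show ?thesis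
    using sum_D_idx[of \<omega> ?m ?n] expect_from_N_nonneg[of "(?m, ?n)" "Suc ?m" \<omega>] N_0_const[of \<omega>]
    unfolding idx_row_col by linarith
qed

text \<open>The summand \<open>4\<close> pays for the accumulated approximation errors, see \<open>sum_two_powers\<close>.\<close>

definition offset :: rat where
  "offset = of_nat (nat \<lceil>N 0 (\<lambda>_. False)\<rceil> + 4)"

definition X :: "nat \<Rightarrow> bits \<Rightarrow> real" where
  "X = wealth (\<lambda>_ _. True) offset"

lemma X_eq: "X t \<omega> = of_rat offset + (\<Sum>s<t. D s \<omega>)"
  using wealth_def[of "\<lambda>_ _. True"] bet_def[of "\<lambda>_ _. True"]
  by (simp add: X_def computable_const below_def)

lemma X_nonneg: "0 \<le> X t \<omega>"
proof -
  have "N 0 (\<lambda>_. False) + 4 \<le> of_rat offset"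
    by (simp add: offset_def of_rat_add real_nat_ceiling_ge)
  then show ?thesis using sum_D_ge[of \<omega> t] by (simp add: X_eq)
qed

lemma computable_rat_X: "computable n F \<Longrightarrow> computable_rat n (\<lambda>\<omega> v. X (F \<omega> v) \<omega>)"
  unfolding X_def by (rule computable_rat_wealth) (auto simp: computable_const below_def)

lemma below_X: "t \<le> idx p \<Longrightarrow> below p (X t)"
  unfolding X_def by (rule below_wealth) (auto simp: computable_const below_def)

text \<open>Solving \<open>sum_D_idx\<close> for the conditional expectation leaves \<open>X\<close>
  at time \<open>idx p\<close>, the partial sums of an absolutely convergent series and an error
  that tends to 0.\<close>

lemma tendsto_if_convergent_X:
  assumes "convergent (\<lambda>t. X t \<omega>)"
  shows "\<exists>y. ((\<lambda>p. expect_from p (N (Suc (fst p))) \<omega>) \<longlongrightarrow> y) lex_at_top"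
proof -
  obtain x where x: "(\<lambda>t. X t \<omega>) \<longlonglongrightarrow> x" using assms by (auto simp: convergent_def)
  have geo: "summable (\<lambda>i. 2 / 2 ^ i :: real)"
    using summable_mult[OF summable_geometric[of "1 / 2 :: real"], of 2]
    by (simp add: power_divide)
  have "summable (\<lambda>i. full_row_error i \<omega>)"
    by (rule summable_comparison_test[OF _ geo]) (use full_row_error_le in auto)
  then have S: "(\<lambda>m. \<Sum>i<m. full_row_error i \<omega>) \<longlonglongrightarrow> (\<Sum>i. full_row_error i \<omega>)"
    by (rule summable_LIMSEQ)
  have "((\<lambda>p. 2 / 2 ^ fst p :: real) \<longlongrightarrow> 0) lex_at_top"
    by (rule filterlim_compose[OF summable_LIMSEQ_zero[OF geo] filterlim_fst_lex_at_top])
  then have E: "((\<lambda>p. row_error (fst p) (snd p) \<omega>) \<longlongrightarrow> 0) lex_at_top"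
    by (rule Lim_null_comparison[rotated]) (simp add: row_error_le)
  have "((\<lambda>p. X (idx p) \<omega> - of_rat offset + N 0 \<omega> - (\<Sum>i<fst p. full_row_error i \<omega>) -
      row_error (fst p) (snd p) \<omega>) \<longlongrightarrow>
      x - of_rat offset + N 0 \<omega> - (\<Sum>i. full_row_error i \<omega>) - 0) lex_at_top"
    by (intro tendsto_intros E filterlim_compose[OF x filterlim_idx]
        filterlim_compose[OF S filterlim_fst_lex_at_top])
  moreover have "X (idx p) \<omega> - of_rat offset + N 0 \<omega> - (\<Sum>i<fst p. full_row_error i \<omega>) -
      row_error (fst p) (snd p) \<omega> = expect_from p (N (Suc (fst p))) \<omega>" for p
    using sum_D_idx[of \<omega> "fst p" "snd p"] by (simp add: X_eq)
  ultimately show ?thesis by auto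
qed

theorem ex_exploding_martingale:
  assumes "lex_diverges (\<lambda>p. expect_from p (N (Suc (fst p))) \<omega>)"
  shows "\<exists>M k. lex_martingale M \<and> computable_rational_lex M \<and> (\<forall>p \<omega>'. 0 \<le> M p \<omega>') \<and>
    computable_nat k \<and> (\<forall>m n. k m \<le> n \<longrightarrow> M (m, n) = M (Suc m, 0)) \<and>
    Liminf lex_at_top (\<lambda>p. ereal (M p \<omega>)) = \<infinity>"
proof -
  have nc: "\<not> convergent (\<lambda>t. X t \<omega>)"
    using assms tendsto_if_convergent_X unfolding lex_diverges_def by blast
  have nonneg: "0 \<le> X t \<omega>" for t by (rule X_nonneg)
  show ?thesis
  proof (rule nonconvergent_cases[of "\<lambda>t. X t \<omega>", OF nonneg nc])
    assume top: "filterlim (\<lambda>t. X t \<omega>) at_top sequentially"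
    show ?thesis
    proof (rule wealth_witness)
      show "0 \<le> wealth (\<lambda>_ _. True) offset t \<omega>'" for t \<omega>'
        using X_nonneg by (simp add: X_def)
      show "filterlim (\<lambda>t. wealth (\<lambda>_ _. True) offset t \<omega>) at_top sequentially"
        using top by (simp add: X_def)
    qed (auto simp: computable_const below_def)
  next
    fix \<alpha> \<beta> assume \<alpha>: "0 \<le> (of_rat \<alpha> :: real)" and \<alpha>\<beta>: "of_rat \<alpha> < (of_rat \<beta> :: real)"
      and low: "\<And>t. \<exists>s\<ge>t. X s \<omega> < of_rat \<alpha>" and high: "\<And>t. \<exists>s\<ge>t. of_rat \<beta> < X s \<omega>"
    define H where "H s \<omega> = holding (\<lambda>t. X t \<omega>) (of_rat \<alpha>) (of_rat \<beta>) s" for s \<omega>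
    have cfH: "computable (Suc 0) (\<lambda>\<omega> v. of_bool (H (v 0) \<omega>))"
      unfolding H_def holding_def
      by (intro computable_ex_less computable_all_less computable_conj computable_imp
          computable_not computable_le computable_rat_less computable_rat_X computable_rat_const
          computable_Suc computable_var) auto
    \<comment> \<open>The prices up to time \<open>s\<close> are already known while the bit of time
      \<open>s\<close> is still unread.\<close>
    have belowH: "below (row s, col s) (H s)" for s
      unfolding H_def by (rule below_holding, rule below_X) (simp add: idx_row_col)
    \<comment> \<open>Taking \<open>\<alpha>\<close> as initial wealth matches
      \<open>capital\<close>; \<open>offset\<close> cancels from the price differences.\<close>
    have w: "wealth H \<alpha> t \<omega>' = capital (\<lambda>t. X t \<omega>') (of_rat \<alpha>) (of_rat \<beta>) t" for t \<omega>'
      using wealth_def[OF cfH belowH] bet_def[OF cfH belowH]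
      by (simp add: capital_def X_eq H_def cong: if_cong)
    show ?thesis
    proof (rule wealth_witness[OF cfH belowH])
      show "0 \<le> wealth H \<alpha> t \<omega>'" for t \<omega>'
        unfolding w by (rule capital_nonneg[OF \<alpha> \<alpha>\<beta> X_nonneg])
      show "filterlim (\<lambda>t. wealth H \<alpha> t \<omega>) at_top sequentially"
        unfolding w by (rule capital_at_top[OF \<alpha> \<alpha>\<beta> X_nonneg low high])
    qed
  qed
qed

end

section \<open>Equivalence with Doob randomness\<close>

lemma ucont_approxI:
  assumes "\<And>i. \<exists>c u. (\<forall>\<omega> \<omega>'. agree u \<omega> \<omega>' \<longrightarrow> c \<omega> = c \<omega>') \<and>
    (\<forall>\<omega>. \<bar>enum_rat (c \<omega>) - f \<omega>\<bar> \<le> 1 / 2 ^ i)"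
  shows "ucont f"
  unfolding ucont_def
proof (intro allI impI)
  fix \<epsilon> :: real assume "0 < \<epsilon>"
  then obtain i where "(1 / 2) ^ i < \<epsilon> / 2"
    using real_arch_pow_inv[of "\<epsilon> / 2" "1 / 2"] by auto
  then have i: "1 / 2 ^ i < \<epsilon> / 2" by (simp add: power_divide)
  obtain c u where c: "\<And>\<omega> \<omega>'. agree u \<omega> \<omega>' \<Longrightarrow> c \<omega> = c \<omega>'"
    "\<And>\<omega>. \<bar>enum_rat (c \<omega>) - f \<omega>\<bar> \<le> 1 / 2 ^ i"
    using assms[of i] by blast
  have "\<bar>f \<omega> - f \<omega>'\<bar> < \<epsilon>" if "agree u \<omega> \<omega>'" for \<omega> \<omega>'
    using c(1)[OF that] c(2)[of \<omega>] c(2)[of \<omega>'] i by simp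
  then show "\<exists>k. \<forall>\<omega> \<omega>'. agree k \<omega> \<omega>' \<longrightarrow> \<bar>f \<omega> - f \<omega>'\<bar> < \<epsilon>" by blast
qed

lemma computable_uniform:
  assumes "computable n F"
  shows "\<exists>u. \<forall>\<omega> \<omega>'. agree u \<omega> \<omega>' \<longrightarrow> F \<omega> v = F \<omega>' v"
  using locally_constant_uniform(2)[of "\<lambda>\<omega>. F \<omega> v"]
      computable_locally_constant[OF assms, of _ v] by blast

lemma map_upt_literal:
  "map v [0..<Suc (Suc 0)] = [v 0, v (Suc 0)]"
  "map v [0..<Suc (Suc (Suc 0))] = [v 0, v (Suc 0), v (Suc (Suc 0))]"
  by (simp_all add: upt_rec)

text \<open>Oracle substitution turns access to the truncated oracle into access to the full one,
  with the number of rows as parameter.\<close>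

lemma computable_rows_code:
  assumes "computable_rows N"
  obtains c where "computable (Suc (Suc 0)) (\<lambda>\<omega> v. c \<omega> (v 0) (v (Suc 0)))"
    "\<And>\<omega> m i. \<bar>enum_rat (c \<omega> m i) - N m \<omega>\<bar> \<le> 1 / 2 ^ i"
    "\<And>m i. below (m, 0) (\<lambda>\<omega>. c \<omega> m i)"
proof -
  obtain e where e: "\<And>m \<omega>. computes_real e (first_rows m \<omega>) [m] (N m \<omega>)"
    using assms unfolding computable_rows_def by blast
  define c where "c \<omega> m i = the (eval (first_rows m \<omega>) e [m, i])" for \<omega> m i
  have ev: "eval (first_rows m \<omega>) e [m, i] = Some (c \<omega> m i)"
    and approx: "\<bar>enum_rat (c \<omega> m i) - N m \<omega>\<bar> \<le> 1 / 2 ^ i" for \<omega> m i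
    using e[of m \<omega>] unfolding computes_real_def c_def by (auto dest!: spec[of _ i])
  have "computable (Suc (Suc (Suc 0))) (\<lambda>\<omega> v. of_bool (v 0 < v (Suc (Suc 0)) \<and> \<omega> (v 0, v (Suc 0))))"
    by (intro computable_intros computable_var) auto
  then obtain q where q: "\<And>\<omega> v. eval \<omega> q (map v [0..<Suc (Suc (Suc 0))]) =
      Some (of_bool (v 0 < v (Suc (Suc 0)) \<and> \<omega> (v 0, v (Suc 0))))" using computableE by blast
  have q': "eval \<omega> q [i, j, m] = Some (of_bool (first_rows m \<omega> (i, j)))" for \<omega> i j m
    using q[of \<omega> "case_nat i (case_nat j (\<lambda>_. m))"]
    unfolding map_upt_literal by (simp add: first_rows_def)
  have "\<exists>e'. \<forall>\<omega> ys xs y. length xs = 2 \<longrightarrow> length ys = 1 \<longrightarrow>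
      eval (first_rows (hd ys) \<omega>) e xs = Some y \<longrightarrow> eval \<omega> e' (xs @ ys) = Some y"
  proof (rule eval_oracle_subst)
    fix \<omega> and ys :: "nat list" and i j assume "length ys = 1"
    then obtain m where "ys = [m]" by (cases ys) auto
    then show "eval \<omega> q (i # j # ys) = Some (of_bool (first_rows (hd ys) \<omega> (i, j)))"
      using q' by simp
  qed
  then obtain e' where e': "\<And>\<omega> ys xs y. length xs = 2 \<Longrightarrow> length ys = 1 \<Longrightarrow>
      eval (first_rows (hd ys) \<omega>) e xs = Some y \<Longrightarrow> eval \<omega> e' (xs @ ys) = Some y" by blast
  \<comment> \<open>\<open>m\<close> appears as an input of \<open>e\<close> and again as the
    parameter of the truncation.\<close>
  have ev': "eval \<omega> e' [m, i, m] = Some (c \<omega> m i)" for \<omega> m i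
    using e'[of "[m, i]" "[m]" \<omega>] ev by simp
  have cfc: "computable (Suc (Suc 0)) (\<lambda>\<omega> v. c \<omega> (v 0) (v (Suc 0)))"
  proof (rule computableI)
    fix \<omega> and v :: "nat \<Rightarrow> nat"
    show "eval \<omega> (Comp e' [Proj 0, Proj 1, Proj 0]) (map v [0..<Suc (Suc 0)]) =
        Some (c \<omega> (v 0) (v (Suc 0)))"
      by (rule eval_CompI[OF _ ev']) (simp add: map_upt_literal)
  qed
  have below: "below (m, 0) (\<lambda>\<omega>. c \<omega> m i)" for m i
  proof (rule belowI)
    fix \<omega> \<omega>' :: bits assume "\<And>q. q \<prec> (m, 0) \<Longrightarrow> \<omega> q = \<omega>' q"
    then have "first_rows m \<omega> = first_rows m \<omega>'"
      by (auto simp: first_rows_def lex_less_def fun_eq_iff)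
    then show "c \<omega> m i = c \<omega>' m i" by (simp add: c_def)
  qed
  from cfc approx below show thesis by (rule that)
qed

lemma ex_row_approximation:
  assumes mart: "row_martingale N" and comp: "computable_rows N" and nonneg: "\<And>m \<omega>. 0 \<le> N m \<omega>"
  shows "\<exists>a k. row_approximation N a k"
proof -
  obtain c where c: "computable (Suc (Suc 0)) (\<lambda>\<omega> v. c \<omega> (v 0) (v (Suc 0)))"
    "\<And>\<omega> m i. \<bar>enum_rat (c \<omega> m i) - N m \<omega>\<bar> \<le> 1 / 2 ^ i"
    "\<And>m i. below (m, 0) (\<lambda>\<omega>. c \<omega> m i)"
    using computable_rows_code[OF comp] by blast
  have uc: "ucont (N m)" for m
  proof (rule ucont_approxI)
    fix i
    show "\<exists>d u. (\<forall>\<omega> \<omega>'. agree u \<omega> \<omega>' \<longrightarrow> d \<omega> = d \<omega>') \<and>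
        (\<forall>\<omega>. \<bar>enum_rat (d \<omega>) - N m \<omega>\<bar> \<le> 1 / 2 ^ i)"
      using computable_uniform[OF c(1), of "case_nat m (\<lambda>_. i)"] c(2)[of _ m i]
      by (intro exI[of _ "\<lambda>\<omega>. c \<omega> m i"]) auto
  qed
  define a where "a \<omega> m = approx_code (c \<omega> m m) m" for \<omega> m
  have cfa: "computable (Suc 0) (\<lambda>\<omega> v. a \<omega> (v 0))"
    unfolding a_def by (intro computable_approx_code computable_comp2[OF c(1)] computable_var) auto
  have "computable (Suc 0) (\<lambda>\<omega> v. a \<omega> (Suc (v 0)))"
    by (intro computable_comp1[OF cfa] computable_Suc computable_var) auto
  then obtain K where K: "computable (Suc 0) (\<lambda>\<omega> v. K (v 0))"
    "\<And>m \<omega> \<omega>'. agree (K m) \<omega> \<omega>' \<Longrightarrow> a \<omega> (Suc m) = a \<omega>' (Suc m)"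
    using computable_fan[of "\<lambda>\<omega> m. a \<omega> (Suc m)"] by blast
  \<comment> \<open>The successor makes the modulus positive and keeps it a modulus.\<close>
  have "row_approximation N a (\<lambda>m. Suc (K m))"
  proof
    show "ucont (N m)" "0 \<le> N m \<omega>" for m \<omega> by (rule uc, rule nonneg)
    show "expect_from (j, 0) (N m) \<omega> = N j \<omega>" if "j \<le> m" for j m \<omega>
      using mart that unfolding row_martingale_def by (intro ucont_AE_eq ucont_expect_from uc) auto
    show "computable (Suc 0) (\<lambda>\<omega> v. a \<omega> (v 0))" by (rule cfa)
    show "\<bar>real (a \<omega> m) / 2 ^ m - N m \<omega>\<bar> \<le> 2 / 2 ^ m" for \<omega> m
    proof -
      \<comment> \<open>Replacing a negative value by 0 brings it closer to the nonnegative
        \<open>N m \<omega>\<close>.\<close>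
      have "\<bar>max 0 (enum_rat (c \<omega> m m)) - N m \<omega>\<bar> \<le> 1 / 2 ^ m"
        using c(2)[of \<omega> m m] nonneg[of m \<omega>] by (auto simp: max_def)
      then show ?thesis using approx_code_error[of "c \<omega> m m" m] unfolding a_def by linarith
    qed
    show "below (m, 0) (\<lambda>\<omega>. a \<omega> m)" for m
      using c(3)[of m m] unfolding below_def a_def by metis
    show "computable (Suc 0) (\<lambda>\<omega> v. Suc (K (v 0)))" by (rule computable_Suc[OF K(1)])
    show "a \<omega> (Suc m) = a \<omega>' (Suc m)" if "agree (Suc (K m)) \<omega> \<omega>'" for m \<omega> \<omega>'
      using K(2)[OF agree_mono[OF that]] by simp
  qed simp
  then show ?thesis by blast
qed

lemma computable_lex_if_rational:
  assumes "computable_rational_lex M"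
  shows "computable_lex M"
proof -
  obtain e where e: "\<And>m n \<omega>. \<exists>c. eval \<omega> e [m, n] = Some c \<and> M (m, n) \<omega> = enum_rat c"
    using assms unfolding computable_rational_lex_def by blast
  \<comment> \<open>The exact value serves for every precision, so the precision is dropped.\<close>
  have "computes_real (Comp e [Proj 0, Proj 1]) \<omega> [m, n] (M (m, n) \<omega>)" for m n \<omega>
    unfolding computes_real_def
  proof
    fix i
    obtain c where c: "eval \<omega> e [m, n] = Some c" "M (m, n) \<omega> = enum_rat c" using e by blast
    have "eval \<omega> (Comp e [Proj 0, Proj 1]) ([m, n] @ [i]) = Some c"
      by (rule eval_CompI[OF _ c(1)]) simp
    then show "\<exists>c. eval \<omega> (Comp e [Proj 0, Proj 1]) ([m, n] @ [i]) = Some c \<and>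
        \<bar>enum_rat c - M (m, n) \<omega>\<bar> \<le> 1 / 2 ^ i" using c(2) by simp
  qed
  then show ?thesis unfolding computable_lex_def by blast
qed

lemma ucont_computable_lex:
  assumes "computable_lex M"
  shows "ucont (M p)"
proof (rule ucont_approxI)
  fix i
  obtain m n where p: "p = (m, n)" by fastforce
  obtain e where e: "\<And>m n \<omega>. computes_real e \<omega> [m, n] (M (m, n) \<omega>)"
    using assms unfolding computable_lex_def by blast
  define c where "c \<omega> m n i = the (eval \<omega> e [m, n, i])" for \<omega> m n i
  have c: "eval \<omega> e [m, n, i] = Some (c \<omega> m n i)"
    "\<bar>enum_rat (c \<omega> m n i) - M (m, n) \<omega>\<bar> \<le> 1 / 2 ^ i" for \<omega> m n i
    using e[of \<omega> m n] unfolding computes_real_def c_def by (auto dest!: spec[of _ i])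
  have computable: "computable (Suc (Suc (Suc 0))) (\<lambda>\<omega> v. c \<omega> (v 0) (v (Suc 0)) (v (Suc (Suc 0))))"
    by (rule computableI[of e]) (simp only: map_upt_literal c(1))
  show "\<exists>d u. (\<forall>\<omega> \<omega>'. agree u \<omega> \<omega>' \<longrightarrow> d \<omega> = d \<omega>') \<and>
      (\<forall>\<omega>. \<bar>enum_rat (d \<omega>) - M p \<omega>\<bar> \<le> 1 / 2 ^ i)"
    using computable_uniform[OF computable, of
        "case_nat m (case_nat n (\<lambda>_. i))"] c(2)[where m = m and n = n and i = i]
    unfolding p by (intro exI[of _ "\<lambda>\<omega>. c \<omega> m n i"]) auto
qed

lemma lex_martingale_expect_from:
  fixes p q :: "nat \<times> nat"
  assumes "lex_martingale M" "computable_lex M" "p \<preceq> q"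
  shows "expect_from p (M q) \<omega> = M p \<omega>"
proof (rule ucont_AE_eq)
  show "AE \<omega> in coin. expect_from p (M q) \<omega> = M p \<omega>"
    using assms(1,3) unfolding lex_martingale_def by blast
qed (intro ucont_expect_from ucont_computable_lex assms(2))+

lemma lex_le_row_start: "j \<le> m \<Longrightarrow> (j, 0) \<preceq> (m, 0)"
  by (auto simp: lex_le_def lex_less_def)

lemma row_martingale_row_starts:
  assumes "lex_martingale M"
  shows "row_martingale (\<lambda>m. M (m, 0))"
  using assms lex_le_row_start unfolding lex_martingale_def row_martingale_def by blast

text \<open>The truncated oracles form a null set, so dependence on the first rows almost surely
  would not suffice; by continuity it holds at every oracle.\<close>

lemma computable_rows_row_starts:
  assumes M: "lex_martingale M" and comp: "computable_lex M"
  shows "computable_rows (\<lambda>m. M (m, 0))"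
proof -
  obtain e where e: "\<And>m n \<omega>. computes_real e \<omega> [m, n] (M (m, n) \<omega>)"
    using comp unfolding computable_lex_def by blast
  have "computes_real (Comp e [Proj 0, Zero, Proj 1]) (first_rows m \<omega>) [m] (M (m, 0) \<omega>)" for m \<omega>
    unfolding computes_real_def
  proof
    fix i
    have "expect_from (m, 0) (M (m, 0)) = M (m, 0)"
      by (intro ext lex_martingale_expect_from M comp) (simp add: lex_le_def)
    then have "below (m, 0) (M (m, 0))" using below_expect_from[of "(m, 0)" "M (m, 0)"] by simp
    then have eq: "M (m, 0) (first_rows m \<omega>) = M (m, 0) \<omega>"
      by (rule belowD) (auto simp: first_rows_def lex_less_def)
    obtain c where c: "eval (first_rows m \<omega>) e [m, 0, i] = Some c"
      "\<bar>enum_rat c - M (m, 0) (first_rows m \<omega>)\<bar> \<le> 1 / 2 ^ i"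
      using e[of "first_rows m \<omega>" m 0] unfolding computes_real_def by auto
    have "eval (first_rows m \<omega>) (Comp e [Proj 0, Zero, Proj 1]) ([m] @ [i]) = Some c"
      by (rule eval_CompI[OF _ c(1)]) simp
    then show "\<exists>c. eval (first_rows m \<omega>) (Comp e [Proj 0, Zero, Proj 1]) ([m] @ [i]) = Some c \<and>
        \<bar>enum_rat c - M (m, 0) \<omega>\<bar> \<le> 1 / 2 ^ i" using c(2) eq by auto
  qed
  then show ?thesis unfolding computable_rows_def by blast
qed

text \<open>The strongest of the equivalent conditions, through which the others are
  connected.\<close>

definition exploding :: "bits \<Rightarrow> bool" where
  "exploding \<omega> \<longleftrightarrow> (\<exists>M k. lex_martingale M \<and> computable_rational_lex M \<and> (\<forall>p \<omega>'. 0 \<le> M p \<omega>') \<and>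
    computable_nat k \<and> (\<forall>m n. k m \<le> n \<longrightarrow> M (m, n) = M (Suc m, 0)) \<and>
    Liminf lex_at_top (\<lambda>p. ereal (M p \<omega>)) = \<infinity>)"

lemma exploding_if_not_Doob_random:
  assumes "\<not> Doob_random \<omega>"
  shows "exploding \<omega>"
proof -
  obtain N where N: "row_martingale N" "computable_rows N" "\<And>m \<omega>. 0 \<le> N m \<omega>"
    "\<not> convergent (\<lambda>m. N m \<omega>)"
    using assms unfolding Doob_random_def by blast
  obtain a k where "row_approximation N a k" using ex_row_approximation[OF N(1-3)] by blast
  then interpret row_approximation N a k .
  have "lex_diverges (\<lambda>p. expect_from p (N (Suc (fst p))) \<omega>)"
    unfolding lex_diverges_def
  proof
    assume "\<exists>y. ((\<lambda>p. expect_from p (N (Suc (fst p))) \<omega>) \<longlongrightarrow> y) lex_at_top"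
    then obtain y where "((\<lambda>p. expect_from p (N (Suc (fst p))) \<omega>) \<longlongrightarrow> y) lex_at_top" by blast
    \<comment> \<open>At the start of row \<open>m\<close> the conditional expectation is
      \<open>N m \<omega>\<close>, so a limit over pairs would be a limit of the row
      martingale.\<close>
    from filterlim_compose[OF this filterlim_row_starts]
    have "(\<lambda>m. N m \<omega>) \<longlonglongrightarrow> y" by (simp add: N_martingale)
    then show False using N(4) by (auto simp: convergent_def)
  qed
  then show ?thesis unfolding exploding_def by (rule ex_exploding_martingale)
qed

lemma exploding_if_lex_diverges:
  assumes M: "lex_martingale M" "computable_lex M" "\<And>p \<omega>. 0 \<le> M p \<omega>"
    and div: "lex_diverges (\<lambda>p. M p \<omega>)"
  shows "exploding \<omega>"
proof -
  obtain a k where "row_approximation (\<lambda>m. M (m, 0)) a k"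
    using ex_row_approximation[OF row_martingale_row_starts[OF M(1)]
        computable_rows_row_starts[OF M(1,2)] M(3)] by blast
  then interpret row_approximation "\<lambda>m. M (m, 0)" a k .
  \<comment> \<open>\<open>(m, n)\<close> precedes \<open>(Suc m, 0)\<close>, so a lexicographic
    martingale is recovered from its values at the starts of rows.\<close>
  have "expect_from p (M (Suc (fst p), 0)) \<omega> = M p \<omega>" for p
    by (rule lex_martingale_expect_from[OF M(1,2)]) (simp add: lex_le_def lex_less_def)
  then show ?thesis
    unfolding exploding_def using div by (intro ex_exploding_martingale) simp
qed

lemma not_Doob_random_if_exploding:
  assumes "exploding \<omega>"
  shows "\<not> Doob_random \<omega>"
proof
  assume dr: "Doob_random \<omega>"
  obtain M where M: "lex_martingale M" "computable_rational_lex M" "\<And>p \<omega>. 0 \<le> M p \<omega>"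
    "Liminf lex_at_top (\<lambda>p. ereal (M p \<omega>)) = \<infinity>"
    using assms unfolding exploding_def by blast
  have "convergent (\<lambda>m. M (m, 0) \<omega>)"
    using dr row_martingale_row_starts[OF M(1)]
      computable_rows_row_starts[OF M(1) computable_lex_if_rational[OF M(2)]] M(3)
    unfolding Doob_random_def by blast
  then obtain y where y: "(\<lambda>m. M (m, 0) \<omega>) \<longlonglongrightarrow> y" by (auto simp: convergent_def)
  \<comment> \<open>The lower limit exceeds every real, in particular one more than the alleged
    limit along the row starts.\<close>
  have "eventually (\<lambda>p. ereal (y + 1) < ereal (M p \<omega>)) lex_at_top"
    by (rule less_LiminfD) (simp add: M(4))
  then have "eventually (\<lambda>m. ereal (y + 1) < ereal (M (m, 0) \<omega>)) sequentially"
    by (rule eventually_compose_filterlim[OF _ filterlim_row_starts])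
  moreover have "eventually (\<lambda>m. M (m, 0) \<omega> < y + 1) sequentially"
    by (rule order_tendstoD(2)[OF y]) simp
  ultimately have "eventually (\<lambda>m. False) sequentially" by eventually_elim simp
  then show False by simp
qed

lemma lex_diverges_if_Liminf:
  assumes "Liminf lex_at_top (\<lambda>p. ereal (x p)) = \<infinity>"
  shows "lex_diverges x"
  unfolding lex_diverges_def
proof
  assume "\<exists>y. (x \<longlongrightarrow> y) lex_at_top"
  then obtain y where "(x \<longlongrightarrow> y) lex_at_top" by blast
  then have "((\<lambda>p. ereal (x p)) \<longlongrightarrow> ereal y) lex_at_top" by simp
  from lim_imp_Liminf[OF lex_at_top_neq_bot this] show False using assms by simp
qed

theorem theorem5p4:
  fixes \<omega> :: "nat \<times> nat \<Rightarrow> bool"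
  shows
    "(\<not> Doob_random \<omega> \<longleftrightarrow>
        (\<exists>M. lex_martingale M \<and> computable_lex M \<and> (\<forall>p \<omega>'. 0 \<le> M p \<omega>') \<and>
          lex_diverges (\<lambda>p. M p \<omega>))) \<and>
     (\<not> Doob_random \<omega> \<longleftrightarrow>
        (\<exists>M. lex_martingale M \<and> computable_rational_lex M \<and> (\<forall>p \<omega>'. 0 \<le> M p \<omega>') \<and>
          lex_diverges (\<lambda>p. M p \<omega>))) \<and>
     (\<not> Doob_random \<omega> \<longleftrightarrow>
        (\<exists>M k. lex_martingale M \<and> computable_rational_lex M \<and> (\<forall>p \<omega>'. 0 \<le> M p \<omega>') \<and>
          computable_nat k \<and> (\<forall>m n. k m \<le> n \<longrightarrow> M (m, n) = M (Suc m, 0)) \<and>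
          Liminf lex_at_top (\<lambda>p. ereal (M p \<omega>)) = \<infinity>))"
proof -
  let ?P2 = "\<exists>M. lex_martingale M \<and> computable_lex M \<and> (\<forall>p \<omega>'. 0 \<le> M p \<omega>') \<and>
    lex_diverges (\<lambda>p. M p \<omega>)"
  let ?P3 = "\<exists>M. lex_martingale M \<and> computable_rational_lex M \<and> (\<forall>p \<omega>'. 0 \<le> M p \<omega>') \<and>
    lex_diverges (\<lambda>p. M p \<omega>)"
  have ?P3 if exp: "exploding \<omega>"
  proof -
    obtain M where "lex_martingale M" "computable_rational_lex M" "\<forall>p \<omega>'. 0 \<le> M p \<omega>'"
      "Liminf lex_at_top (\<lambda>p. ereal (M p \<omega>)) = \<infinity>"
      using exp unfolding exploding_def by blast
    then show ?thesis using lex_diverges_if_Liminf[of "\<lambda>p. M p \<omega>"] by blast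
  qed
  moreover have "?P3 \<Longrightarrow> ?P2" using computable_lex_if_rational by blast
  moreover have "?P2 \<Longrightarrow> exploding \<omega>" using exploding_if_lex_diverges by blast
  moreover have "\<not> Doob_random \<omega> \<longleftrightarrow> exploding \<omega>"
    using exploding_if_not_Doob_random not_Doob_random_if_exploding by blast
  ultimately show ?thesis unfolding exploding_def by argo
qed

end
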